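(* Let $\Omega\subset\mathbb{R}^2$ be a bounded domain of class $C^{2+\alpha}$ with $0<\alpha<1$, let $d\in C^{2+\alpha}(\overline\Omega)$ be a function which coincides with the distance function to $\partial\Omega$ near $\partial\Omega$ and is positive in $\Omega$, and let $u_\Omega$ be the maximal solution of the Liouville equation $-\Delta u+4e^{2u}=0$ in $\Omega$. Let $u_\Omega=v+w$ be a decomposition of $u_\Omega$ such that (P1) $w\in C^{1+\alpha}(\overline\Omega)\cap C^2(\Omega)$; (P2) $w=O(d)$ as $d\to0$; (P3) $e^v=O(1/d)$ as $d\to0$; (P4) $r[v]:=-\Delta v+4e^{2v}=O(1/d)$ as $d\to0$. For $\phi\in H^1_0(\Omega)$ let \[ R[\phi,v]:=\int_\Omega |\nabla\phi|^2+4e^{2v}\left[e^{2\phi}-1-2\phi\right]+2r[v]\phi . \] Then the infimum \[ \inf\{R[\psi-v,v] : \psi\in v+H^1_0(\Omega)\} \] is attained precisely for $\psi=u_\Omega$. (Equivalently: for all $\phi\in H^1_0(\Omega)$, $R[\phi,v]\geq R[w,v]$, with equality if and only if $\phi=w$.)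
   Context: The maximal solution $u_\Omega$ of $-\Delta u+4e^{2u}=0$ in $\Omega$ is the largest solution in $\Omega$; it is known to be the supremum of all solutions of the Dirichlet problem for this equation in $\Omega$ with smooth boundary data, and to be equivalent to $-\ln(2d)$ near $\partial\Omega$. Decompositions $u_\Omega=v+w$ with properties (P1)-(P4) are known to exist; one may for instance take $v=-\ln(2d)$. Functions are real-valued and integrals are with respect to Lebesgue measure. The functional $R[\phi,v]$ is well-defined (the integrand is integrable) for every $\phi\in H^1_0(\Omega)$. *)

theory Defs
  imports "HOL-Analysis.Analysis" "HOL-Library.Landau_Symbols"
begin

section \<open>Classical derivatives and Hoelder spaces\<close>

definition partial :: "'a::euclidean_space \<Rightarrow> ('a \<Rightarrow> real) \<Rightarrow> 'a \<Rightarrow> real" where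
  "partial b f x = deriv (\<lambda>t. f (x + t *\<^sub>R b)) 0"

definition laplacian :: "('a::euclidean_space \<Rightarrow> real) \<Rightarrow> 'a \<Rightarrow> real" where
  "laplacian f x = (\<Sum>b\<in>Basis. partial b (partial b f) x)"

text \<open>The sets \<open>U\<close> and \<open>\<Omega>\<close> below are meant to be open; all notions then depend only on the
  values of the functions inside these sets.\<close>

primrec C_diff :: "nat \<Rightarrow> 'a::euclidean_space set \<Rightarrow> ('a \<Rightarrow> real) \<Rightarrow> bool" where
  "C_diff 0 U f \<longleftrightarrow> continuous_on U f"
| "C_diff (Suc k) U f \<longleftrightarrow> f differentiable_on U \<and> (\<forall>b\<in>Basis. C_diff k U (partial b f))"

definition holder_on :: "real \<Rightarrow> 'a::metric_space set \<Rightarrow> ('a \<Rightarrow> real) \<Rightarrow> bool" where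
  "holder_on \<alpha> S f \<longleftrightarrow> (\<exists>C. \<forall>x\<in>S. \<forall>y\<in>S. \<bar>f x - f y\<bar> \<le> C * dist x y powr \<alpha>)"

definition extends_to_closure :: "'a::topological_space set \<Rightarrow> ('a \<Rightarrow> real) \<Rightarrow> bool" where
  "extends_to_closure \<Omega> f \<longleftrightarrow> (\<exists>g. continuous_on (closure \<Omega>) g \<and> (\<forall>x\<in>\<Omega>. g x = f x))"

text \<open>\<open>C_holder k \<alpha> \<Omega> f\<close> is \<open>f \<in> C\<^sup>k\<^sup>+\<^sup>\<alpha>\<close> on the closure of \<open>\<Omega>\<close>: all partial derivatives
  up to order \<open>k\<close> extend continuously to the closure, and those of order \<open>k\<close> are
  \<open>\<alpha>\<close>-Hoelder continuous on \<open>\<Omega>\<close>.\<close>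

primrec C_holder :: "nat \<Rightarrow> real \<Rightarrow> 'a::euclidean_space set \<Rightarrow> ('a \<Rightarrow> real) \<Rightarrow> bool" where
  "C_holder 0 \<alpha> \<Omega> f \<longleftrightarrow> extends_to_closure \<Omega> f \<and> holder_on \<alpha> \<Omega> f"
| "C_holder (Suc k) \<alpha> \<Omega> f \<longleftrightarrow>
     extends_to_closure \<Omega> f \<and> f differentiable_on \<Omega> \<and> (\<forall>b\<in>Basis. C_holder k \<alpha> \<Omega> (partial b f))"

section \<open>Domains\<close>

text \<open>Near each boundary point, \<open>\<Omega>\<close> is the region above the graph of a function of class
  \<open>C\<^sup>k\<^sup>+\<^sup>\<alpha>\<close> in some Cartesian coordinates \<open>(e \<bullet> x, e' \<bullet> x)\<close>. Taking the function on the whole line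
  is no restriction.\<close>

definition holder_domain :: "nat \<Rightarrow> real \<Rightarrow> (real^2) set \<Rightarrow> bool" where
  "holder_domain k \<alpha> \<Omega> \<longleftrightarrow>
     open \<Omega> \<and> connected \<Omega> \<and> \<Omega> \<noteq> {} \<and>
     (\<forall>p\<in>frontier \<Omega>. \<exists>r>0. \<exists>e e' \<gamma>.
        norm e = 1 \<and> norm e' = 1 \<and> e \<bullet> e' = 0 \<and> C_holder k \<alpha> (UNIV :: real set) \<gamma> \<and>
        (\<forall>x\<in>ball p r. x \<in> \<Omega> \<longleftrightarrow> \<gamma> (e \<bullet> x) < e' \<bullet> x))"

definition is_boundary_distance :: "(real^2) set \<Rightarrow> (real^2 \<Rightarrow> real) \<Rightarrow> bool" where
  "is_boundary_distance \<Omega> d \<longleftrightarrow>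
     (\<forall>x\<in>\<Omega>. d x > 0) \<and>
     (\<exists>\<delta>>0. \<forall>x\<in>\<Omega>. infdist x (frontier \<Omega>) < \<delta> \<longrightarrow> d x = infdist x (frontier \<Omega>))"

text \<open>The filter \<open>d \<rightarrow> 0\<close> inside \<open>\<Omega>\<close>.\<close>

definition bdry :: "(real^2) set \<Rightarrow> (real^2 \<Rightarrow> real) \<Rightarrow> (real^2) filter" where
  "bdry \<Omega> d = inf (filtercomap d (at_right 0)) (principal \<Omega>)"

section \<open>The Liouville equation\<close>

definition liouville_residual :: "(real^2 \<Rightarrow> real) \<Rightarrow> real^2 \<Rightarrow> real" where
  "liouville_residual v x = - laplacian v x + 4 * exp (2 * v x)"

definition liouville_solution :: "(real^2) set \<Rightarrow> (real^2 \<Rightarrow> real) \<Rightarrow> bool" where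
  "liouville_solution \<Omega> u \<longleftrightarrow> C_diff 2 \<Omega> u \<and> (\<forall>x\<in>\<Omega>. liouville_residual u x = 0)"

definition maximal_liouville_solution :: "(real^2) set \<Rightarrow> (real^2 \<Rightarrow> real) \<Rightarrow> bool" where
  "maximal_liouville_solution \<Omega> u \<longleftrightarrow>
     liouville_solution \<Omega> u \<and> (\<forall>u'. liouville_solution \<Omega> u' \<longrightarrow> (\<forall>x\<in>\<Omega>. u' x \<le> u x))"

section \<open>Sobolev spaces\<close>

definition test_functions :: "'a::euclidean_space set \<Rightarrow> ('a \<Rightarrow> real) set" where
  "test_functions \<Omega> =
     {\<eta>. (\<forall>k. C_diff k UNIV \<eta>) \<and> (\<exists>K. compact K \<and> K \<subseteq> \<Omega> \<and> (\<forall>x. x \<notin> K \<longrightarrow> \<eta> x = 0))}"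

definition locally_integrable ::
    "'a::euclidean_space set \<Rightarrow> ('a \<Rightarrow> 'b::{banach, second_countable_topology}) \<Rightarrow> bool" where
  "locally_integrable \<Omega> f \<longleftrightarrow> (\<forall>K. compact K \<and> K \<subseteq> \<Omega> \<longrightarrow> integrable (lebesgue_on K) f)"

definition square_integrable ::
    "'a::euclidean_space set \<Rightarrow> ('a \<Rightarrow> 'b::{banach, second_countable_topology}) \<Rightarrow> bool" where
  "square_integrable \<Omega> f \<longleftrightarrow>
     f \<in> borel_measurable (lebesgue_on \<Omega>) \<and> integrable (lebesgue_on \<Omega>) (\<lambda>x. (norm (f x))\<^sup>2)"

definition has_weak_gradient ::
    "'a::euclidean_space set \<Rightarrow> ('a \<Rightarrow> real) \<Rightarrow> ('a \<Rightarrow> 'a) \<Rightarrow> bool" where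
  "has_weak_gradient \<Omega> f G \<longleftrightarrow>
     locally_integrable \<Omega> f \<and> locally_integrable \<Omega> G \<and>
     (\<forall>\<eta>\<in>test_functions \<Omega>. \<forall>b\<in>Basis.
        (LINT x|lebesgue_on \<Omega>. f x * partial b \<eta> x) = - (LINT x|lebesgue_on \<Omega>. (G x \<bullet> b) * \<eta> x))"

text \<open>On an open set, the weak gradient is unique up to null sets, so the choice made here
  affects no integral over \<open>\<Omega>\<close>.\<close>

definition weak_gradient :: "'a::euclidean_space set \<Rightarrow> ('a \<Rightarrow> real) \<Rightarrow> 'a \<Rightarrow> 'a" where
  "weak_gradient \<Omega> f = (SOME G. has_weak_gradient \<Omega> f G)"

definition H1 :: "'a::euclidean_space set \<Rightarrow> ('a \<Rightarrow> real) set" where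
  "H1 \<Omega> = {f. square_integrable \<Omega> f \<and> (\<exists>G. has_weak_gradient \<Omega> f G \<and> square_integrable \<Omega> G)}"

definition H1_norm :: "'a::euclidean_space set \<Rightarrow> ('a \<Rightarrow> real) \<Rightarrow> real" where
  "H1_norm \<Omega> f =
     sqrt ((LINT x|lebesgue_on \<Omega>. (f x)\<^sup>2) + (LINT x|lebesgue_on \<Omega>. (norm (weak_gradient \<Omega> f x))\<^sup>2))"

definition H1_0 :: "'a::euclidean_space set \<Rightarrow> ('a \<Rightarrow> real) set" where
  "H1_0 \<Omega> = {f \<in> H1 \<Omega>. \<forall>\<epsilon>>0. \<exists>\<eta>\<in>test_functions \<Omega>. H1_norm \<Omega> (\<lambda>x. f x - \<eta> x) < \<epsilon>}"

definition plus_H1_0 :: "(real^2) set \<Rightarrow> (real^2 \<Rightarrow> real) \<Rightarrow> (real^2 \<Rightarrow> real) set" where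
  "plus_H1_0 \<Omega> v = {\<lambda>x. v x + \<phi> x | \<phi>. \<phi> \<in> H1_0 \<Omega>}"

section \<open>The functional\<close>

definition R :: "(real^2) set \<Rightarrow> (real^2 \<Rightarrow> real) \<Rightarrow> (real^2 \<Rightarrow> real) \<Rightarrow> real" where
  "R \<Omega> \<phi> v = (LINT x|lebesgue_on \<Omega>.
     (norm (weak_gradient \<Omega> \<phi> x))\<^sup>2
     + 4 * exp (2 * v x) * (exp (2 * \<phi> x) - 1 - 2 * \<phi> x)
     + 2 * liouville_residual v x * \<phi> x)"

end

theory Submission
  imports Defs
begin

text \<open>
  Let \<open>\<phi> \<in> H\<^sup>1\<^sub>0(\<Omega>)\<close> and \<open>h = \<phi> - w\<close>. Subtracting the equation for \<open>u = v + w\<close> from the definition of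
  \<open>r[v]\<close> gives \<open>\<Delta>w = r[v] + 4 e\<^sup>2\<^sup>v (e\<^sup>2\<^sup>w - 1)\<close>, and with this the functional expands around \<open>w\<close> as
  \<open>R[\<phi>,v] - R[w,v] = \<integral> |\<nabla>h|\<^sup>2 + 4 e\<^sup>2\<^sup>u (e\<^sup>2\<^sup>h - 1 - 2h) + 2 \<integral> \<nabla>w \<bullet> \<nabla>h + h \<Delta>w\<close>.
  The first integrand is nonnegative and vanishes only where \<open>h\<close> and \<open>\<nabla>h\<close> do. The second integral is the
  weak form of \<open>\<Delta>w - \<Delta>w = 0\<close> and is zero. Hence \<open>w\<close> is the only minimiser. The identity is
  \<open>R_expansion\<close>; the work lies in giving a meaning to each of its terms for a general \<open>\<phi>\<close>.

  The second integral vanishes for test functions by integration by parts. It extends to \<open>H\<^sup>1\<^sub>0(\<Omega>)\<close>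
  (\<open>euler_lagrange\<close>) because \<open>\<Delta>w = O(1/d)\<close>, by the assumptions on \<open>v\<close> and \<open>w\<close>, and because \<open>h/d\<close> is
  controlled in \<open>L\<^sup>2\<close> by Hardy's inequality (\<open>hardy_test\<close>, \<open>hardy_H1_0\<close>). Hardy's inequality comes from
  integrating the divergence of \<open>\<eta>\<^sup>2 \<nabla>d / d\<close>. What it needs of the boundary is that \<open>d\<close> has bounded
  derivatives up to order two and that \<open>|\<nabla>d| \<ge> 1\<close> where \<open>d\<close> is small; the latter holds because the
  distance to the boundary decreases at unit rate towards a nearest boundary point.

  As \<open>e\<^sup>2\<^sup>v = O(1/d\<^sup>2)\<close>, the functional is finite once \<open>(e\<^sup>2\<^sup>\<phi> - 1 - 2\<phi>)/d\<^sup>2\<close> is integrable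
  (\<open>exp_integrable\<close>). For a test function \<open>\<eta>\<close> of small energy, applying the planar inequality
  \<open>\<parallel>f\<parallel>\<^sub>2 \<le> \<parallel>\<nabla>f\<parallel>\<^sub>1\<close> (\<open>gagliardo_nirenberg\<close>) to \<open>f = \<eta>\<^sup>m/d\<close> bounds \<open>\<integral> \<eta>\<^sup>2\<^sup>m/d\<^sup>2\<close> by \<open>(m!)\<^sup>2\<close> times the
  \<open>m\<close>-th power of the energy, up to a factor that is geometric in \<open>m\<close>, and the series of
  \<open>(cosh 2\<eta> - 1)/d\<^sup>2\<close> can be summed. Fatou's lemma carries the bound to \<open>H\<^sup>1\<^sub>0\<close>
  functions of small energy, and a general \<open>\<phi>\<close> differs from one of these by a test function.

  Finally, \<open>w\<close> belongs to \<open>H\<^sup>1\<^sub>0(\<Omega>)\<close> (\<open>H1_0_if_vanishing\<close>): as \<open>w = O(d)\<close>, it can be cut off near the boundary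
  with gradients that stay bounded, and then mollified. The fundamental lemma of the calculus of
  variations makes weak gradients unique almost everywhere, so that all these estimates apply to the
  gradient that occurs in the functional.
\<close>

section \<open>Partial derivatives and classes of differentiability\<close>

definition grad :: "('a::euclidean_space \<Rightarrow> real) \<Rightarrow> 'a \<Rightarrow> 'a" where
  "grad f x = (\<Sum>b\<in>Basis. partial b f x *\<^sub>R b)"

lemma grad_inner_Basis [simp]: "b \<in> Basis \<Longrightarrow> grad f x \<bullet> b = partial b f x"
  by (simp add: grad_def)

lemma partial_eq_derivative:
  assumes "(f has_derivative f') (at x)"
  shows "partial b f x = f' b"
proof -
  interpret f': bounded_linear f' using assms by (rule has_derivative_bounded_linear)
  have "((\<lambda>t. x + t *\<^sub>R b) has_derivative (\<lambda>t. t *\<^sub>R b)) (at 0)"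
    by (auto intro!: derivative_eq_intros)
  then have "(f \<circ> (\<lambda>t. x + t *\<^sub>R b) has_derivative f' \<circ> (\<lambda>t. t *\<^sub>R b)) (at 0)"
    by (rule diff_chain_at) (use assms in simp)
  moreover have "f' \<circ> (\<lambda>t. t *\<^sub>R b) = (*) (f' b)"
    by (auto simp: f'.scaleR fun_eq_iff)
  ultimately have "((\<lambda>t. f (x + t *\<^sub>R b)) has_field_derivative f' b) (at 0)"
    by (simp add: has_field_derivative_def comp_def)
  then show ?thesis
    unfolding partial_def by (rule DERIV_imp_deriv)
qed

lemma has_derivative_grad:
  assumes "f differentiable (at x)"
  shows "(f has_derivative (\<lambda>h. grad f x \<bullet> h)) (at x)"
proof -
  obtain f' where f': "(f has_derivative f') (at x)"
    using assms by (auto simp: differentiable_def)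
  interpret f': bounded_linear f' using f' by (rule has_derivative_bounded_linear)
  have "f' h = grad f x \<bullet> h" for h
  proof -
    have "f' h = f' (\<Sum>b\<in>Basis. (h \<bullet> b) *\<^sub>R b)" by (simp add: euclidean_representation)
    also have "\<dots> = (\<Sum>b\<in>Basis. (h \<bullet> b) * f' b)" by (simp add: f'.sum f'.scaleR)
    also have "\<dots> = grad f x \<bullet> h"
      unfolding grad_def inner_sum_left inner_scaleR_left partial_eq_derivative[OF f']
      by (simp add: inner_commute mult.commute)
    finally show ?thesis .
  qed
  then have "f' = (\<lambda>h. grad f x \<bullet> h)" by auto
  then show ?thesis using f' by simp
qed

lemma partial_eq_grad_inner: "f differentiable (at x) \<Longrightarrow> partial b f x = grad f x \<bullet> b"
  using partial_eq_derivative[OF has_derivative_grad] .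

lemma partial_cong:
  assumes "open U" "x \<in> U" "\<And>y. y \<in> U \<Longrightarrow> f y = g y"
  shows "partial b f x = partial b g x"
  unfolding partial_def
proof (rule deriv_cong_ev)
  have "((\<lambda>t. x + t *\<^sub>R b) \<longlongrightarrow> x + 0 *\<^sub>R b) (nhds 0)"
    by (intro tendsto_intros filterlim_ident)
  then have "\<forall>\<^sub>F t in nhds 0. x + t *\<^sub>R b \<in> U"
    using assms(1,2) topological_tendstoD[of _ x] by simp
  then show "\<forall>\<^sub>F t in nhds 0. f (x + t *\<^sub>R b) = g (x + t *\<^sub>R b)"
    by eventually_elim (use assms(3) in auto)
qed simp

lemma grad_cong:
  assumes "open U" "x \<in> U" "\<And>y. y \<in> U \<Longrightarrow> f y = g y"
  shows "grad f x = grad g x"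
  unfolding grad_def using partial_cong[OF assms] by simp

lemma partial_const [simp]: "partial b (\<lambda>x. c) x = 0"
  by (rule partial_eq_derivative) (rule has_derivative_const)

lemma differentiable_on_open_cong:
  assumes "open U" "\<And>y. y \<in> U \<Longrightarrow> f y = g y" "f differentiable_on U"
  shows "g differentiable_on U"
  unfolding differentiable_on_def
proof
  fix x assume x: "x \<in> U"
  show "g differentiable (at x within U)"
    by (rule differentiable_transform_within[of f x U 1 g])
       (use assms x in \<open>simp_all add: differentiable_on_def\<close>)
qed

lemma partial_add:
  "f differentiable (at x) \<Longrightarrow> g differentiable (at x)
    \<Longrightarrow> partial b (\<lambda>x. f x + g x) x = partial b f x + partial b g x"
  using partial_eq_derivative[OF has_derivative_add[OF has_derivative_grad has_derivative_grad], of f x g b]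
  by (simp add: partial_eq_grad_inner[of f] partial_eq_grad_inner[of g])

lemma partial_diff:
  "f differentiable (at x) \<Longrightarrow> g differentiable (at x)
    \<Longrightarrow> partial b (\<lambda>x. f x - g x) x = partial b f x - partial b g x"
  using partial_eq_derivative[OF has_derivative_diff[OF has_derivative_grad has_derivative_grad], of f x g b]
  by (simp add: partial_eq_grad_inner[of f] partial_eq_grad_inner[of g])

lemma partial_mult:
  "f differentiable (at x) \<Longrightarrow> g differentiable (at x)
    \<Longrightarrow> partial b (\<lambda>x. f x * g x) x = f x * partial b g x + partial b f x * g x"
  using partial_eq_derivative[OF has_derivative_mult[OF has_derivative_grad has_derivative_grad], of f x g b]
  by (simp add: partial_eq_grad_inner[of f] partial_eq_grad_inner[of g])

lemma has_derivative_chain_real: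
  assumes "f differentiable (at x)" "(h has_real_derivative h') (at (f x))"
  shows "((\<lambda>x. h (f x)) has_derivative (\<lambda>y. h' * (grad f x \<bullet> y))) (at x)"
  using diff_chain_at[OF has_derivative_grad[OF assms(1)] assms(2)[unfolded has_field_derivative_def]]
  by (simp add: comp_def)

lemma partial_chain_real:
  assumes "f differentiable (at x)" "(h has_real_derivative h') (at (f x))"
  shows "partial b (\<lambda>x. h (f x)) x = h' * partial b f x"
  using partial_eq_derivative[OF has_derivative_chain_real[OF assms]] assms(1)
  by (simp add: partial_eq_grad_inner)

lemma C_diff_continuous_on: "C_diff k U f \<Longrightarrow> continuous_on U f"
  by (cases k) (auto intro: differentiable_imp_continuous_on)

lemma C_diff_differentiable_at: "C_diff (Suc k) U f \<Longrightarrow> open U \<Longrightarrow> x \<in> U \<Longrightarrow> f differentiable (at x)"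
  by (simp add: differentiable_on_eq_differentiable_at)

lemma C_diff_subset: "C_diff k U f \<Longrightarrow> V \<subseteq> U \<Longrightarrow> C_diff k V f"
  by (induction k arbitrary: f) (auto intro: continuous_on_subset differentiable_on_subset)

lemma C_diff_SucD: "C_diff (Suc k) U f \<Longrightarrow> C_diff k U f"
proof (induction k arbitrary: f)
  case 0
  then show ?case by (auto intro: differentiable_imp_continuous_on)
next
  case (Suc k)
  have "C_diff k U (partial b f)" if "b \<in> Basis" for b
    using Suc.prems that by (intro Suc.IH) (simp only: C_diff.simps(2)[of "Suc k"])
  moreover have "f differentiable_on U"
    using Suc.prems by (simp only: C_diff.simps(2)[of "Suc k"])
  ultimately show ?case by simp
qed

lemma C_diff_le: "m \<le> k \<Longrightarrow> C_diff k U f \<Longrightarrow> C_diff m U f"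
  by (induction k rule: dec_induct) (blast dest: C_diff_SucD)+

lemma C_diff_cong:
  assumes "open U" "C_diff k U f" "\<And>y. y \<in> U \<Longrightarrow> f y = g y"
  shows "C_diff k U g"
  using assms(2,3)
proof (induction k arbitrary: f g)
  case 0
  then show ?case using continuous_on_cong[of U U f g] by simp
next
  case (Suc k)
  have "C_diff k U (partial b g)" if "b \<in> Basis" for b
  proof (rule Suc.IH[of "partial b f"])
    show "C_diff k U (partial b f)" using Suc.prems(1) that by simp
    show "partial b f y = partial b g y" if "y \<in> U" for y
      by (rule partial_cong[OF assms(1) that Suc.prems(2)])
  qed
  moreover have "g differentiable_on U"
    by (rule differentiable_on_open_cong[OF assms(1) Suc.prems(2)]) (use Suc.prems(1) in simp_all)
  ultimately show ?case by simp
qed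

lemma C_diff_Un:
  assumes "open U" "open V" "C_diff k U f" "C_diff k V f"
  shows "C_diff k (U \<union> V) f"
  using assms(3,4)
proof (induction k arbitrary: f)
  case 0
  then show ?case using assms(1,2) by (simp add: continuous_on_open_Un)
next
  case (Suc k)
  moreover have "f differentiable_on U \<union> V"
    using Suc.prems assms(1,2) by (auto simp: differentiable_on_eq_differentiable_at open_Un)
  ultimately show ?case by simp
qed

lemma C_diff_const: "C_diff k U (\<lambda>x. c)"
proof (induction k arbitrary: c)
  case (Suc k)
  have "partial b (\<lambda>x. c) = (\<lambda>x. 0)" for b :: 'a by auto
  then show ?case using Suc by simp
qed simp

lemma C_diff_add:
  assumes "open U" "C_diff k U f" "C_diff k U g"
  shows "C_diff k U (\<lambda>x. f x + g x)"
  using assms(2,3)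
proof (induction k arbitrary: f g)
  case 0
  then show ?case by (auto intro: continuous_intros)
next
  case (Suc k)
  have "C_diff k U (partial b (\<lambda>x. f x + g x))" if "b \<in> Basis" for b
  proof (rule C_diff_cong[OF assms(1) Suc.IH])
    show "C_diff k U (partial b f)" "C_diff k U (partial b g)" using Suc.prems that by simp_all
    show "partial b f y + partial b g y = partial b (\<lambda>x. f x + g x) y" if "y \<in> U" for y
      by (rule partial_add[symmetric]) (rule C_diff_differentiable_at[OF _ assms(1) that], fact)+
  qed
  then show ?case using Suc.prems by (auto simp: differentiable_on_add)
qed

lemma C_diff_mult:
  assumes "open U" "C_diff k U f" "C_diff k U g"
  shows "C_diff k U (\<lambda>x. f x * g x)"
  using assms(2,3)
proof (induction k arbitrary: f g)
  case 0
  then show ?case by (auto intro: continuous_intros)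
next
  case (Suc k)
  have "C_diff k U (partial b (\<lambda>x. f x * g x))" if "b \<in> Basis" for b
  proof (rule C_diff_cong[OF assms(1) C_diff_add[OF assms(1)]])
    show "C_diff k U (\<lambda>x. f x * partial b g x)" "C_diff k U (\<lambda>x. partial b f x * g x)"
      using Suc.prems that C_diff_SucD[OF Suc.prems(1)] C_diff_SucD[OF Suc.prems(2)]
      by (auto intro!: Suc.IH)
    show "f y * partial b g y + partial b f y * g y = partial b (\<lambda>x. f x * g x) y" if "y \<in> U" for y
      by (rule partial_mult[symmetric]) (rule C_diff_differentiable_at[OF _ assms(1) that], fact)+
  qed
  moreover have "(\<lambda>x. f x * g x) differentiable_on U"
    using Suc.prems by (auto intro: differentiable_on_mult)
  ultimately show ?case by simp
qed

lemma C_diff_diff: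
  assumes "open U" "C_diff k U f" "C_diff k U g"
  shows "C_diff k U (\<lambda>x. f x - g x)"
  using C_diff_add[OF assms(1,2) C_diff_mult[OF assms(1) C_diff_const[of k U "-1"] assms(3)]] by simp

text \<open>A class of one-variable functions that is closed under differentiation consists of
  smooth functions, so composing with its members keeps the order of differentiability.\<close>

lemma C_diff_compose:
  assumes "open U" "C_diff k U f" "h \<in> H"
    and H: "\<And>h. h \<in> H \<Longrightarrow> \<exists>h'\<in>H. \<forall>t\<in>T. (h has_real_derivative h' t) (at t)"
    and T: "f ` U \<subseteq> T"
  shows "C_diff k U (\<lambda>x. h (f x))"
  using assms(2,3)
proof (induction k arbitrary: h)
  case 0
  obtain h' where "\<forall>t\<in>T. (h has_real_derivative h' t) (at t)" using H 0 by blast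
  then have "continuous_on T h"
    by (meson DERIV_isCont continuous_at_imp_continuous_on)
  then show ?case using 0 T by (auto intro: continuous_on_compose2)
next
  case (Suc k)
  obtain h' where h': "h' \<in> H" "\<And>t. t \<in> T \<Longrightarrow> (h has_real_derivative h' t) (at t)"
    using H Suc.prems by blast
  have fd: "f differentiable (at x)" if "x \<in> U" for x
    using Suc.prems assms(1) that by (auto simp: differentiable_on_eq_differentiable_at)
  have "C_diff k U (partial b (\<lambda>x. h (f x)))" if "b \<in> Basis" for b
  proof (rule C_diff_cong[OF assms(1) C_diff_mult[OF assms(1)]])
    show "C_diff k U (\<lambda>x. h' (f x))"
      using Suc.IH[OF C_diff_SucD[OF Suc.prems(1)] h'(1)] .
    show "C_diff k U (partial b f)" using Suc.prems that by simp
    show "h' (f x) * partial b f x = partial b (\<lambda>x. h (f x)) x" if "x \<in> U" for x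
      using partial_chain_real[OF fd[OF that] h'(2)] T that by auto
  qed
  moreover have "(\<lambda>x. h (f x)) differentiable_on U"
    using has_derivative_chain_real[OF fd h'(2)] T assms(1)
    by (auto simp: differentiable_on_eq_differentiable_at differentiable_def)
  ultimately show ?case by simp
qed

lemma C_diff_inner: "C_diff k U (\<lambda>x. a \<bullet> x)"
proof (cases k)
  case (Suc k)
  have "partial b (\<lambda>x. a \<bullet> x) = (\<lambda>x. a \<bullet> b)" for b :: 'a
    by (intro ext partial_eq_derivative) (auto intro!: derivative_eq_intros)
  moreover have "(\<lambda>x. a \<bullet> x) differentiable_on U"
    by (auto simp: differentiable_on_def intro!: derivative_intros)
  ultimately show ?thesis using Suc by (simp add: C_diff_const)
qed (auto intro: continuous_intros)

lemma C_diff_sum: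
  assumes "open U" "finite I" "\<And>i. i \<in> I \<Longrightarrow> C_diff k U (f i)"
  shows "C_diff k U (\<lambda>x. \<Sum>i\<in>I. f i x)"
  using assms(2,3) by (induction rule: finite_induct) (auto intro: C_diff_const C_diff_add[OF assms(1)])

lemma C_diff_dist_sq: "C_diff k UNIV (\<lambda>x. (norm (x - p))\<^sup>2)"
proof -
  have *: "(norm (x - p))\<^sup>2 = (\<Sum>b\<in>Basis. (b \<bullet> x - p \<bullet> b) * (b \<bullet> x - p \<bullet> b))" for x
    by (subst power2_norm_eq_inner, subst euclidean_inner) (simp add: inner_diff_left inner_diff_right inner_commute)
  show ?thesis unfolding * 
    by (intro C_diff_sum C_diff_mult C_diff_diff C_diff_inner C_diff_const) auto
qed

section \<open>Smooth bump functions\<close>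

text \<open>The functions \<open>p(1/t) e\<^sup>-\<^sup>1\<^sup>/\<^sup>t\<close>, \<open>p\<close> a polynomial, extended by zero to the left of the
  origin: the classical flat functions, together with all their derivatives.\<close>

definition flat_exp :: "real poly \<Rightarrow> real \<Rightarrow> real" where
  "flat_exp p t = (if t \<le> 0 then 0 else poly p (1 / t) * exp (- (1 / t)))"

lemma poly_times_exp_minus_tendsto_0: "((\<lambda>s. poly p s * exp (- s)) \<longlongrightarrow> 0) at_top" for p :: "real poly"
proof -
  have "((\<lambda>s. \<Sum>i\<le>degree p. coeff p i * (s ^ i / exp s)) \<longlongrightarrow> (\<Sum>i\<le>degree p. coeff p i * 0)) at_top"
    by (intro tendsto_intros tendsto_power_div_exp_0)
  moreover have "(\<Sum>i\<le>degree p. coeff p i * (s ^ i / exp s)) = poly p s * exp (- s)" for s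
    by (simp add: poly_altdef exp_minus divide_inverse sum_distrib_right mult.assoc)
  ultimately show ?thesis by simp
qed

text \<open>At the origin the difference quotient from the right is \<open>s p(s) e\<^sup>-\<^sup>s\<close> with \<open>s = 1/t\<close>, which tends to zero as
  \<open>s\<close> tends to infinity. Away from the origin this is the chain rule.\<close>

lemma flat_exp_deriv: "(flat_exp p has_real_derivative flat_exp ([:0,0,1:] * (p - pderiv p)) t) (at t)"
proof -
  consider "t < 0" | "t > 0" | "t = 0" by linarith
  then show ?thesis
  proof cases
    case 1
    have "((\<lambda>t. 0) has_real_derivative 0) (at t)" by simp
    then have "(flat_exp p has_real_derivative 0) (at t)"
      by (rule has_field_derivative_transform_within_open[of _ _ _ "{..<0}"]) (use 1 in \<open>auto simp: flat_exp_def\<close>)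
    then show ?thesis using 1 by (simp add: flat_exp_def)
  next
    case 2
    have "((\<lambda>t. poly p (1 / t) * exp (- (1 / t))) has_real_derivative
        flat_exp ([:0,0,1:] * (p - pderiv p)) t) (at t)"
      using 2 by (auto intro!: derivative_eq_intros poly_DERIV simp: flat_exp_def field_simps power2_eq_square)
    then show ?thesis
      by (rule has_field_derivative_transform_within_open[of _ _ _ "{0<..}"]) (use 2 in \<open>auto simp: flat_exp_def\<close>)
  next
    case 3
    have "((\<lambda>t. poly (pCons 0 p) (inverse t) * exp (- inverse t)) \<longlongrightarrow> 0) (at_right 0)"
      by (rule filterlim_compose[OF poly_times_exp_minus_tendsto_0 filterlim_inverse_at_top_right])
    then have "((\<lambda>t. flat_exp p t / t) \<longlongrightarrow> 0) (at_right 0)"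
      by (rule Lim_transform_eventually)
         (auto simp: eventually_at_filter flat_exp_def field_simps comp_def)
    moreover have "((\<lambda>t. flat_exp p t / t) \<longlongrightarrow> 0) (at_left 0)"
      by (rule Lim_transform_eventually[of "\<lambda>_. 0"]) (auto simp: eventually_at_filter flat_exp_def)
    ultimately have "((\<lambda>t. flat_exp p t / t) \<longlongrightarrow> 0) (at 0)"
      by (simp add: filterlim_split_at)
    then show ?thesis using 3 by (simp add: has_field_derivative_iff flat_exp_def)
  qed
qed

text \<open>The flat exponential is applied to a polynomial in the coordinates, so smoothness holds at the
  centre as well as across the boundary sphere of the ball.\<close>

definition bump :: "'a::euclidean_space \<Rightarrow> real \<Rightarrow> 'a \<Rightarrow> real" where
  "bump p r x = flat_exp 1 (r\<^sup>2 - (norm (x - p))\<^sup>2)"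

lemma bump_smooth: "C_diff k UNIV (bump p r)"
  unfolding bump_def
  by (rule C_diff_compose[where H="range flat_exp" and T=UNIV])
     (auto intro!: C_diff_diff C_diff_const C_diff_dist_sq flat_exp_deriv)

lemma bump_nonneg: "bump p r x \<ge> 0"
  by (simp add: bump_def flat_exp_def)

lemma bump_pos_iff: "r > 0 \<Longrightarrow> bump p r x > 0 \<longleftrightarrow> x \<in> ball p r"
  using power_strict_mono[of "norm (x - p)" r 2] power2_less_imp_less[of "norm (x - p)" r]
  by (auto simp: bump_def flat_exp_def dist_norm norm_minus_commute not_le)

section \<open>Integration by parts\<close>

lemma open_sets_lebesgue [simp, intro]: "open S \<Longrightarrow> S \<in> sets lebesgue"
  by simp

lemma integrable_compact_support_lborel:
  fixes f :: "'a::euclidean_space \<Rightarrow> 'b::euclidean_space"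
  assumes "compact K" "continuous_on K f" "\<And>x. x \<notin> K \<Longrightarrow> f x = 0"
  shows "integrable lborel f"
proof -
  have "f = (\<lambda>x. indicator K x *\<^sub>R f x)"
    using assms(3) by (auto simp: fun_eq_iff indicator_def)
  then show ?thesis using borel_integrable_compact[OF assms(1,2)] by simp
qed

lemma integral_lebesgue_on_eq_lborel:
  fixes f :: "'a::euclidean_space \<Rightarrow> 'b::euclidean_space"
  assumes "\<Omega> \<in> sets lebesgue" "integrable lborel f" "\<And>x. x \<notin> \<Omega> \<Longrightarrow> f x = 0"
  shows "integrable (lebesgue_on \<Omega>) f" "(LINT x|lebesgue_on \<Omega>. f x) = integral\<^sup>L lborel f"
proof -
  have eq: "(\<lambda>x. if x \<in> \<Omega> then f x else 0) = f" using assms(3) by auto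
  have m: "f \<in> borel_measurable lborel" using assms(2) by auto
  show "integrable (lebesgue_on \<Omega>) f"
    using Lebesgue_Measure.integrable_restrict_UNIV[OF assms(1), of f] integrable_completion[OF m] assms(2) eq by simp
  show "(LINT x|lebesgue_on \<Omega>. f x) = integral\<^sup>L lborel f"
    using Lebesgue_Measure.integral_restrict_UNIV[OF assms(1), of f] integral_completion[OF m] eq by simp
qed

lemma integrable_compact_support:
  fixes f :: "'a::euclidean_space \<Rightarrow> 'b::euclidean_space"
  assumes "open \<Omega>" "compact K" "K \<subseteq> \<Omega>" "continuous_on \<Omega> f" "\<And>x. x \<in> \<Omega> - K \<Longrightarrow> f x = 0"
  shows "integrable (lebesgue_on \<Omega>) f"
proof -
  let ?f = "\<lambda>x. if x \<in> K then f x else 0"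
  have "continuous_on K ?f"
    using continuous_on_subset[OF assms(4,3)] by (simp cong: continuous_on_cong)
  then have "integrable lborel ?f"
    by (intro integrable_compact_support_lborel[OF assms(2)]) auto
  then have "integrable (lebesgue_on \<Omega>) ?f"
    by (rule integral_lebesgue_on_eq_lborel(1)[rotated]) (use assms in auto)
  then show ?thesis
    by (rule Bochner_Integration.integrable_cong[THEN iffD1, rotated -1]) (use assms in auto)
qed

lemma partial_zero_outside:
  assumes "closed K" "\<And>x. x \<notin> K \<Longrightarrow> f x = 0" "x \<notin> K"
  shows "partial b f x = 0"
  using partial_cong[of "-K" x f "\<lambda>_. 0"] assms by (simp add: open_Compl)

text \<open>The sets \<open>\<Omega>\<close> and \<open>- K\<close> are open and cover the space, and the extension is zero on the second one.\<close>

lemma C_diff_zero_extension: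
  assumes "open \<Omega>" "C_diff k \<Omega> f" "compact K" "K \<subseteq> \<Omega>" "\<And>x. x \<in> \<Omega> - K \<Longrightarrow> f x = 0"
  shows "C_diff k UNIV (\<lambda>x. if x \<in> \<Omega> then f x else 0)"
proof -
  have "C_diff k \<Omega> (\<lambda>x. if x \<in> \<Omega> then f x else 0)"
    by (rule C_diff_cong[OF assms(1,2)]) simp
  moreover have "C_diff k (- K) (\<lambda>x. if x \<in> \<Omega> then f x else 0)"
    by (rule C_diff_cong[OF _ C_diff_const[of k _ 0]]) (use assms in \<open>auto simp: compact_imp_closed open_Compl\<close>)
  ultimately have "C_diff k (\<Omega> \<union> - K) (\<lambda>x. if x \<in> \<Omega> then f x else 0)"
    using assms by (intro C_diff_Un) (auto simp: compact_imp_closed open_Compl)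
  moreover have "\<Omega> \<union> - K = UNIV" using assms(4) by auto
  ultimately show ?thesis by simp
qed

lemma C1_partial_bounded:
  assumes "C_diff 1 UNIV f" "compact K" "\<And>x. x \<notin> K \<Longrightarrow> f x = 0" "b \<in> Basis"
  obtains M where "M \<ge> 0" "\<And>x. \<bar>partial b f x\<bar> \<le> M"
proof -
  have "compact (partial b f ` K)"
    using assms by (intro compact_continuous_image) (auto intro: continuous_on_subset)
  then obtain M where M: "\<forall>y\<in>partial b f ` K. \<bar>y\<bar> \<le> M" "0 < M"
    by (metis bounded_pos compact_imp_bounded real_norm_def)
  have "\<bar>partial b f x\<bar> \<le> M" for x
    using M partial_zero_outside[of K f x b] assms(3) compact_imp_closed[OF assms(2)]
    by (cases "x \<in> K") auto
  then show ?thesis using M that[of M] by auto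
qed

lemma has_real_derivative_along_line:
  assumes "f differentiable (at (x + s *\<^sub>R b))"
  shows "((\<lambda>t. f (x + t *\<^sub>R b)) has_real_derivative partial b f (x + s *\<^sub>R b)) (at s)"
proof -
  have "((\<lambda>t. x + t *\<^sub>R b) has_derivative (\<lambda>t. t *\<^sub>R b)) (at s)"
    by (auto intro!: derivative_eq_intros)
  then have "(f \<circ> (\<lambda>t. x + t *\<^sub>R b) has_derivative (\<lambda>h. grad f (x + s *\<^sub>R b) \<bullet> h) \<circ> (\<lambda>t. t *\<^sub>R b)) (at s)"
    by (rule diff_chain_at) (rule has_derivative_grad[OF assms])
  moreover have "(\<lambda>h. grad f (x + s *\<^sub>R b) \<bullet> h) \<circ> (\<lambda>t. t *\<^sub>R b) = (*) (partial b f (x + s *\<^sub>R b))"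
    by (simp add: fun_eq_iff partial_eq_grad_inner[OF assms])
  ultimately show ?thesis by (simp add: has_field_derivative_def comp_def)
qed

text \<open>The integral of a derivative vanishes because the integral is translation invariant: it is
  the limit of the integrals of difference quotients, all of which are zero.\<close>

text \<open>The global statement, applied to the extension by zero.\<close>

lemma integral_partial_eq_0_lborel:
  fixes f :: "'a::euclidean_space \<Rightarrow> real"
  assumes C1: "C_diff 1 UNIV f" and K: "compact K" and 0: "\<And>x. x \<notin> K \<Longrightarrow> f x = 0" and b: "b \<in> Basis"
  shows "integral\<^sup>L lborel (partial b f) = 0"
proof -
  obtain M where M: "M \<ge> 0" "\<And>x. \<bar>partial b f x\<bar> \<le> M"
    using C1_partial_bounded[OF C1 K 0 b] by blast
  have diff: "f differentiable (at x)" for x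
    using C1 by (simp add: differentiable_on_eq_differentiable_at)
  define t where "t n = 1 / (real n + 1)" for n
  have t: "0 < t n" "t n \<le> 1" for n by (auto simp: t_def)
  have t0: "t \<longlonglongrightarrow> 0" using LIMSEQ_Suc[OF lim_1_over_n[where 'a=real]] by (simp add: t_def[abs_def] add.commute)
  define q where "q n x = (f (x + t n *\<^sub>R b) - f x) / t n" for n x
  obtain r where r: "r > 0" "K \<subseteq> cball 0 r"
    by (metis K bounded_pos compact_imp_bounded mem_cball_0 subsetI)
  have int: "integrable lborel f"
    using C1 by (intro integrable_compact_support_lborel[OF K _ 0])
      (auto intro: differentiable_imp_continuous_on continuous_on_subset)
  have shift: "integrable lborel (\<lambda>x. f (c + x))" "(LINT x|lborel. f (c + x)) = integral\<^sup>L lborel f" for c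
    using int integrable_distr[of "(+) c" lborel borel f] integral_distr[of "(+) c" lborel borel f]
    by (auto simp: lborel_distr_plus)
  have "(\<lambda>n. integral\<^sup>L lborel (q n)) \<longlonglongrightarrow> integral\<^sup>L lborel (partial b f)"
  proof (rule integral_dominated_convergence[where w="\<lambda>x. M * indicator (cball 0 (r + 1)) x"])
    show "integrable lborel (\<lambda>x::'a. M * indicator (cball 0 (r + 1)) x)"
      by (intro integrable_mult_right integrable_real_indicator) (use emeasure_lborel_cball_finite[of "0::'a" "r + 1"] in \<open>auto simp: less_top\<close>)
    show "AE x in lborel. (\<lambda>n. q n x) \<longlonglongrightarrow> partial b f x"
    proof (rule AE_I2)
      fix x
      have "((\<lambda>s. (f (x + s *\<^sub>R b) - f x) / s) \<longlongrightarrow> partial b f x) (at 0)"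
        using has_real_derivative_along_line[of f x 0 b] diff by (simp add: has_field_derivative_iff)
      moreover have "filterlim t (at 0) sequentially"
        using t0 t(1) by (auto simp: filterlim_at less_imp_neq[symmetric])
      ultimately show "(\<lambda>n. q n x) \<longlonglongrightarrow> partial b f x"
        unfolding q_def by (auto dest: filterlim_compose)
    qed
    show "AE x in lborel. norm (q n x) \<le> M * indicator (cball 0 (r + 1)) x" for n
    proof (rule AE_I2)
      fix x
      show "norm (q n x) \<le> M * indicator (cball 0 (r + 1)) x"
      proof (cases "x \<in> cball 0 (r + 1)")
        case True
        obtain z where "f (x + t n *\<^sub>R b) - f (x + 0 *\<^sub>R b) = (t n - 0) * partial b f (x + z *\<^sub>R b)"
          using MVT2[OF t(1)[of n], of "\<lambda>s. f (x + s *\<^sub>R b)" "\<lambda>s. partial b f (x + s *\<^sub>R b)"]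
            has_real_derivative_along_line[OF diff] by blast
        then show ?thesis using M True t(1)[of n] by (simp add: q_def)
      next
        case False
        have "norm (t n *\<^sub>R b) \<le> 1" using t[of n] b by simp
        then have "norm (x + t n *\<^sub>R b) > r"
          using False norm_triangle_ineq4[of "x + t n *\<^sub>R b" "t n *\<^sub>R b"] by auto
        then have "x + t n *\<^sub>R b \<notin> K" "x \<notin> K" using False r by (auto simp: subset_iff)
        then have "f (x + t n *\<^sub>R b) = 0" "f x = 0" by (auto intro: 0)
        then show ?thesis using False by (simp add: q_def)
      qed
    qed
    show "partial b f \<in> borel_measurable lborel"
      using C1 b by (auto intro!: borel_measurable_continuous_onI)
    show "q n \<in> borel_measurable lborel" for n
      unfolding q_def using shift(1)[of "t n *\<^sub>R b"] int by (auto simp: add_ac dest!: borel_measurable_integrable)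
  qed
  moreover have "integral\<^sup>L lborel (q n) = 0" for n
    unfolding q_def using shift[of "t n *\<^sub>R b"] int by (simp add: add_ac)
  ultimately show ?thesis
    using LIMSEQ_unique[OF _ tendsto_const[of 0 sequentially]] by auto
qed

lemma integral_partial_eq_0:
  fixes f :: "'a::euclidean_space \<Rightarrow> real"
  assumes "open \<Omega>" "C_diff 1 \<Omega> f" "compact K" "K \<subseteq> \<Omega>" "\<And>x. x \<in> \<Omega> - K \<Longrightarrow> f x = 0" "b \<in> Basis"
  shows "integrable (lebesgue_on \<Omega>) (partial b f)" "(LINT x|lebesgue_on \<Omega>. partial b f x) = 0"
proof -
  let ?f = "\<lambda>x. if x \<in> \<Omega> then f x else 0"
  have C1: "C_diff 1 UNIV ?f"
    by (rule C_diff_zero_extension[OF assms(1-5)])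
  have f0: "?f x = 0" if "x \<notin> K" for x using that assms by auto
  have out: "partial b ?f x = 0" if "x \<notin> K" for x
    by (rule partial_zero_outside[OF compact_imp_closed[OF assms(3)] f0 that])
  have int: "integrable lborel (partial b ?f)"
    by (rule integrable_compact_support_lborel[OF assms(3) _ out])
       (use C1 assms(6) in \<open>auto intro: continuous_on_subset\<close>)
  have eq: "partial b ?f x = partial b f x" if "x \<in> \<Omega>" for x
    by (rule partial_cong[OF assms(1) that]) simp
  note * = integral_lebesgue_on_eq_lborel[OF open_sets_lebesgue[OF assms(1)] int out]
  have out': "\<And>x. x \<notin> \<Omega> \<Longrightarrow> x \<notin> K" using assms(4) by auto
  show "integrable (lebesgue_on \<Omega>) (partial b f)"
    using *(1)[OF out'] by (rule Bochner_Integration.integrable_cong[THEN iffD1, rotated -1]) (auto simp: eq)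
  have "(LINT x|lebesgue_on \<Omega>. partial b f x) = (LINT x|lebesgue_on \<Omega>. partial b ?f x)"
    by (rule Bochner_Integration.integral_cong) (auto simp: eq)
  also have "\<dots> = 0"
    using *(2)[OF out'] integral_partial_eq_0_lborel[OF C1 assms(3) f0 assms(6)] by simp
  finally show "(LINT x|lebesgue_on \<Omega>. partial b f x) = 0" .
qed

lemma integral_by_parts:
  fixes f :: "'a::euclidean_space \<Rightarrow> real"
  assumes "open \<Omega>" "C_diff 1 \<Omega> f" "C_diff 1 \<Omega> g" "compact K" "K \<subseteq> \<Omega>" "\<And>x. x \<in> \<Omega> - K \<Longrightarrow> g x = 0" "b \<in> Basis"
  shows "(LINT x|lebesgue_on \<Omega>. f x * partial b g x) = - (LINT x|lebesgue_on \<Omega>. partial b f x * g x)"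
proof -
  have C1: "C_diff 1 \<Omega> (\<lambda>x. f x * g x)" by (rule C_diff_mult[OF assms(1-3)])
  have d: "f differentiable (at x)" "g differentiable (at x)" if "x \<in> \<Omega>" for x
    using assms(2,3) assms(1) that by (auto simp: differentiable_on_eq_differentiable_at)
  have eq: "partial b (\<lambda>x. f x * g x) x = f x * partial b g x + partial b f x * g x" if "x \<in> \<Omega>" for x
    by (rule partial_mult) (use d that in auto)
  have "g x = 0" if "x \<in> \<Omega> \<inter> - K" for x using assms(6) that by auto
  then have pg: "partial b g x = 0" if "x \<in> \<Omega> - K" for x
    using partial_cong[of "\<Omega> \<inter> - K" x g "\<lambda>_. 0" b] that assms(1,4)
    by (auto simp: open_Int open_Compl compact_imp_closed)
  have cont: "continuous_on \<Omega> f" "continuous_on \<Omega> g" "continuous_on \<Omega> (partial b f)" "continuous_on \<Omega> (partial b g)"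
    using assms by (auto intro: differentiable_imp_continuous_on)
  have "0 = (LINT x|lebesgue_on \<Omega>. partial b (\<lambda>x. f x * g x) x)"
    using integral_partial_eq_0(2)[OF assms(1) C1 assms(4,5) _ assms(7)] assms(6) by simp
  also have "\<dots> = (LINT x|lebesgue_on \<Omega>. f x * partial b g x + partial b f x * g x)"
    by (rule Bochner_Integration.integral_cong) (auto simp: eq)
  also have "\<dots> = (LINT x|lebesgue_on \<Omega>. f x * partial b g x) + (LINT x|lebesgue_on \<Omega>. partial b f x * g x)"
    by (intro Bochner_Integration.integral_add integrable_compact_support[OF assms(1,4,5)] continuous_intros cont)
       (auto simp: pg assms(6))
  finally show ?thesis by simp
qed

section \<open>The fundamental lemma of the calculus of variations\<close>

lemma locally_integrable_mult:
  fixes f :: "'a::euclidean_space \<Rightarrow> real"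
  assumes "open \<Omega>" "locally_integrable \<Omega> f" "compact K" "K \<subseteq> \<Omega>"
    "continuous_on \<Omega> \<eta>" "\<And>x. x \<in> \<Omega> - K \<Longrightarrow> \<eta> x = 0"
  shows "integrable (lebesgue_on \<Omega>) (\<lambda>x. f x * \<eta> x)"
proof -
  have "compact (\<eta> ` K)"
    using assms by (intro compact_continuous_image) (auto intro: continuous_on_subset)
  then obtain M where M: "\<forall>y\<in>\<eta> ` K. \<bar>y\<bar> \<le> M" "0 < M"
    by (metis bounded_pos compact_imp_bounded real_norm_def)
  have leb: "K \<in> sets lebesgue" "\<Omega> \<in> sets lebesgue" using assms by (auto simp: lmeasurable_compact fmeasurableD)
  have f: "integrable lebesgue (\<lambda>x. if x \<in> K then f x else 0)"
    using assms(2-4) by (simp add: locally_integrable_def Lebesgue_Measure.integrable_restrict_UNIV[OF leb(1)])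
  have "(\<lambda>x. if x \<in> K then \<eta> x else 0) \<in> borel_measurable lebesgue"
    by (rule borel_measurable_if_I[OF continuous_imp_measurable_on_sets_lebesgue leb(1)])
       (use assms leb in \<open>auto intro: continuous_on_subset\<close>)
  then have "integrable lebesgue (\<lambda>x. (if x \<in> K then f x else 0) * (if x \<in> K then \<eta> x else 0))"
    using f M by (intro Bochner_Integration.integrable_bound[OF integrable_mult_right[OF f, of M]])
      (auto simp: abs_mult mult.commute intro!: AE_I2 mult_right_mono)
  also have "(\<lambda>x. (if x \<in> K then f x else 0) * (if x \<in> K then \<eta> x else 0)) = (\<lambda>x. if x \<in> \<Omega> then f x * \<eta> x else 0)"
    using assms(4,6) by (force simp: fun_eq_iff)
  finally show ?thesis by (simp add: Lebesgue_Measure.integrable_restrict_UNIV[OF leb(2)])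
qed

text \<open>An open set is exhausted by compact sets, and \<open>f\<close> is the pointwise limit of its restrictions to them.\<close>

lemma locally_integrable_measurable:
  fixes f :: "'a::euclidean_space \<Rightarrow> 'b::euclidean_space"
  assumes "open \<Omega>" "locally_integrable \<Omega> f"
  shows "f \<in> borel_measurable (lebesgue_on \<Omega>)"
proof -
  obtain C :: "nat \<Rightarrow> 'a set" where C: "\<And>n. compact (C n)" "\<And>n. C n \<subseteq> \<Omega>"
    "\<And>K. \<lbrakk>compact K; K \<subseteq> \<Omega>\<rbrakk> \<Longrightarrow> \<exists>N. \<forall>n\<ge>N. K \<subseteq> C n"
    using open_Union_compact_subsets[OF assms(1)] by metis
  have leb: "C n \<in> sets lebesgue" for n using C(1) by (simp add: lmeasurable_compact fmeasurableD)
  have "(\<lambda>x. if x \<in> \<Omega> then f x else 0) \<in> borel_measurable lebesgue"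
  proof (rule borel_measurable_LIMSEQ_metric)
    fix n
    have "f \<in> borel_measurable (lebesgue_on (C n))"
      using assms(2) C(1,2)[of n] by (auto simp: locally_integrable_def)
    then show "(\<lambda>x. if x \<in> C n then f x else 0) \<in> borel_measurable lebesgue"
      by (rule borel_measurable_if_I[OF _ leb])
  next
    fix x
    show "(\<lambda>n. if x \<in> C n then f x else 0) \<longlonglongrightarrow> (if x \<in> \<Omega> then f x else 0)"
    proof (cases "x \<in> \<Omega>")
      case True
      then obtain N where "\<forall>n\<ge>N. {x} \<subseteq> C n" using C(3)[of "{x}"] by auto
      then have "\<forall>\<^sub>F n in sequentially. (if x \<in> C n then f x else 0) = f x"
        by (auto simp: eventually_sequentially)
      then show ?thesis using True by (auto intro: tendsto_eventually)
    next
      case False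
      then have "\<And>n. x \<notin> C n" using C(2) by auto
      then show ?thesis using False by simp
    qed
  qed
  then show ?thesis using borel_measurable_if[OF open_sets_lebesgue[OF assms(1)]] by blast
qed

text \<open>If \<open>b\<close> is the sum of the bumps of the balls, then \<open>1 - exp (- n b)\<close> is a test function, and as \<open>n\<close> grows
  it increases to the indicator of the union of the balls. This gives smooth approximations of
  indicators without a partition of unity.\<close>

lemma integral_ball_union_eq_0:
  fixes g :: "'a::euclidean_space \<Rightarrow> real"
  assumes "open \<Omega>" "locally_integrable \<Omega> g"
    and 0: "\<And>\<eta>. \<eta> \<in> test_functions \<Omega> \<Longrightarrow> (LINT x|lebesgue_on \<Omega>. g x * \<eta> x) = 0"
    and P: "finite P" "r > 0" "(\<Union>p\<in>P. cball p r) \<subseteq> \<Omega>"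
  shows "(LINT x|lebesgue_on \<Omega>. g x * indicator (\<Union>p\<in>P. ball p r) x) = 0"
proof -
  let ?K = "\<Union>p\<in>P. cball p r" and ?U = "\<Union>p\<in>P. ball p r"
  define b where "b x = (\<Sum>p\<in>P. bump p r x)" for x
  define \<eta> where "\<eta> n x = 1 - exp (- real n * b x)" for n x
  have K: "compact ?K" using P by (intro compact_UN) auto
  have b_nonneg: "b x \<ge> 0" for x by (auto simp: b_def bump_nonneg intro: sum_nonneg)
  have b0: "b x = 0" if "x \<notin> ?U" for x
    unfolding b_def
  proof (intro sum.neutral ballI)
    fix p assume "p \<in> P"
    then have "\<not> bump p r x > 0" using that bump_pos_iff[OF P(2)] by blast
    then show "bump p r x = 0" using bump_nonneg[of p r x] by linarith
  qed
  have b_pos: "b x > 0" if "x \<in> ?U" for x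
    using that bump_pos_iff[OF P(2)] bump_nonneg P(1) by (auto simp: b_def intro!: sum_pos2 simp del: mem_ball)
  have smooth: "C_diff k UNIV (\<eta> n)" for k n
    unfolding \<eta>_def
  proof (rule C_diff_compose[where h="\<lambda>t. 1 - exp (- real n * t)" and H="{\<lambda>t. a + c * exp (- real n * t) | a c. True}" and T=UNIV])
    show "C_diff k UNIV b" unfolding b_def by (intro C_diff_sum bump_smooth P) auto
    show "(\<lambda>t. 1 - exp (- real n * t)) \<in> {\<lambda>t. a + c * exp (- real n * t) | a c. True}"
      by (rule CollectI, rule exI[of _ 1], rule exI[of _ "-1"], simp)
    fix h assume "h \<in> {\<lambda>t. a + c * exp (- real n * t) | a c. True}"
    then obtain a c where h: "h = (\<lambda>t. a + c * exp (- real n * t))" by auto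
    have "(h has_real_derivative 0 + (- real n * c) * exp (- real n * t)) (at t)" for t
      unfolding h by (auto intro!: derivative_eq_intros)
    then show "\<exists>h'\<in>{\<lambda>t. a + c * exp (- real n * t) | a c. True}. \<forall>t\<in>UNIV. (h has_real_derivative h' t) (at t)"
      by (intro bexI[of _ "\<lambda>t. 0 + (- real n * c) * exp (- real n * t)"] ballI CollectI) blast+
  qed auto
  have out: "\<eta> n x = 0" if "x \<notin> ?U" for n x using b0[OF that] by (simp add: \<eta>_def)
  have bd: "\<bar>\<eta> n x\<bar> \<le> 1" for n x using b_nonneg[of x] by (simp add: \<eta>_def)
  have lim: "(\<lambda>n. \<eta> n x) \<longlonglongrightarrow> indicator ?U x" for x
  proof (cases "x \<in> ?U")
    case True
    have "filterlim (\<lambda>n. real n * b x) at_top sequentially"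
      using b_pos[OF True] by (simp add: filterlim_at_top_mult_tendsto_pos[OF tendsto_const _ filterlim_real_sequentially, of "b x"] mult.commute)
    then have "(\<lambda>n. exp (- (real n * b x))) \<longlonglongrightarrow> 0"
      by (intro filterlim_compose[OF exp_at_bot] filterlim_compose[OF filterlim_uminus_at_bot_at_top])
    then have "(\<lambda>n. 1 - exp (- (real n * b x))) \<longlonglongrightarrow> 1 - 0" by (intro tendsto_intros)
    then show ?thesis using True by (simp add: \<eta>_def)
  qed (simp add: out)
  have meas: "g \<in> borel_measurable (lebesgue_on \<Omega>)"
    by (rule locally_integrable_measurable[OF assms(1,2)])
  have leb: "?K \<in> sets lebesgue" using K by (simp add: lmeasurable_compact fmeasurableD)
  have gK: "integrable (lebesgue_on \<Omega>) (\<lambda>x. indicator ?K x * g x)"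
  proof -
    have "integrable lebesgue (\<lambda>x. if x \<in> ?K then g x else 0)"
      using assms(2) K P(3) Lebesgue_Measure.integrable_restrict_UNIV[OF leb, of g] by (auto simp: locally_integrable_def)
    also have "(\<lambda>x. if x \<in> ?K then g x else 0) = (\<lambda>x. if x \<in> \<Omega> then indicator ?K x * g x else 0)"
      using subsetD[OF P(3)] by (auto simp: fun_eq_iff indicator_def)
    finally show ?thesis using Lebesgue_Measure.integrable_restrict_UNIV[OF open_sets_lebesgue[OF assms(1)]] by blast
  qed
  have "(\<lambda>n. LINT x|lebesgue_on \<Omega>. g x * \<eta> n x) \<longlonglongrightarrow> (LINT x|lebesgue_on \<Omega>. g x * indicator ?U x)"
  proof (rule integral_dominated_convergence[where w="\<lambda>x. \<bar>indicator ?K x * g x\<bar>"])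
    show "integrable (lebesgue_on \<Omega>) (\<lambda>x. \<bar>indicator ?K x * g x\<bar>)" using gK by (rule integrable_abs)
    show "AE x in lebesgue_on \<Omega>. (\<lambda>n. g x * \<eta> n x) \<longlonglongrightarrow> g x * indicator ?U x"
      by (intro AE_I2 tendsto_intros lim)
    show "AE x in lebesgue_on \<Omega>. norm (g x * \<eta> n x) \<le> \<bar>indicator ?K x * g x\<bar>" for n
    proof (rule AE_I2)
      fix x
      show "norm (g x * \<eta> n x) \<le> \<bar>indicator ?K x * g x\<bar>"
      proof (cases "x \<in> ?U")
        case True
        then have "indicator ?K x = (1::real)" by (auto simp: indicator_def intro: less_imp_le)
        then show ?thesis using bd[of n x] by (simp add: abs_mult mult_left_le)
      qed (simp add: out)
    qed
    show "(\<lambda>x. g x * indicator ?U x) \<in> borel_measurable (lebesgue_on \<Omega>)"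
    proof (intro borel_measurable_times meas borel_measurable_indicator)
      have "?U \<subseteq> \<Omega>" using P(3) by force
      then show "?U \<in> sets (lebesgue_on \<Omega>)"
        using assms(1) by (simp add: sets_restrict_space_iff open_UN)
    qed
    show "(\<lambda>x. g x * \<eta> n x) \<in> borel_measurable (lebesgue_on \<Omega>)" for n
      by (intro borel_measurable_times meas continuous_imp_measurable_on_sets_lebesgue
          continuous_on_subset[OF C_diff_continuous_on[OF smooth[of 0]]]) (use assms(1) in auto)
  qed
  moreover have "(LINT x|lebesgue_on \<Omega>. g x * \<eta> n x) = 0" for n
  proof (rule 0)
    show "\<eta> n \<in> test_functions \<Omega>"
      unfolding test_functions_def using smooth K P(3) out
      by (auto intro!: exI[of _ ?K]) (meson ball_subset_cball mem_ball mem_cball out subsetD UN_iff)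
  qed
  ultimately show ?thesis
    using LIMSEQ_unique[OF _ tendsto_const[of 0 sequentially]] by auto
qed


text \<open>Cover \<open>K\<close> by finitely many balls of radius \<open>r\<close> with centres in \<open>K\<close>. As \<open>r\<close> tends to zero, these unions shrink
  to \<open>K\<close> inside a fixed compact subset of \<open>\<Omega>\<close>, and dominated convergence applies.\<close>

lemma integral_compact_eq_0:
  fixes g :: "'a::euclidean_space \<Rightarrow> real"
  assumes "open \<Omega>" "locally_integrable \<Omega> g"
    and 0: "\<And>\<eta>. \<eta> \<in> test_functions \<Omega> \<Longrightarrow> (LINT x|lebesgue_on \<Omega>. g x * \<eta> x) = 0"
    and K: "compact K" "K \<subseteq> \<Omega>"
  shows "(LINT x|lebesgue_on K. g x) = 0"
proof -
  obtain e where e: "e > 0" "(\<Union>x\<in>K. cball x e) \<subseteq> \<Omega>"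
    using compact_subset_open_imp_cball_epsilon_subset[OF K(1) assms(1) K(2)] by blast
  define D where "D = (\<Union>x\<in>K. \<Union>y\<in>cball 0 e. {x + y})"
  have D: "compact D" unfolding D_def by (rule compact_sums'[OF K(1) compact_cball])
  have DU: "D = (\<Union>x\<in>K. cball x e)"
  proof -
    have "y \<in> D" if "x \<in> K" "y \<in> cball x e" for x y
      unfolding D_def using that
      by (intro UN_I[of x] UN_I[of "y - x"]) (auto simp: dist_norm norm_minus_commute)
    then show ?thesis by (auto simp: D_def dist_norm)
  qed
  define r where "r n = e / (real n + 1)" for n
  have r: "0 < r n" "r n \<le> e" for n using e(1) by (auto simp: r_def field_simps)
  have r0: "r \<longlonglongrightarrow> 0"
    using tendsto_mult[OF tendsto_const[of e] LIMSEQ_Suc[OF lim_1_over_n[where 'a=real]]]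
    by (simp add: r_def[abs_def] add.commute)
  have "\<exists>P. finite P \<and> P \<subseteq> K \<and> K \<subseteq> (\<Union>p\<in>P. ball p (r n))" for n
    using compactE_image[OF K(1), of K "\<lambda>p. ball p (r n)"] r(1)[of n] by (metis UN_I centre_in_ball open_ball subsetI)
  then obtain P where P: "\<And>n. finite (P n)" "\<And>n. P n \<subseteq> K" "\<And>n. K \<subseteq> (\<Union>p\<in>P n. ball p (r n))"
    by metis
  let ?U = "\<lambda>n. \<Union>p\<in>P n. ball p (r n)"
  have UD: "?U n \<subseteq> D" for n unfolding DU using P(2)[of n] r(2)[of n] by force
  have lim: "(\<lambda>n. indicator (?U n) x :: real) \<longlonglongrightarrow> indicator K x" for x
  proof (cases "x \<in> K")
    case True
    then have "x \<in> ?U n" for n using P(3) by blast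
    then show ?thesis using True by simp
  next
    case False
    show ?thesis
    proof (cases "K = {}")
      case True
      then have "P n = {}" for n using P(2) by auto
      then show ?thesis using False by simp
    next
      case ne: False
      have "infdist x K > 0"
        using False K(1) ne in_closed_iff_infdist_zero[of K x] infdist_nonneg[of x K] compact_imp_closed by fastforce
      then have "\<forall>\<^sub>F n in sequentially. r n < infdist x K" using r0 by (auto dest: order_tendstoD)
      then have "\<forall>\<^sub>F n in sequentially. (indicator (?U n) x :: real) = indicator K x"
      proof eventually_elim
        case (elim n)
        have "x \<notin> ?U n"
        proof
          assume "x \<in> ?U n"
          then obtain p where "p \<in> P n" "dist p x < r n" by auto
          then show False using elim infdist_le[of p K x] P(2)[of n] by (auto simp: dist_commute)
        qed
        then show ?case using False by simp
      qed
      then show ?thesis by (rule tendsto_eventually)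
    qed
  qed
  have meas: "g \<in> borel_measurable (lebesgue_on \<Omega>)"
    by (rule locally_integrable_measurable[OF assms(1,2)])
  have leb: "D \<in> sets lebesgue" "K \<in> sets lebesgue" using D K(1) by (auto simp: lmeasurable_compact fmeasurableD)
  have D\<Omega>: "D \<subseteq> \<Omega>" using e(2) DU by simp
  have gD: "integrable (lebesgue_on \<Omega>) (\<lambda>x. indicator D x * g x)"
  proof -
    have "integrable lebesgue (\<lambda>x. if x \<in> D then g x else 0)"
      using assms(2) D D\<Omega> Lebesgue_Measure.integrable_restrict_UNIV[OF leb(1), of g] by (auto simp: locally_integrable_def)
    also have "(\<lambda>x. if x \<in> D then g x else 0) = (\<lambda>x. if x \<in> \<Omega> then indicator D x * g x else 0)"
      using D\<Omega> by (auto simp: fun_eq_iff indicator_def)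
    finally show ?thesis using Lebesgue_Measure.integrable_restrict_UNIV[OF open_sets_lebesgue[OF assms(1)]] by blast
  qed
  have ind: "indicator S \<in> borel_measurable (lebesgue_on \<Omega>)" if "S \<in> sets lebesgue" "S \<subseteq> \<Omega>" for S :: "'a set"
    using that assms(1) by (intro borel_measurable_indicator) (simp add: sets_restrict_space_iff)
  have U\<Omega>: "?U n \<subseteq> \<Omega>" for n using UD D\<Omega> by blast
  have "(\<lambda>n. LINT x|lebesgue_on \<Omega>. g x * indicator (?U n) x) \<longlonglongrightarrow> (LINT x|lebesgue_on \<Omega>. g x * indicator K x)"
  proof (rule integral_dominated_convergence[where w="\<lambda>x. \<bar>indicator D x * g x\<bar>"])
    show "integrable (lebesgue_on \<Omega>) (\<lambda>x. \<bar>indicator D x * g x\<bar>)" using gD by (rule integrable_abs)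
    show "AE x in lebesgue_on \<Omega>. (\<lambda>n. g x * indicator (?U n) x) \<longlonglongrightarrow> g x * indicator K x"
      by (intro AE_I2 tendsto_intros lim)
    show "AE x in lebesgue_on \<Omega>. norm (g x * indicator (?U n) x) \<le> \<bar>indicator D x * g x\<bar>" for n
    proof (rule AE_I2)
      fix x
      show "norm (g x * indicator (?U n) x) \<le> \<bar>indicator D x * g x\<bar>"
        by (cases "x \<in> ?U n") (use UD[of n] in \<open>auto simp: subset_iff\<close>)
    qed
    show "(\<lambda>x. g x * indicator K x) \<in> borel_measurable (lebesgue_on \<Omega>)"
      by (intro borel_measurable_times meas ind leb K)
    show "(\<lambda>x. g x * indicator (?U n) x) \<in> borel_measurable (lebesgue_on \<Omega>)" for n
      by (intro borel_measurable_times meas ind U\<Omega> open_sets_lebesgue open_UN) auto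
  qed
  moreover have "(LINT x|lebesgue_on \<Omega>. g x * indicator (?U n) x) = 0" for n
  proof (rule integral_ball_union_eq_0[OF assms(1,2) 0 P(1) r(1)])
    show "(\<Union>p\<in>P n. cball p (r n)) \<subseteq> \<Omega>"
      using e(2) P(2)[of n] r(2)[of n] by (force simp: subset_iff)
  qed
  ultimately have "(LINT x|lebesgue_on \<Omega>. g x * indicator K x) = 0"
    using LIMSEQ_unique[OF _ tendsto_const[of 0 sequentially]] by auto
  moreover have "(LINT x|lebesgue_on \<Omega>. g x * indicator K x) = (LINT x|lebesgue. (if x \<in> \<Omega> then g x * indicator K x else 0))"
    by (rule Lebesgue_Measure.integral_restrict_UNIV[symmetric]) (use assms(1) in auto)
  moreover have "(\<lambda>x. if x \<in> \<Omega> then g x * indicator K x else 0) = (\<lambda>x. if x \<in> K then g x else 0)"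
    using K(2) by (auto simp: fun_eq_iff indicator_def)
  moreover have "(LINT x|lebesgue. (if x \<in> K then g x else 0)) = (LINT x|lebesgue_on K. g x)"
    by (rule Lebesgue_Measure.integral_restrict_UNIV[OF leb(2)])
  ultimately show ?thesis by simp
qed

text \<open>By inner regularity the set where \<open>g > 0\<close> is, up to a null set, a countable union of compact sets. On each
  of these \<open>g\<close> is positive with integral zero, so each of them is a null set.\<close>

lemma positivity_set_null:
  fixes g :: "'a::euclidean_space \<Rightarrow> real"
  assumes "open \<Omega>" "locally_integrable \<Omega> g"
    and 0: "\<And>K. compact K \<Longrightarrow> K \<subseteq> \<Omega> \<Longrightarrow> (LINT x|lebesgue_on K. g x) = 0"
  shows "AE x in lebesgue_on \<Omega>. g x \<le> 0"
proof -
  let ?A = "{x \<in> \<Omega>. g x > 0}"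
  have meas: "g \<in> borel_measurable (lebesgue_on \<Omega>)"
    by (rule locally_integrable_measurable[OF assms(1,2)])
  then have "{x \<in> space (lebesgue_on \<Omega>). g x > 0} \<in> sets (lebesgue_on \<Omega>)" by measurable
  then have "?A \<in> sets lebesgue" using assms(1) by (simp add: sets_restrict_space_iff)
  then obtain C T where C: "fsigma C" "T \<in> null_sets lebesgue" "C \<union> T = ?A"
    using lebesgue_set_almost_fsigma by metis
  obtain F :: "nat \<Rightarrow> 'a set" where F: "range F \<subseteq> Collect compact" "C = \<Union>(F ` UNIV)"
    using C(1) fsigma_Union_compact by metis
  have "F n \<in> null_sets lebesgue" for n
  proof -
    have cF: "compact (F n)" using F(1) by auto
    have FA: "F n \<subseteq> ?A" using F(2) C(3) by auto
    have leb: "F n \<in> sets lebesgue" using cF by (simp add: lmeasurable_compact fmeasurableD)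
    have int: "integrable (lebesgue_on (F n)) g"
      using assms(2) cF FA by (auto simp: locally_integrable_def)
    have "(LINT x|lebesgue_on (F n). g x) = 0" using 0[OF cF] FA by auto
    moreover have "AE x in lebesgue_on (F n). 0 \<le> g x"
      using FA by (auto intro!: AE_I2 less_imp_le)
    ultimately have "AE x in lebesgue_on (F n). g x = 0"
      using integral_nonneg_eq_0_iff_AE[OF int] by simp
    then have "AE x in lebesgue_on (F n). False"
      by (rule AE_mp) (use FA in \<open>auto intro!: AE_I2\<close>)
    then have "AE x in lebesgue. x \<notin> F n"
      using AE_restrict_space_iff[of "F n" lebesgue "\<lambda>_. False"] leb by simp
    then show ?thesis using AE_iff_null_sets[OF leb] by simp
  qed
  then have "C \<in> null_sets lebesgue" unfolding F(2) by (intro null_sets_UN') auto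
  then have "?A \<in> null_sets lebesgue" using C(2,3) null_sets.Un by metis
  then have "AE x in lebesgue. x \<notin> ?A" using AE_not_in by blast
  then have "AE x in lebesgue. x \<in> \<Omega> \<longrightarrow> g x \<le> 0"
    by (rule AE_mp) (auto intro!: AE_I2)
  then show ?thesis using AE_restrict_space_iff[of \<Omega> lebesgue] assms(1) by simp
qed

lemma fundamental_lemma:
  fixes g :: "'a::euclidean_space \<Rightarrow> real"
  assumes "open \<Omega>" "locally_integrable \<Omega> g"
    and 0: "\<And>\<eta>. \<eta> \<in> test_functions \<Omega> \<Longrightarrow> (LINT x|lebesgue_on \<Omega>. g x * \<eta> x) = 0"
  shows "AE x in lebesgue_on \<Omega>. g x = 0"
proof -
  have 1: "(LINT x|lebesgue_on K. g x) = 0" if "compact K" "K \<subseteq> \<Omega>" for K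
    by (rule integral_compact_eq_0[OF assms that])
  have "AE x in lebesgue_on \<Omega>. g x \<le> 0"
    by (rule positivity_set_null[OF assms(1,2) 1])
  moreover have "AE x in lebesgue_on \<Omega>. - g x \<le> 0"
    by (rule positivity_set_null[OF assms(1)]) (use assms(2) 1 in \<open>auto simp: locally_integrable_def\<close>)
  ultimately show ?thesis by eventually_elim simp
qed

section \<open>Weak gradients\<close>

lemma test_functionsE:
  assumes "\<eta> \<in> test_functions \<Omega>"
  obtains K where "compact K" "K \<subseteq> \<Omega>" "\<And>x. x \<notin> K \<Longrightarrow> \<eta> x = 0"
  using assms by (auto simp: test_functions_def)

lemma test_functions_C_diff: "\<eta> \<in> test_functions \<Omega> \<Longrightarrow> C_diff k U \<eta>"
  using C_diff_subset[of k UNIV \<eta> U] by (auto simp: test_functions_def)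

lemma test_functions_continuous: "\<eta> \<in> test_functions \<Omega> \<Longrightarrow> continuous_on U \<eta>"
  using test_functions_C_diff[of \<eta> \<Omega> 0] by simp

lemma test_functions_continuous_partial: "\<eta> \<in> test_functions \<Omega> \<Longrightarrow> b \<in> Basis \<Longrightarrow> continuous_on U (partial b \<eta>)"
  using test_functions_C_diff[of \<eta> \<Omega> 1 U] by simp

lemma continuous_on_grad: "(\<And>b. b \<in> Basis \<Longrightarrow> continuous_on U (partial b f)) \<Longrightarrow> continuous_on U (grad f)"
  unfolding grad_def[abs_def] by (intro continuous_intros) auto

lemma test_functions_differentiable: "\<eta> \<in> test_functions \<Omega> \<Longrightarrow> \<eta> differentiable (at x)"
  using C_diff_differentiable_at[OF test_functions_C_diff open_UNIV] by blast

lemma grad_diff: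
  "f differentiable (at x) \<Longrightarrow> g differentiable (at x) \<Longrightarrow> grad (\<lambda>x. f x - g x) x = grad f x - grad g x"
  by (simp add: grad_def partial_diff scaleR_diff_left sum_subtractf)

lemma grad_zero_outside:
  assumes "closed K" "\<And>x. x \<notin> K \<Longrightarrow> f x = 0" "x \<notin> K"
  shows "grad f x = 0"
  using partial_zero_outside[OF assms] by (simp add: grad_def)

lemma test_functions_diff:
  assumes "\<eta> \<in> test_functions \<Omega>" "\<zeta> \<in> test_functions \<Omega>"
  shows "(\<lambda>x. \<eta> x - \<zeta> x) \<in> test_functions \<Omega>"
proof -
  obtain K where K: "compact K" "K \<subseteq> \<Omega>" "\<And>x. x \<notin> K \<Longrightarrow> \<eta> x = 0"
    using test_functionsE[OF assms(1)] by blast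
  obtain L where L: "compact L" "L \<subseteq> \<Omega>" "\<And>x. x \<notin> L \<Longrightarrow> \<zeta> x = 0"
    using test_functionsE[OF assms(2)] by blast
  have "C_diff k UNIV (\<lambda>x. \<eta> x - \<zeta> x)" for k
    by (intro C_diff_diff open_UNIV test_functions_C_diff[OF assms(1)] test_functions_C_diff[OF assms(2)])
  moreover have "compact (K \<union> L)" "K \<union> L \<subseteq> \<Omega>" "\<forall>x. x \<notin> K \<union> L \<longrightarrow> \<eta> x - \<zeta> x = 0"
    using K L by (auto simp: compact_Un)
  ultimately show ?thesis
    unfolding test_functions_def by (intro CollectI conjI allI exI[of _ "K \<union> L"]) auto
qed

lemma locally_integrable_inner_left: "locally_integrable \<Omega> G \<Longrightarrow> locally_integrable \<Omega> (\<lambda>x. G x \<bullet> b)"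
  by (auto simp: locally_integrable_def)

lemma locally_integrable_diff:
  "locally_integrable \<Omega> f \<Longrightarrow> locally_integrable \<Omega> g \<Longrightarrow> locally_integrable \<Omega> (\<lambda>x. f x - g x)"
  by (auto simp: locally_integrable_def)

lemma integrable_mult_test:
  assumes "open \<Omega>" "locally_integrable \<Omega> f" "\<eta> \<in> test_functions \<Omega>"
  shows "integrable (lebesgue_on \<Omega>) (\<lambda>x. f x * \<eta> x)"
proof -
  obtain K where K: "compact K" "K \<subseteq> \<Omega>" "\<And>x. x \<notin> K \<Longrightarrow> \<eta> x = 0"
    using test_functionsE[OF assms(3)] by blast
  show ?thesis
    by (rule locally_integrable_mult[OF assms(1,2) K(1,2) test_functions_continuous[OF assms(3)]]) (use K(3) in auto)
qed

lemma integrable_mult_partial_test: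
  assumes "open \<Omega>" "locally_integrable \<Omega> f" "\<eta> \<in> test_functions \<Omega>" "b \<in> Basis"
  shows "integrable (lebesgue_on \<Omega>) (\<lambda>x. f x * partial b \<eta> x)"
proof -
  obtain K where K: "compact K" "K \<subseteq> \<Omega>" "\<And>x. x \<notin> K \<Longrightarrow> \<eta> x = 0"
    using test_functionsE[OF assms(3)] by blast
  show ?thesis
    by (rule locally_integrable_mult[OF assms(1,2) K(1,2) test_functions_continuous_partial[OF assms(3,4)]])
       (use partial_zero_outside[OF compact_imp_closed[OF K(1)] K(3)] in auto)
qed

lemma has_weak_gradientD:
  assumes "has_weak_gradient \<Omega> f G"
  shows "locally_integrable \<Omega> f" "locally_integrable \<Omega> G"
    "\<eta> \<in> test_functions \<Omega> \<Longrightarrow> b \<in> Basis \<Longrightarrow>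
      (LINT x|lebesgue_on \<Omega>. f x * partial b \<eta> x) = - (LINT x|lebesgue_on \<Omega>. (G x \<bullet> b) * \<eta> x)"
  using assms by (auto simp: has_weak_gradient_def)

lemma has_weak_gradient_diff:
  fixes f g :: "'a::euclidean_space \<Rightarrow> real"
  assumes "open \<Omega>" "has_weak_gradient \<Omega> f F" "has_weak_gradient \<Omega> g G"
  shows "has_weak_gradient \<Omega> (\<lambda>x. f x - g x) (\<lambda>x. F x - G x)"
  unfolding has_weak_gradient_def
proof (intro conjI ballI)
  note f = has_weak_gradientD[OF assms(2)] and g = has_weak_gradientD[OF assms(3)]
  show "locally_integrable \<Omega> (\<lambda>x. f x - g x)" "locally_integrable \<Omega> (\<lambda>x. F x - G x)"
    by (intro locally_integrable_diff f g)+
  fix \<eta> :: "'a \<Rightarrow> real" and b :: 'a assume that: "\<eta> \<in> test_functions \<Omega>" "b \<in> Basis"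
  have "(LINT x|lebesgue_on \<Omega>. (f x - g x) * partial b \<eta> x)
      = (LINT x|lebesgue_on \<Omega>. f x * partial b \<eta> x) - (LINT x|lebesgue_on \<Omega>. g x * partial b \<eta> x)"
    unfolding left_diff_distrib
    by (intro Bochner_Integration.integral_diff integrable_mult_partial_test[OF assms(1)] f g that)
  also have "\<dots> = - ((LINT x|lebesgue_on \<Omega>. (F x \<bullet> b) * \<eta> x) - (LINT x|lebesgue_on \<Omega>. (G x \<bullet> b) * \<eta> x))"
    unfolding f(3)[OF that] g(3)[OF that] by simp
  also have "(LINT x|lebesgue_on \<Omega>. (F x \<bullet> b) * \<eta> x) - (LINT x|lebesgue_on \<Omega>. (G x \<bullet> b) * \<eta> x)
      = (LINT x|lebesgue_on \<Omega>. ((F x - G x) \<bullet> b) * \<eta> x)"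
    unfolding left_diff_distrib inner_diff_left
    by (intro Bochner_Integration.integral_diff[symmetric] integrable_mult_test[OF assms(1)]
        locally_integrable_inner_left f g that)
  finally show "(LINT x|lebesgue_on \<Omega>. (f x - g x) * partial b \<eta> x)
      = - (LINT x|lebesgue_on \<Omega>. ((F x - G x) \<bullet> b) * \<eta> x)" .
qed

text \<open>Weak gradients are linear, so their uniqueness reduces to this case.\<close>

lemma weak_gradient_zero:
  assumes "open \<Omega>" "has_weak_gradient \<Omega> f G" "AE x in lebesgue_on \<Omega>. f x = 0"
  shows "AE x in lebesgue_on \<Omega>. G x = 0"
proof -
  note f = has_weak_gradientD[OF assms(2)]
  have "AE x in lebesgue_on \<Omega>. G x \<bullet> b = 0" if b: "b \<in> Basis" for b
  proof (rule fundamental_lemma[OF assms(1) locally_integrable_inner_left[OF f(2)]])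
    fix \<eta> assume \<eta>: "\<eta> \<in> test_functions \<Omega>"
    have "AE x in lebesgue_on \<Omega>. f x * partial b \<eta> x = 0"
      using assms(3) by eventually_elim simp
    then have "(LINT x|lebesgue_on \<Omega>. f x * partial b \<eta> x) = 0"
      by (rule integral_eq_zero_AE)
    then show "(LINT x|lebesgue_on \<Omega>. G x \<bullet> b * \<eta> x) = 0" using f(3)[OF \<eta> b] by simp
  qed
  then have "AE x in lebesgue_on \<Omega>. \<forall>b\<in>Basis. G x \<bullet> b = 0"
    by (rule AE_finite_allI[OF finite_Basis])
  then show ?thesis
  proof eventually_elim
    case (elim x)
    show ?case by (rule euclidean_eqI) (use elim in simp)
  qed
qed

lemma has_weak_gradient_unique:
  assumes "open \<Omega>" "has_weak_gradient \<Omega> f F" "has_weak_gradient \<Omega> f G"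
  shows "AE x in lebesgue_on \<Omega>. F x = G x"
proof -
  have "AE x in lebesgue_on \<Omega>. F x - G x = 0"
    by (rule weak_gradient_zero[OF assms(1) has_weak_gradient_diff[OF assms]]) simp
  then show ?thesis by eventually_elim simp
qed

lemma has_weak_gradient_weak_gradient:
  "has_weak_gradient \<Omega> f G \<Longrightarrow> has_weak_gradient \<Omega> f (weak_gradient \<Omega> f)"
  unfolding weak_gradient_def by (rule someI[of "has_weak_gradient \<Omega> f"])

lemma weak_gradient_AE:
  "open \<Omega> \<Longrightarrow> has_weak_gradient \<Omega> f G \<Longrightarrow> AE x in lebesgue_on \<Omega>. weak_gradient \<Omega> f x = G x"
  by (rule has_weak_gradient_unique) (auto intro: has_weak_gradient_weak_gradient)

lemma continuous_locally_integrable: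
  fixes f :: "'a::euclidean_space \<Rightarrow> 'b::euclidean_space"
  assumes "continuous_on \<Omega> f"
  shows "locally_integrable \<Omega> f"
  unfolding locally_integrable_def
proof (intro allI impI)
  fix K assume K: "compact K \<and> K \<subseteq> \<Omega>"
  have leb: "K \<in> sets lebesgue" using K by (simp add: lmeasurable_compact fmeasurableD)
  have "integrable lborel (\<lambda>x. if x \<in> K then f x else 0)"
    using K assms by (intro integrable_compact_support_lborel[of K]) (auto intro: continuous_on_subset cong: continuous_on_cong)
  then have "integrable lebesgue (\<lambda>x. if x \<in> K then f x else 0)"
    using integrable_completion[of "\<lambda>x. if x \<in> K then f x else 0" lborel] by auto
  then show "integrable (lebesgue_on K) f"
    by (simp add: Lebesgue_Measure.integrable_restrict_UNIV[OF leb])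
qed

lemma has_weak_gradient_grad:
  assumes "open \<Omega>" "C_diff 1 \<Omega> f"
  shows "has_weak_gradient \<Omega> f (grad f)"
  unfolding has_weak_gradient_def
proof (intro conjI ballI)
  show "locally_integrable \<Omega> f" "locally_integrable \<Omega> (grad f)"
    using assms C_diff_continuous_on[OF assms(2)] by (auto intro!: continuous_locally_integrable continuous_on_grad)
  fix \<eta> and b :: 'a assume \<eta>: "\<eta> \<in> test_functions \<Omega>" and b: "b \<in> Basis"
  obtain K where K: "compact K" "K \<subseteq> \<Omega>" "\<And>x. x \<notin> K \<Longrightarrow> \<eta> x = 0"
    using test_functionsE[OF \<eta>] by blast
  show "(LINT x|lebesgue_on \<Omega>. f x * partial b \<eta> x) = - (LINT x|lebesgue_on \<Omega>. (grad f x \<bullet> b) * \<eta> x)"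
    using integral_by_parts[OF assms test_functions_C_diff[OF \<eta>] K(1,2) _ b] K(3) b by simp
qed

section \<open>Energy and the space \<open>H\<^sup>1\<^sub>0\<close>\<close>

text \<open>The square of the \<open>H\<^sup>1\<close> norm, with the gradient as a separate argument: an arbitrary representative
  can then be used in place of the chosen weak gradient.\<close>

definition energy :: "'a::euclidean_space set \<Rightarrow> ('a \<Rightarrow> real) \<Rightarrow> ('a \<Rightarrow> 'a) \<Rightarrow> real" where
  "energy \<Omega> f G = (LINT x|lebesgue_on \<Omega>. (f x)\<^sup>2 + (norm (G x))\<^sup>2)"

text \<open>The parallelogram identity. Used in place of the triangle inequality of the \<open>H\<^sup>1\<close> norm, it avoids square
  roots at the price of a factor 2.\<close>

lemma norm_diff_sq_le: "(norm (a - b :: 'a::real_inner))\<^sup>2 \<le> 2 * (norm a)\<^sup>2 + 2 * (norm b)\<^sup>2"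
proof -
  have "(norm (a - b))\<^sup>2 + (norm (a + b))\<^sup>2 = 2 * (norm a)\<^sup>2 + 2 * (norm b)\<^sup>2"
    by (simp add: power2_norm_eq_inner inner_diff_left inner_diff_right inner_add_left inner_add_right inner_commute)
  then show ?thesis using zero_le_power2[of "norm (a + b)"] by linarith
qed

lemma square_integrable_diff:
  fixes f g :: "'a::euclidean_space \<Rightarrow> 'b::euclidean_space"
  assumes "square_integrable \<Omega> f" "square_integrable \<Omega> g"
  shows "square_integrable \<Omega> (\<lambda>x. f x - g x)"
  unfolding square_integrable_def
proof
  show m: "(\<lambda>x. f x - g x) \<in> borel_measurable (lebesgue_on \<Omega>)"
    using assms by (auto simp: square_integrable_def)
  have "integrable (lebesgue_on \<Omega>) (\<lambda>x. 2 * (norm (f x))\<^sup>2 + 2 * (norm (g x))\<^sup>2)"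
    using assms by (auto simp: square_integrable_def)
  then show "integrable (lebesgue_on \<Omega>) (\<lambda>x. (norm (f x - g x))\<^sup>2)"
    by (rule Bochner_Integration.integrable_bound) (use m norm_diff_sq_le in auto)
qed

lemma square_integrable_AE:
  fixes f g :: "'a::euclidean_space \<Rightarrow> 'b::euclidean_space"
  assumes "square_integrable \<Omega> f" "g \<in> borel_measurable (lebesgue_on \<Omega>)" "AE x in lebesgue_on \<Omega>. f x = g x"
  shows "square_integrable \<Omega> g"
proof -
  have "integrable (lebesgue_on \<Omega>) (\<lambda>x. (norm (f x))\<^sup>2) = integrable (lebesgue_on \<Omega>) (\<lambda>x. (norm (g x))\<^sup>2)"
    by (rule integrable_cong_AE) (use assms in \<open>auto simp: square_integrable_def\<close>)
  then show ?thesis using assms by (simp add: square_integrable_def)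
qed

lemma continuous_compact_support_square_integrable:
  fixes f :: "'a::euclidean_space \<Rightarrow> 'b::euclidean_space"
  assumes "open \<Omega>" "compact K" "K \<subseteq> \<Omega>" "continuous_on \<Omega> f" "\<And>x. x \<in> \<Omega> - K \<Longrightarrow> f x = 0"
  shows "square_integrable \<Omega> f"
  unfolding square_integrable_def
proof
  show "f \<in> borel_measurable (lebesgue_on \<Omega>)"
    using assms by (intro continuous_imp_measurable_on_sets_lebesgue) auto
  show "integrable (lebesgue_on \<Omega>) (\<lambda>x. (norm (f x))\<^sup>2)"
    by (rule integrable_compact_support[OF assms(1-3)]) (use assms(4,5) in \<open>auto intro!: continuous_intros\<close>)
qed

lemma test_square_integrable:
  assumes "open \<Omega>" "\<eta> \<in> test_functions \<Omega>"
  shows "square_integrable \<Omega> \<eta>" "square_integrable \<Omega> (grad \<eta>)"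
proof -
  obtain K where K: "compact K" "K \<subseteq> \<Omega>" "\<And>x. x \<notin> K \<Longrightarrow> \<eta> x = 0"
    using test_functionsE[OF assms(2)] by blast
  show "square_integrable \<Omega> \<eta>"
    by (rule continuous_compact_support_square_integrable[OF assms(1) K(1,2) test_functions_continuous[OF assms(2)]])
       (use K(3) in auto)
  show "square_integrable \<Omega> (grad \<eta>)"
    by (rule continuous_compact_support_square_integrable[OF assms(1) K(1,2) continuous_on_grad])
       (use test_functions_continuous_partial[OF assms(2)] grad_zero_outside[OF compact_imp_closed[OF K(1)] K(3)] in auto)
qed

lemma test_has_weak_gradient: "open \<Omega> \<Longrightarrow> \<eta> \<in> test_functions \<Omega> \<Longrightarrow> has_weak_gradient \<Omega> \<eta> (grad \<eta>)"
  by (rule has_weak_gradient_grad[OF _ test_functions_C_diff])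

lemma H1_norm_eq_energy:
  assumes "open \<Omega>" "square_integrable \<Omega> f" "has_weak_gradient \<Omega> f G" "square_integrable \<Omega> G"
  shows "H1_norm \<Omega> f = sqrt (energy \<Omega> f G)"
proof -
  have "(LINT x|lebesgue_on \<Omega>. (norm (weak_gradient \<Omega> f x))\<^sup>2) = (LINT x|lebesgue_on \<Omega>. (norm (G x))\<^sup>2)"
  proof (rule integral_cong_AE)
    show "AE x in lebesgue_on \<Omega>. (norm (weak_gradient \<Omega> f x))\<^sup>2 = (norm (G x))\<^sup>2"
      using weak_gradient_AE[OF assms(1,3)] by eventually_elim simp
    have "weak_gradient \<Omega> f \<in> borel_measurable (lebesgue_on \<Omega>)"
      using has_weak_gradient_weak_gradient[OF assms(3)] locally_integrable_measurable[OF assms(1)]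
      by (auto simp: has_weak_gradient_def)
    then show "(\<lambda>x. (norm (weak_gradient \<Omega> f x))\<^sup>2) \<in> borel_measurable (lebesgue_on \<Omega>)" by simp
  qed (use assms(4) in \<open>auto simp: square_integrable_def\<close>)
  moreover have "energy \<Omega> f G = (LINT x|lebesgue_on \<Omega>. (f x)\<^sup>2) + (LINT x|lebesgue_on \<Omega>. (norm (G x))\<^sup>2)"
    unfolding energy_def using assms by (intro Bochner_Integration.integral_add) (auto simp: square_integrable_def)
  ultimately show ?thesis by (simp add: H1_norm_def)
qed

lemma weak_gradient_square_integrable:
  assumes "open \<Omega>" "has_weak_gradient \<Omega> f G" "square_integrable \<Omega> G"
  shows "square_integrable \<Omega> (weak_gradient \<Omega> f)"
proof (rule square_integrable_AE[OF assms(3)])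
  show "weak_gradient \<Omega> f \<in> borel_measurable (lebesgue_on \<Omega>)"
    using has_weak_gradient_weak_gradient[OF assms(2)] locally_integrable_measurable[OF assms(1)]
    by (auto simp: has_weak_gradient_def)
  show "AE x in lebesgue_on \<Omega>. G x = weak_gradient \<Omega> f x"
    using weak_gradient_AE[OF assms(1,2)] by eventually_elim simp
qed

lemma H1_0_I:
  assumes "open \<Omega>" "square_integrable \<Omega> f" "has_weak_gradient \<Omega> f G" "square_integrable \<Omega> G"
    and appr: "\<And>\<epsilon>. \<epsilon> > 0 \<Longrightarrow> \<exists>\<eta>\<in>test_functions \<Omega>. energy \<Omega> (\<lambda>x. f x - \<eta> x) (\<lambda>x. G x - grad \<eta> x) < \<epsilon>"
  shows "f \<in> H1_0 \<Omega>"
  unfolding H1_0_def H1_def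
proof (intro CollectI conjI exI[of _ G] allI impI)
  fix \<epsilon> :: real assume \<epsilon>: "\<epsilon> > 0"
  then obtain \<eta> where \<eta>: "\<eta> \<in> test_functions \<Omega>" "energy \<Omega> (\<lambda>x. f x - \<eta> x) (\<lambda>x. G x - grad \<eta> x) < \<epsilon>\<^sup>2"
    using appr[of "\<epsilon>\<^sup>2"] by auto
  have "H1_norm \<Omega> (\<lambda>x. f x - \<eta> x) = sqrt (energy \<Omega> (\<lambda>x. f x - \<eta> x) (\<lambda>x. G x - grad \<eta> x))"
    by (intro H1_norm_eq_energy assms square_integrable_diff has_weak_gradient_diff
        test_square_integrable test_has_weak_gradient \<eta>)
  also have "\<dots> < \<epsilon>" using real_sqrt_less_mono[OF \<eta>(2)] \<epsilon> by simp
  finally show "\<exists>\<eta>\<in>test_functions \<Omega>. H1_norm \<Omega> (\<lambda>x. f x - \<eta> x) < \<epsilon>" using \<eta>(1) by blast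
qed (use assms in auto)

lemma H1_0_D:
  assumes "open \<Omega>" "f \<in> H1_0 \<Omega>"
  shows "square_integrable \<Omega> f" "has_weak_gradient \<Omega> f (weak_gradient \<Omega> f)" "square_integrable \<Omega> (weak_gradient \<Omega> f)"
proof -
  obtain G where G: "square_integrable \<Omega> f" "has_weak_gradient \<Omega> f G" "square_integrable \<Omega> G"
    using assms(2) by (auto simp: H1_0_def H1_def)
  then show "square_integrable \<Omega> f" "has_weak_gradient \<Omega> f (weak_gradient \<Omega> f)" "square_integrable \<Omega> (weak_gradient \<Omega> f)"
    using has_weak_gradient_weak_gradient weak_gradient_square_integrable[OF assms(1)] by auto
qed

lemma H1_0_approx:
  assumes "open \<Omega>" "f \<in> H1_0 \<Omega>" "\<epsilon> > 0"
  shows "\<exists>\<eta>\<in>test_functions \<Omega>. energy \<Omega> (\<lambda>x. f x - \<eta> x) (\<lambda>x. weak_gradient \<Omega> f x - grad \<eta> x) < \<epsilon>"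
proof -
  obtain \<eta> where \<eta>: "\<eta> \<in> test_functions \<Omega>" "H1_norm \<Omega> (\<lambda>x. f x - \<eta> x) < sqrt \<epsilon>"
    using assms(2) real_sqrt_gt_zero[OF assms(3)] unfolding H1_0_def by blast
  have "H1_norm \<Omega> (\<lambda>x. f x - \<eta> x) = sqrt (energy \<Omega> (\<lambda>x. f x - \<eta> x) (\<lambda>x. weak_gradient \<Omega> f x - grad \<eta> x))"
    by (intro H1_norm_eq_energy assms(1) square_integrable_diff has_weak_gradient_diff
        test_square_integrable test_has_weak_gradient \<eta> H1_0_D[OF assms(1,2)])
  then show ?thesis using \<eta> by (intro bexI[of _ \<eta>]) auto
qed

lemma energy_diff_le:
  assumes "square_integrable \<Omega> f" "square_integrable \<Omega> F" "square_integrable \<Omega> g" "square_integrable \<Omega> G"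
  shows "energy \<Omega> (\<lambda>x. f x - g x) (\<lambda>x. F x - G x) \<le> 2 * energy \<Omega> f F + 2 * energy \<Omega> g G"
proof -
  have i: "integrable (lebesgue_on \<Omega>) (\<lambda>x. (f x)\<^sup>2 + (norm (F x))\<^sup>2)" "integrable (lebesgue_on \<Omega>) (\<lambda>x. (g x)\<^sup>2 + (norm (G x))\<^sup>2)"
    "integrable (lebesgue_on \<Omega>) (\<lambda>x. (f x - g x)\<^sup>2 + (norm (F x - G x))\<^sup>2)"
    using assms square_integrable_diff[OF assms(1,3)] square_integrable_diff[OF assms(2,4)]
    by (auto simp: square_integrable_def)
  have "energy \<Omega> (\<lambda>x. f x - g x) (\<lambda>x. F x - G x) \<le>
     (LINT x|lebesgue_on \<Omega>. 2 * ((f x)\<^sup>2 + (norm (F x))\<^sup>2) + 2 * ((g x)\<^sup>2 + (norm (G x))\<^sup>2))"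
    unfolding energy_def
  proof (rule Bochner_Integration.integral_mono[OF i(3)])
    fix x
    show "(f x - g x)\<^sup>2 + (norm (F x - G x))\<^sup>2 \<le> 2 * ((f x)\<^sup>2 + (norm (F x))\<^sup>2) + 2 * ((g x)\<^sup>2 + (norm (G x))\<^sup>2)"
      using norm_diff_sq_le[of "f x" "g x"] norm_diff_sq_le[of "F x" "G x"] by (simp add: algebra_simps)
  qed (intro Bochner_Integration.integrable_add integrable_mult_right i)
  also have "\<dots> = 2 * energy \<Omega> f F + 2 * energy \<Omega> g G"
    unfolding energy_def
    by (subst Bochner_Integration.integral_add)
       (intro integrable_mult_right i | simp only: integral_mult_right_zero)+
  finally show ?thesis .
qed

lemma H1_0_diff:
  assumes "open \<Omega>" "f \<in> H1_0 \<Omega>" "g \<in> H1_0 \<Omega>"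
  shows "(\<lambda>x. f x - g x) \<in> H1_0 \<Omega>"
proof (rule H1_0_I[OF assms(1)])
  note D = H1_0_D[OF assms(1,2)] H1_0_D[OF assms(1,3)]
  note T = test_square_integrable[OF assms(1)]
  let ?G = "\<lambda>x. weak_gradient \<Omega> f x - weak_gradient \<Omega> g x"
  show "square_integrable \<Omega> (\<lambda>x. f x - g x)" "square_integrable \<Omega> ?G" "has_weak_gradient \<Omega> (\<lambda>x. f x - g x) ?G"
    using D assms(1) by (auto intro: square_integrable_diff has_weak_gradient_diff)
  fix \<epsilon> :: real assume "\<epsilon> > 0"
  then have "\<epsilon> / 4 > 0" by simp
  then obtain \<eta> \<zeta> where \<eta>: "\<eta> \<in> test_functions \<Omega>" "energy \<Omega> (\<lambda>x. f x - \<eta> x) (\<lambda>x. weak_gradient \<Omega> f x - grad \<eta> x) < \<epsilon> / 4"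
    and \<zeta>: "\<zeta> \<in> test_functions \<Omega>" "energy \<Omega> (\<lambda>x. g x - \<zeta> x) (\<lambda>x. weak_gradient \<Omega> g x - grad \<zeta> x) < \<epsilon> / 4"
    using H1_0_approx[OF assms(1,2)] H1_0_approx[OF assms(1,3)] by meson
  have "energy \<Omega> (\<lambda>x. (f x - \<eta> x) - (g x - \<zeta> x)) (\<lambda>x. (weak_gradient \<Omega> f x - grad \<eta> x) - (weak_gradient \<Omega> g x - grad \<zeta> x))
    \<le> 2 * energy \<Omega> (\<lambda>x. f x - \<eta> x) (\<lambda>x. weak_gradient \<Omega> f x - grad \<eta> x)
      + 2 * energy \<Omega> (\<lambda>x. g x - \<zeta> x) (\<lambda>x. weak_gradient \<Omega> g x - grad \<zeta> x)"
    by (intro energy_diff_le square_integrable_diff D T \<eta> \<zeta>)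
  also have "\<dots> < \<epsilon>" using \<eta>(2) \<zeta>(2) by linarith
  finally have "energy \<Omega> (\<lambda>x. f x - g x - (\<eta> x - \<zeta> x)) (\<lambda>x. ?G x - grad (\<lambda>x. \<eta> x - \<zeta> x) x) < \<epsilon>"
    by (simp add: grad_diff test_functions_differentiable[OF \<eta>(1)] test_functions_differentiable[OF \<zeta>(1)] algebra_simps)
  then show "\<exists>\<eta>\<in>test_functions \<Omega>. energy \<Omega> (\<lambda>x. f x - g x - \<eta> x) (\<lambda>x. ?G x - grad \<eta> x) < \<epsilon>"
    by (intro bexI[of _ "\<lambda>x. \<eta> x - \<zeta> x"] test_functions_diff \<eta>(1) \<zeta>(1))
qed

lemma H1_0_test: 
  assumes "open \<Omega>" "\<eta> \<in> test_functions \<Omega>"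
  shows "\<eta> \<in> H1_0 \<Omega>"
  by (rule H1_0_I[OF assms(1) test_square_integrable(1)[OF assms] test_has_weak_gradient[OF assms] test_square_integrable(2)[OF assms]])
     (intro bexI[of _ \<eta>], auto simp: energy_def assms)

section \<open>Mollification\<close>

lemma eventually_modulus:
  fixes g :: "'a::euclidean_space \<Rightarrow> real"
  assumes "compact K" "continuous_on UNIV g" "\<And>x. x \<notin> K \<Longrightarrow> g x = 0" "\<epsilon> > 0"
  shows "\<forall>\<^sub>F \<delta> in at_right 0. \<forall>x y. dist x y \<le> \<delta> \<longrightarrow> \<bar>g x - g y\<bar> \<le> \<epsilon>"
proof -
  obtain r where r: "K \<subseteq> cball 0 r"
    by (metis assms(1) bounded_pos compact_imp_bounded mem_cball_0 subsetI)
  have "uniformly_continuous_on (cball 0 (r + 1)) g"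
    using assms(2) by (intro compact_uniformly_continuous) (auto intro: continuous_on_subset)
  then obtain e where e: "e > 0" "\<And>x y. x \<in> cball 0 (r + 1) \<Longrightarrow> y \<in> cball 0 (r + 1) \<Longrightarrow> dist y x < e \<Longrightarrow> dist (g y) (g x) < \<epsilon>"
    using assms(4) unfolding uniformly_continuous_on_def by metis
  have "\<bar>g x - g y\<bar> \<le> \<epsilon>" if "dist x y \<le> \<delta>" "\<delta> < min e 1" for \<delta> x y
  proof (cases "x \<in> K \<or> y \<in> K")
    case True
    then have "norm x \<le> r \<or> norm y \<le> r" using r by auto
    then have "norm x \<le> r + 1" "norm y \<le> r + 1"
      using that norm_triangle_sub[of x y] norm_triangle_sub[of y x] by (auto simp: dist_norm norm_minus_commute)
    then show ?thesis using e(2)[of y x] that by (auto simp: dist_real_def dist_commute)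
  qed (use assms in auto)
  moreover have "\<forall>\<^sub>F \<delta> in at_right 0. \<delta> < min e 1"
    using e(1) by (intro eventually_at_right_real[THEN eventually_mono, of 0 "min e 1"]) auto
  ultimately show ?thesis by (auto elim!: eventually_mono)
qed

lemma integral_cbox_eq_lborel:
  fixes f :: "'a::euclidean_space \<Rightarrow> real"
  assumes "K \<subseteq> cbox a b" "compact K" "continuous_on UNIV f" "\<And>x. x \<notin> K \<Longrightarrow> f x = 0"
  shows "integral (cbox a b) f = (LINT x|lborel. f x)" "f integrable_on cbox a b" "integrable lborel f"
proof -
  show i: "integrable lborel f"
    using assms by (intro integrable_compact_support_lborel[of K]) (auto intro: continuous_on_subset)
  have "(\<lambda>x. if x \<in> cbox a b then f x else 0) = f" using assms(1,4) by (intro ext) (metis subsetD)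
  then show "integral (cbox a b) f = (LINT x|lborel. f x)"
    using integral_lborel[OF i] Henstock_Kurzweil_Integration.integral_restrict_UNIV[of "cbox a b" f] by simp
  show "f integrable_on cbox a b"
    using assms(3) by (intro integrable_continuous) (auto intro: continuous_on_subset)
qed

lemma continuous_on_UNIV_reflect:
  "continuous_on UNIV \<rho> \<Longrightarrow> continuous_on UNIV (\<lambda>y. \<rho> (x - y))" for \<rho> :: "'a::euclidean_space \<Rightarrow> 'b::topological_space"
  by (rule continuous_on_compose2[of UNIV]) (auto intro!: continuous_intros)

text \<open>Since \<open>f\<close> has compact support, the convolution is an integral over a box and can be differentiated under
  the integral sign. The derivative is again a convolution with \<open>f\<close>, so smoothness follows by
  induction.\<close>

lemma convolution_has_derivative:
  fixes f \<rho> :: "'a::euclidean_space \<Rightarrow> real"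
  assumes f: "continuous_on UNIV f" "compact K" "\<And>x. x \<notin> K \<Longrightarrow> f x = 0"
    and \<rho>: "C_diff 1 UNIV \<rho>"
  shows "(\<lambda>x. LINT y|lborel. f y * \<rho> (x - y)) differentiable (at x)"
    and "b \<in> Basis \<Longrightarrow> partial b (\<lambda>x. LINT y|lborel. f y * \<rho> (x - y)) x = (LINT y|lborel. f y * partial b \<rho> (x - y))"
proof -
  obtain l u where lu: "K \<subseteq> cbox l u"
    using bounded_subset_cbox_symmetric[OF compact_imp_bounded[OF f(2)]] by blast
  have c\<rho>: "continuous_on UNIV \<rho>" using C_diff_continuous_on[OF \<rho>] .
  have cp: "continuous_on UNIV (partial b \<rho>)" if "b \<in> Basis" for b using \<rho> that by simp
  have cg: "continuous_on UNIV (grad \<rho>)" by (rule continuous_on_grad) (rule cp)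
  note * = integral_cbox_eq_lborel[OF lu f(2)]
  have eq: "(LINT y|lborel. f y * \<rho> (x - y)) = integral (cbox l u) (\<lambda>y. f y * \<rho> (x - y))" for x
    by (rule *(1)[symmetric]) (auto intro!: continuous_intros continuous_on_UNIV_reflect f c\<rho> simp: f(3))
  define D where "D x y = blinfun_inner_left (f y *\<^sub>R grad \<rho> (x - y))" for x y
  have cD: "continuous_on (UNIV \<times> cbox l u) (\<lambda>(x, y). D x y)"
    unfolding D_def case_prod_beta
    by (intro continuous_intros bounded_linear.continuous_on[OF bounded_linear_blinfun_inner_left]
        continuous_on_compose2[OF f(1)] continuous_on_compose2[OF cg]) auto
  have cD1: "continuous_on (cbox l u) (D x)" for x
    unfolding D_def
    by (intro continuous_intros bounded_linear.continuous_on[OF bounded_linear_blinfun_inner_left]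
        continuous_on_compose2[OF f(1)] continuous_on_compose2[OF cg]) auto
  have deriv: "((\<lambda>x. integral (cbox l u) (\<lambda>y. f y * \<rho> (x - y))) has_derivative blinfun_apply (integral (cbox l u) (D x))) (at x within UNIV)"
  proof (rule leibniz_rule)
    fix x y
    have d: "\<rho> differentiable (at (x - y))" using \<rho> by (simp add: differentiable_on_eq_differentiable_at)
    have "(\<rho> \<circ> (\<lambda>x. x - y) has_derivative (\<lambda>h. grad \<rho> (x - y) \<bullet> h) \<circ> (\<lambda>h. h)) (at x)"
      by (rule diff_chain_at) (auto intro!: derivative_eq_intros has_derivative_grad[OF d])
    then have "((\<lambda>x. f y * \<rho> (x - y)) has_derivative (\<lambda>h. f y * (grad \<rho> (x - y) \<bullet> h))) (at x)"
      by (intro has_derivative_mult_right) (simp add: comp_def)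
    then show "((\<lambda>x. f y * \<rho> (x - y)) has_derivative blinfun_apply (D x y)) (at x within UNIV)"
      by (simp add: D_def inner_commute)
  next
    show "(\<lambda>y. f y * \<rho> (x - y)) integrable_on cbox l u" for x
      by (rule *(2)) (auto intro!: continuous_intros continuous_on_UNIV_reflect f c\<rho> simp: f(3))
  qed (use cD in auto)
  then show "(\<lambda>x. LINT y|lborel. f y * \<rho> (x - y)) differentiable (at x)"
    unfolding eq by (auto simp: differentiable_def)
  show "partial b (\<lambda>x. LINT y|lborel. f y * \<rho> (x - y)) x = (LINT y|lborel. f y * partial b \<rho> (x - y))" if b: "b \<in> Basis"
  proof -
    have "partial b (\<lambda>x. LINT y|lborel. f y * \<rho> (x - y)) x = blinfun_apply (integral (cbox l u) (D x)) b"
      unfolding eq by (rule partial_eq_derivative) (use deriv in simp)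
    also have "\<dots> = integral (cbox l u) (\<lambda>y. blinfun_apply (D x y) b)"
      by (rule blinfun_apply_integral) (rule integrable_continuous[OF cD1])
    also have "\<dots> = integral (cbox l u) (\<lambda>y. f y * partial b \<rho> (x - y))"
      using b by (simp add: D_def inner_commute[of b])
    also have "\<dots> = (LINT y|lborel. f y * partial b \<rho> (x - y))"
      by (rule *(1)) (auto intro!: continuous_intros continuous_on_UNIV_reflect f cp b simp: f(3))
    finally show ?thesis .
  qed
qed

lemma convolution_smooth:
  fixes f \<rho> :: "'a::euclidean_space \<Rightarrow> real"
  assumes f: "continuous_on UNIV f" "compact K" "\<And>x. x \<notin> K \<Longrightarrow> f x = 0"
    and \<rho>: "\<And>n. C_diff n UNIV \<rho>"
  shows "C_diff n UNIV (\<lambda>x. LINT y|lborel. f y * \<rho> (x - y))"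
  using \<rho>
proof (induction n arbitrary: \<rho>)
  case 0
  have "continuous_on UNIV (\<lambda>x. LINT y|lborel. f y * \<rho> (x - y))"
    by (intro differentiable_imp_continuous_on differentiable_at_imp_differentiable_on
        convolution_has_derivative(1)[OF f 0[of 1]])
  then show ?case by simp
next
  case (Suc n)
  have "partial b (\<lambda>x. LINT y|lborel. f y * \<rho> (x - y)) = (\<lambda>x. LINT y|lborel. f y * partial b \<rho> (x - y))"
    if "b \<in> Basis" for b
    by (rule ext) (rule convolution_has_derivative(2)[OF f Suc.prems[of 1] that])
  moreover have "C_diff n UNIV (\<lambda>x. LINT y|lborel. f y * partial b \<rho> (x - y))" if "b \<in> Basis" for b
  proof (rule Suc.IH)
    show "C_diff m UNIV (partial b \<rho>)" for m using Suc.prems[of "Suc m"] that by simp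
  qed
  moreover have "(\<lambda>x. LINT y|lborel. f y * \<rho> (x - y)) differentiable_on UNIV"
    by (intro differentiable_at_imp_differentiable_on convolution_has_derivative(1)[OF f Suc.prems[of 1]])
  ultimately show ?case by simp
qed

lemma bump_reflect: "bump 0 r (x - y) = bump x r y"
  by (simp add: bump_def norm_minus_commute)

lemma bump_zero: "r > 0 \<Longrightarrow> x \<notin> cball p r \<Longrightarrow> bump p r x = 0"
  using bump_pos_iff[of r p x] bump_nonneg[of p r x] by (auto simp: less_le)

lemma bump_continuous: "continuous_on U (bump p r)"
  using C_diff_continuous_on[OF bump_smooth[of 0]] continuous_on_subset by blast

lemma bump_integrable: "r > 0 \<Longrightarrow> integrable lborel (bump p r)"
  using bump_zero by (intro integrable_compact_support_lborel[of "cball p r"] bump_continuous) auto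

lemma bump_integral_translate: "(LINT y|lborel. bump (p::'a) r y) = (LINT y|lborel. bump (0::'a::euclidean_space) r y)"
proof -
  have "(LINT y|lborel. bump (0::'a) r y) = (LINT y|distr lborel borel ((+) (- p)). bump 0 r y)"
    unfolding lborel_distr_plus ..
  also have "\<dots> = (LINT y|lborel. bump 0 r (- p + y))"
    by (rule integral_distr) (auto intro: borel_measurable_continuous_onI bump_continuous)
  also have "\<dots> = (LINT y|lborel. bump p r y)"
    by (simp add: bump_def)
  finally show ?thesis by simp
qed

lemma bump_integral_pos:
  assumes "r > 0" 
  shows "(LINT y|lborel. bump p r y) > 0"
proof (rule ccontr)
  assume "\<not> ?thesis"
  moreover have "(LINT y|lborel. bump p r y) \<ge> 0" by (simp add: bump_nonneg)
  ultimately have "(LINT y|lborel. bump p r y) = 0" by linarith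
  then have "AE y in lborel. bump p r y = 0"
    using integral_nonneg_eq_0_iff_AE[OF bump_integrable[OF assms, of p]] by (simp add: bump_nonneg)
  then have "AE y in lborel. y \<notin> ball p r"
  proof eventually_elim
    case (elim y)
    then show ?case using bump_pos_iff[OF assms, of p y] by simp
  qed
  then have "emeasure lborel (ball p r) = 0"
    using AE_iff_measurable[of "ball p r" lborel "\<lambda>y. y \<notin> ball p r"] by (simp del: mem_ball)
  then show False using open_not_negligible[of "ball p r"] assms
    by (simp add: negligible_iff_emeasure0)
qed

text \<open>Averaging against a bump of radius \<open>\<delta>\<close> changes a function by at most its oscillation at scale \<open>\<delta>\<close>.\<close>

lemma mollified_close:
  fixes g :: "'a::euclidean_space \<Rightarrow> real"
  assumes "continuous_on UNIV g" "\<delta> > 0" "\<And>x y. dist x y \<le> \<delta> \<Longrightarrow> \<bar>g x - g y\<bar> \<le> \<epsilon>"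
  defines "c \<equiv> (LINT y|lborel. bump (0::'a) \<delta> y)"
  shows "\<bar>(LINT y|lborel. g y * (bump x \<delta> y / c)) - g x\<bar> \<le> \<epsilon>"
proof -
  have c: "c > 0" "(LINT y|lborel. bump x \<delta> y) = c"
    unfolding c_def by (rule bump_integral_pos[OF assms(2)]) (rule bump_integral_translate)
  have bi: "integrable lborel (bump x \<delta>)" by (rule bump_integrable[OF assms(2)])
  have "continuous_on UNIV (\<lambda>y. g y * bump x \<delta> y)"
    by (intro continuous_on_mult assms(1) bump_continuous)
  then have i: "integrable lborel (\<lambda>y. g y * bump x \<delta> y)"
    using bump_zero[OF assms(2)]
    by (intro integrable_compact_support_lborel[of "cball x \<delta>"]) (auto intro: continuous_on_subset)
  have i': "integrable lborel (\<lambda>y. g x * bump x \<delta> y)" by (rule integrable_mult_right[OF bi])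
  have j: "integrable lborel (\<lambda>y. (g y - g x) * bump x \<delta> y)"
    unfolding left_diff_distrib by (rule Bochner_Integration.integrable_diff[OF i i'])
  have "(LINT y|lborel. (g y - g x) * bump x \<delta> y) = (LINT y|lborel. g y * bump x \<delta> y) - (LINT y|lborel. g x * bump x \<delta> y)"
    unfolding left_diff_distrib by (rule Bochner_Integration.integral_diff[OF i i'])
  also have "(LINT y|lborel. g x * bump x \<delta> y) = g x * c"
    unfolding integral_mult_right_zero c(2) ..
  finally have "\<bar>(LINT y|lborel. g y * bump x \<delta> y) - g x * c\<bar> = \<bar>LINT y|lborel. (g y - g x) * bump x \<delta> y\<bar>"
    by simp
  also have "\<dots> \<le> (LINT y|lborel. \<bar>(g y - g x) * bump x \<delta> y\<bar>)"
    by (rule integral_abs_bound)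
  also have "\<dots> \<le> (LINT y|lborel. \<epsilon> * bump x \<delta> y)"
  proof (rule Bochner_Integration.integral_mono[OF integrable_abs[OF j] integrable_mult_right[OF bi]])
    fix y
    show "\<bar>(g y - g x) * bump x \<delta> y\<bar> \<le> \<epsilon> * bump x \<delta> y"
    proof (cases "dist x y \<le> \<delta>")
      case True
      then have "\<bar>g y - g x\<bar> \<le> \<epsilon>" by (intro assms(3)) (simp add: dist_commute)
      then show ?thesis using bump_nonneg[of x \<delta> y] by (simp add: abs_mult mult_right_mono)
    next
      case False
      then have "bump x \<delta> y = 0" by (intro bump_zero[OF assms(2)]) simp
      then show ?thesis by simp
    qed
  qed
  also have "\<dots> = \<epsilon> * c" unfolding integral_mult_right_zero c(2) ..
  finally have le: "\<bar>(LINT y|lborel. g y * bump x \<delta> y) - g x * c\<bar> \<le> \<epsilon> * c" .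
  have "(LINT y|lborel. g y * (bump x \<delta> y / c)) = (LINT y|lborel. g y * bump x \<delta> y) / c"
    unfolding times_divide_eq_right by (rule integral_divide_zero)
  then have "(LINT y|lborel. g y * (bump x \<delta> y / c)) - g x = ((LINT y|lborel. g y * bump x \<delta> y) - g x * c) / c"
    using c(1) by (metis diff_divide_distrib less_irrefl nonzero_mult_div_cancel_right)
  then show ?thesis
    using le c(1) by (metis abs_divide abs_of_pos pos_divide_le_eq)
qed

text \<open>Integration by parts moves the derivative from the kernel to \<open>f\<close>: the partial derivatives of the mollified
  function are the mollified partial derivatives of \<open>f\<close>. By uniform continuity, averaging on a
  small scale \<open>\<delta>\<close> changes all of them little.\<close>

lemma C1_approx_by_test:
  fixes f :: "'a::euclidean_space \<Rightarrow> real"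
  assumes f: "C_diff 1 UNIV f" and K: "compact K" "K \<subseteq> \<Omega>" and 0: "\<And>x. x \<notin> K \<Longrightarrow> f x = 0"
    and "open \<Omega>" "\<epsilon> > 0"
  obtains \<eta> where "\<eta> \<in> test_functions \<Omega>" "\<And>x. \<bar>f x - \<eta> x\<bar> \<le> \<epsilon>"
    "\<And>x b. b \<in> Basis \<Longrightarrow> \<bar>partial b f x - partial b \<eta> x\<bar> \<le> \<epsilon>"
proof -
  obtain e where e: "e > 0" "(\<Union>x\<in>K. cball x e) \<subseteq> \<Omega>"
    by (rule compact_subset_open_imp_cball_epsilon_subset[OF K(1) \<open>open \<Omega>\<close> K(2)])
  have cf: "continuous_on UNIV f" by (rule C_diff_continuous_on[OF f])
  have cp: "continuous_on UNIV (partial b f)" if "b \<in> Basis" for b using f that by simp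
  have p0: "partial b f x = 0" if "x \<notin> K" for b x
    by (rule partial_zero_outside[OF compact_imp_closed[OF K(1)] 0 that])
  have "\<forall>\<^sub>F \<delta> in at_right 0. \<forall>b\<in>Basis. \<forall>x y. dist x y \<le> \<delta> \<longrightarrow> \<bar>partial b f x - partial b f y\<bar> \<le> \<epsilon>"
    by (intro eventually_ball_finite finite_Basis ballI eventually_modulus[OF K(1) cp p0] assms)
  moreover have "\<forall>\<^sub>F \<delta> in at_right 0. \<forall>x y. dist x y \<le> \<delta> \<longrightarrow> \<bar>f x - f y\<bar> \<le> \<epsilon>"
    by (intro eventually_modulus[OF K(1) cf 0] assms)
  moreover have "\<forall>\<^sub>F \<delta> in at_right (0::real). \<delta> \<in> {0<..<e}"
    by (rule eventually_at_right_real[OF e(1)])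
  ultimately have "\<exists>\<delta>. (\<forall>b\<in>Basis. \<forall>x y. dist x y \<le> \<delta> \<longrightarrow> \<bar>partial b f x - partial b f y\<bar> \<le> \<epsilon>)
      \<and> (\<forall>x y. dist x y \<le> \<delta> \<longrightarrow> \<bar>f x - f y\<bar> \<le> \<epsilon>) \<and> \<delta> \<in> {0<..<e}"
    by (intro eventually_happens'[OF trivial_limit_at_right_real] eventually_conj)
  then obtain \<delta> where \<delta>': "\<forall>b\<in>Basis. \<forall>x y. dist x y \<le> \<delta> \<longrightarrow> \<bar>partial b f x - partial b f y\<bar> \<le> \<epsilon>"
      "\<forall>x y. dist x y \<le> \<delta> \<longrightarrow> \<bar>f x - f y\<bar> \<le> \<epsilon>" "\<delta> \<in> {0<..<e}"
    by (elim exE conjE)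
  have \<delta>: "\<And>b x y. b \<in> Basis \<Longrightarrow> dist x y \<le> \<delta> \<Longrightarrow> \<bar>partial b f x - partial b f y\<bar> \<le> \<epsilon>"
      "\<And>x y. dist x y \<le> \<delta> \<Longrightarrow> \<bar>f x - f y\<bar> \<le> \<epsilon>" "0 < \<delta>" "\<delta> < e"
    using \<delta>' by simp_all
  define c where "c = (LINT y|lborel. bump (0::'a) \<delta> y)"
  define k where "k z = bump 0 \<delta> z / c" for z :: 'a
  have k_reflect: "k (x - y) = bump x \<delta> y / c" for x y by (simp add: k_def bump_reflect)
  have k_smooth: "C_diff n UNIV k" for n
    using C_diff_mult[OF open_UNIV bump_smooth[of n 0 \<delta>] C_diff_const[of n UNIV "1 / c"]]
    by (simp add: k_def[abs_def])
  define \<eta> where "\<eta> x = (LINT y|lborel. f y * k (x - y))" for x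
  define D where "D = (\<Union>x\<in>K. \<Union>y\<in>cball 0 \<delta>. {x + y})"
  have D: "compact D" unfolding D_def by (rule compact_sums'[OF K(1) compact_cball])
  have D\<Omega>: "D \<subseteq> \<Omega>"
  proof
    fix z assume "z \<in> D"
    then obtain x y where "x \<in> K" "norm y \<le> \<delta>" "z = x + y" by (auto simp: D_def)
    then have "z \<in> cball x e" using \<delta>(4) by (simp add: dist_norm)
    then show "z \<in> \<Omega>" using e(2) \<open>x \<in> K\<close> by blast
  qed
  have out: "\<eta> x = 0" if "x \<notin> D" for x
  proof -
    have "f y * k (x - y) = 0" for y
    proof (cases "y \<in> K")
      case True
      have "x - y \<notin> cball 0 \<delta>"
      proof
        assume "x - y \<in> cball 0 \<delta>"
        then have "x \<in> D" unfolding D_def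
          by (intro UN_I[OF True] UN_I[of "x - y"]) auto
        then show False using that by simp
      qed
      then show ?thesis using bump_zero[OF \<delta>(3), of "x - y" 0] by (simp add: k_def)
    qed (simp add: 0)
    then have "(\<lambda>y. f y * k (x - y)) = (\<lambda>y. 0)" by (rule ext)
    then show ?thesis by (simp add: \<eta>_def)
  qed
  have \<eta>: "\<eta> \<in> test_functions \<Omega>"
  proof -
    have "C_diff n UNIV \<eta>" for n
      unfolding \<eta>_def[abs_def] by (rule convolution_smooth[OF cf K(1) 0 k_smooth])
    moreover have "\<exists>K. compact K \<and> K \<subseteq> \<Omega> \<and> (\<forall>x. x \<notin> K \<longrightarrow> \<eta> x = 0)"
      by (rule exI[of _ D]) (simp add: D D\<Omega> out)
    ultimately show ?thesis unfolding test_functions_def by blast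
  qed
  moreover have "\<bar>f x - \<eta> x\<bar> \<le> \<epsilon>" for x
    using mollified_close[OF cf \<delta>(3,2), where x=x]
    by (simp add: \<eta>_def k_reflect c_def abs_minus_commute)
  moreover have "\<bar>partial b f x - partial b \<eta> x\<bar> \<le> \<epsilon>" if b: "b \<in> Basis" for x b
  proof -
    have kd: "k differentiable (at z)" for z
      using C_diff_differentiable_at[OF k_smooth[of "Suc 0"] open_UNIV] by simp
    have kr: "((\<lambda>y. k (x - y)) has_derivative (\<lambda>h. grad k (x - y) \<bullet> (- h))) (at y)" for y
    proof -
      have "(k \<circ> (\<lambda>y. x - y) has_derivative (\<lambda>h. grad k (x - y) \<bullet> h) \<circ> (\<lambda>h. - h)) (at y)"
        by (rule diff_chain_at) (auto intro!: derivative_eq_intros has_derivative_grad[OF kd])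
      then show ?thesis by (simp add: comp_def)
    qed
    have kC: "C_diff 1 UNIV (\<lambda>y. k (x - y))"
      using C_diff_mult[OF open_UNIV bump_smooth[of 1 x \<delta>] C_diff_const[of 1 UNIV "1 / c"]]
      by (simp add: k_reflect)
    have C1: "C_diff 1 UNIV (\<lambda>y. f y * k (x - y))" by (rule C_diff_mult[OF open_UNIV f kC])
    have fd: "f differentiable (at y)" for y using f by (simp add: differentiable_on_eq_differentiable_at)
    have krd: "(\<lambda>y. k (x - y)) differentiable (at y)" for y using kr by (auto simp: differentiable_def)
    have pr: "partial b (\<lambda>y. f y * k (x - y)) y = partial b f y * k (x - y) - f y * partial b k (x - y)" for y
      using partial_mult[OF fd krd, of b y] partial_eq_derivative[OF kr, of b y] b by simp
    have ck: "continuous_on UNIV k" "continuous_on UNIV (partial b k)"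
      using k_smooth[of 1] b C_diff_continuous_on[OF k_smooth[of 1]] by auto
    have "continuous_on UNIV (\<lambda>y. partial b f y * k (x - y))"
      by (intro continuous_on_mult cp b continuous_on_UNIV_reflect ck)
    then have i1: "integrable lborel (\<lambda>y. partial b f y * k (x - y))"
      by (intro integrable_compact_support_lborel[OF K(1)]) (auto intro: continuous_on_subset simp: p0)
    have "continuous_on UNIV (\<lambda>y. f y * partial b k (x - y))"
      by (intro continuous_on_mult cf continuous_on_UNIV_reflect ck)
    then have i2: "integrable lborel (\<lambda>y. f y * partial b k (x - y))"
      by (intro integrable_compact_support_lborel[OF K(1)]) (auto intro: continuous_on_subset simp: 0)
    have "0 = (LINT y|lborel. partial b (\<lambda>y. f y * k (x - y)) y)"
      using integral_partial_eq_0_lborel[OF C1 K(1) _ b] 0 by simp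
    also have "\<dots> = (LINT y|lborel. partial b f y * k (x - y)) - (LINT y|lborel. f y * partial b k (x - y))"
      unfolding pr by (rule Bochner_Integration.integral_diff[OF i1 i2])
    also have "(LINT y|lborel. f y * partial b k (x - y)) = partial b \<eta> x"
      unfolding \<eta>_def[abs_def] by (rule convolution_has_derivative(2)[OF cf K(1) 0 k_smooth b, symmetric])
    finally have "partial b \<eta> x = (LINT y|lborel. partial b f y * (bump x \<delta> y / c))"
      by (simp add: k_reflect)
    then show ?thesis
      using mollified_close[OF cp[OF b] \<delta>(3) \<delta>(1)[OF b], where x=x]
      by (simp add: c_def abs_minus_commute)
  qed
  ultimately show ?thesis by (rule that)
qed

section \<open>The Gagliardo--Nirenberg inequality in the plane\<close>

abbreviation e1 :: "real^2" where "e1 \<equiv> axis 1 1"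
abbreviation e2 :: "real^2" where "e2 \<equiv> axis 2 1"

definition plane_point :: "real \<times> real \<Rightarrow> real^2" where
  "plane_point p = fst p *\<^sub>R e1 + snd p *\<^sub>R e2"

lemma Basis_plane: "Basis = {e1, e2}"
  by (auto simp: Basis_vec_def UNIV_2)

lemma e1_neq_e2: "e1 \<noteq> e2"
  by (simp add: axis_eq_axis)

lemma plane_point_inner [simp]: "plane_point p \<bullet> e1 = fst p" "plane_point p \<bullet> e2 = snd p"
  by (simp_all add: plane_point_def inner_add_left inner_axis_axis)

lemma plane_point_measurable [measurable]: "plane_point \<in> borel_measurable borel"
  unfolding plane_point_def[abs_def] by (intro borel_measurable_continuous_onI continuous_intros)

text \<open>The isometry between \<open>real \<times> real\<close> and \<open>real^2\<close> preserves volume, which makes Fubini's theorem available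
  on \<open>real^2\<close>.\<close>

lemma lborel_plane: "distr lborel borel plane_point = lborel"
proof (rule lborel_eqI[symmetric])
  fix l u :: "real^2" assume le: "\<And>b. b \<in> Basis \<Longrightarrow> l \<bullet> b \<le> u \<bullet> b"
  have "plane_point -` box l u = box (l \<bullet> e1, l \<bullet> e2) (u \<bullet> e1, u \<bullet> e2)"
    by (auto simp: box_def Basis_plane Basis_prod_def)
  then have "emeasure (distr lborel borel plane_point) (box l u)
      = emeasure lborel (box (l \<bullet> e1, l \<bullet> e2) (u \<bullet> e1, u \<bullet> e2))"
    by (subst emeasure_distr) auto
  also have "\<dots> = ennreal ((u \<bullet> e1 - l \<bullet> e1) * (u \<bullet> e2 - l \<bullet> e2))"
    using le by (subst emeasure_lborel_box) (auto simp: Basis_prod_def Basis_plane)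
  also have "(u \<bullet> e1 - l \<bullet> e1) * (u \<bullet> e2 - l \<bullet> e2) = (\<Prod>b\<in>Basis. (u - l) \<bullet> b)"
    by (simp add: Basis_plane e1_neq_e2 inner_diff_left)
  finally show "emeasure (distr lborel borel plane_point) (box l u) = ennreal (\<Prod>b\<in>Basis. (u - l) \<bullet> b)" .
qed simp

lemma nn_integral_plane:
  assumes [measurable]: "f \<in> borel_measurable borel"
  shows "(\<integral>\<^sup>+z. f z \<partial>(lborel :: (real^2) measure)) = (\<integral>\<^sup>+x. \<integral>\<^sup>+y. f (plane_point (x, y)) \<partial>lborel \<partial>lborel)"
    and "(\<integral>\<^sup>+z. f z \<partial>(lborel :: (real^2) measure)) = (\<integral>\<^sup>+y. \<integral>\<^sup>+x. f (plane_point (x, y)) \<partial>lborel \<partial>lborel)"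
proof -
  have "(\<integral>\<^sup>+z. f z \<partial>(lborel :: (real^2) measure)) = (\<integral>\<^sup>+p. f (plane_point p) \<partial>lborel)"
    by (subst lborel_plane[symmetric]) (rule nn_integral_distr; simp)
  then have eq: "(\<integral>\<^sup>+z. f z \<partial>(lborel :: (real^2) measure)) = (\<integral>\<^sup>+p. f (plane_point p) \<partial>(lborel \<Otimes>\<^sub>M lborel))"
    by (simp add: lborel_prod)
  have m: "(\<lambda>p. f (plane_point p)) \<in> borel_measurable (lborel \<Otimes>\<^sub>M lborel)"
    by (simp add: lborel_prod)
  show 1: "(\<integral>\<^sup>+z. f z \<partial>(lborel :: (real^2) measure)) = (\<integral>\<^sup>+x. \<integral>\<^sup>+y. f (plane_point (x, y)) \<partial>lborel \<partial>lborel)"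
    unfolding eq by (rule lborel.nn_integral_fst[OF m, symmetric])
  show "(\<integral>\<^sup>+z. f z \<partial>(lborel :: (real^2) measure)) = (\<integral>\<^sup>+y. \<integral>\<^sup>+x. f (plane_point (x, y)) \<partial>lborel \<partial>lborel)"
    unfolding 1 by (rule lborel_pair.Fubini'[symmetric]) (use m in \<open>simp add: case_prod_beta'\<close>)
qed

text \<open>A function that vanishes somewhere is bounded by its total variation.\<close>

lemma abs_le_nn_integral_deriv:
  fixes g :: "real \<Rightarrow> real"
  assumes deriv: "\<And>s. (g has_real_derivative g' s) (at s)" and cont: "continuous_on UNIV g'"
    and a: "a \<le> x" "g a = 0"
  shows "ennreal \<bar>g x\<bar> \<le> (\<integral>\<^sup>+s. ennreal \<bar>g' s\<bar> \<partial>lborel)"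
proof -
  have c: "isCont g' s" for s using cont by (simp add: continuous_on_eq_continuous_at)
  have i: "integrable lborel (\<lambda>s. g' s * indicator {a..x} s)"
    by (rule borel_integrable_atLeastAtMost) (rule c)
  have "(LINT s|lborel. g' s * indicator {a..x} s) = g x - g a"
    by (rule integral_FTC_Icc_real[OF a(1)]) (use deriv c in auto)
  then have "ennreal \<bar>g x\<bar> = ennreal (norm (LINT s|lborel. g' s * indicator {a..x} s))"
    using a(2) by simp
  also have "\<dots> \<le> (\<integral>\<^sup>+s. norm (g' s * indicator {a..x} s) \<partial>lborel)"
    by (rule integral_norm_bound_ennreal[OF i])
  also have "\<dots> \<le> (\<integral>\<^sup>+s. ennreal \<bar>g' s\<bar> \<partial>lborel)"
    by (intro nn_integral_mono) (auto simp: indicator_def)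
  finally show ?thesis .
qed

text \<open>The value \<open>|f(x,y)|\<close> is at most the integral of \<open>|\<partial>\<^sub>1f|\<close> over the horizontal line through \<open>(x,y)\<close>, which depends
  on \<open>y\<close> only, and at most the integral of \<open>|\<partial>\<^sub>2f|\<close> over the vertical line, which depends on \<open>x\<close> only. The
  product of these two bounds integrates to the product of the integrals.\<close>

lemma nn_integral_power2_le_partials:
  fixes f :: "real^2 \<Rightarrow> real"
  assumes C1: "C_diff 1 UNIV f" and K: "compact K" and 0: "\<And>x. x \<notin> K \<Longrightarrow> f x = 0"
  shows "(\<integral>\<^sup>+z. ennreal ((f z)\<^sup>2) \<partial>lborel)
    \<le> (\<integral>\<^sup>+z. ennreal \<bar>partial e1 f z\<bar> \<partial>lborel) * (\<integral>\<^sup>+z. ennreal \<bar>partial e2 f z\<bar> \<partial>lborel)"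
proof -
  obtain r where r: "r > 0" "K \<subseteq> cball 0 r"
    by (metis K bounded_pos compact_imp_bounded mem_cball_0 subsetI)
  have fd: "f differentiable (at z)" for z using C1 by (simp add: differentiable_on_eq_differentiable_at)
  have cp: "continuous_on UNIV (partial e1 f)" "continuous_on UNIV (partial e2 f)"
    using C1 by (auto simp: Basis_plane)
  have cf: "continuous_on UNIV f" by (rule C_diff_continuous_on[OF C1])
  have [measurable]: "f \<in> borel_measurable borel" "partial e1 f \<in> borel_measurable borel" "partial e2 f \<in> borel_measurable borel"
    using cf cp by (auto intro: borel_measurable_continuous_onI)
  have cpl: "continuous_on UNIV (\<lambda>s. plane_point (s, y))" "continuous_on UNIV (\<lambda>s. plane_point (y, s))" for y
    unfolding plane_point_def by (auto intro!: continuous_intros)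
  have cpp [measurable]: "plane_point \<in> borel_measurable (lborel \<Otimes>\<^sub>M lborel)"
    by (simp add: lborel_prod)
  have out: "f z = 0" if "\<bar>z \<bullet> b\<bar> > r" "b \<in> Basis" for z b
  proof -
    have "norm z > r" using Basis_le_norm[OF that(2), of z] that(1) by linarith
    then show ?thesis using r(2) by (intro 0) auto
  qed
  define A where "A y = (\<integral>\<^sup>+s. ennreal \<bar>partial e1 f (plane_point (s, y))\<bar> \<partial>lborel)" for y
  define B where "B x = (\<integral>\<^sup>+t. ennreal \<bar>partial e2 f (plane_point (x, t))\<bar> \<partial>lborel)" for x
  have [measurable]: "B \<in> borel_measurable lborel"
    unfolding B_def[abs_def] by measurable
  have [measurable]: "A \<in> borel_measurable lborel"
  proof -
    have "(\<lambda>p. plane_point (snd p, fst p)) \<in> borel_measurable (lborel \<Otimes>\<^sub>M lborel)"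
      unfolding plane_point_def by measurable
    then have "(\<lambda>(y, s). ennreal \<bar>partial e1 f (plane_point (s, y))\<bar>) \<in> borel_measurable (lborel \<Otimes>\<^sub>M lborel)"
      unfolding case_prod_beta' by measurable
    then show ?thesis
      unfolding A_def[abs_def] by (rule lborel.borel_measurable_nn_integral)
  qed
  have fA: "ennreal \<bar>f (plane_point (x, y))\<bar> \<le> A y" for x y
    unfolding A_def
  proof (rule abs_le_nn_integral_deriv[where g="\<lambda>s. f (plane_point (s, y))" and x=x and a="min x (- r - 1)"])
    show "((\<lambda>s. f (plane_point (s, y))) has_real_derivative partial e1 f (plane_point (s, y))) (at s)" for s
      using has_real_derivative_along_line[where f=f and x="y *\<^sub>R e2" and s=s and b=e1, OF fd] by (simp add: plane_point_def add.commute)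
    show "continuous_on UNIV (\<lambda>s. partial e1 f (plane_point (s, y)))"
      by (rule continuous_on_compose2[OF cp(1) cpl(1)]) simp
    show "f (plane_point (min x (- r - 1), y)) = 0"
      by (rule out[of _ e1]) (use r in \<open>auto simp: Basis_plane min_def\<close>)
  qed simp
  have fB: "ennreal \<bar>f (plane_point (x, y))\<bar> \<le> B x" for x y
    unfolding B_def
  proof (rule abs_le_nn_integral_deriv[where g="\<lambda>s. f (plane_point (x, s))" and x=y and a="min y (- r - 1)"])
    show "((\<lambda>s. f (plane_point (x, s))) has_real_derivative partial e2 f (plane_point (x, s))) (at s)" for s
      using has_real_derivative_along_line[where f=f and x="x *\<^sub>R e1" and s=s and b=e2, OF fd] by (simp add: plane_point_def)
    show "continuous_on UNIV (\<lambda>s. partial e2 f (plane_point (x, s)))"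
      by (rule continuous_on_compose2[OF cp(2) cpl(2)]) simp
    show "f (plane_point (x, min y (- r - 1))) = 0"
      by (rule out[of _ e2]) (use r in \<open>auto simp: Basis_plane min_def\<close>)
  qed simp
  have "(\<integral>\<^sup>+z. ennreal ((f z)\<^sup>2) \<partial>lborel) = (\<integral>\<^sup>+x. \<integral>\<^sup>+y. ennreal ((f (plane_point (x, y)))\<^sup>2) \<partial>lborel \<partial>lborel)"
    by (rule nn_integral_plane) measurable
  also have "\<dots> \<le> (\<integral>\<^sup>+x. \<integral>\<^sup>+y. B x * A y \<partial>lborel \<partial>lborel)"
  proof (intro nn_integral_mono)
    fix x y
    have "ennreal ((f (plane_point (x, y)))\<^sup>2) = ennreal \<bar>f (plane_point (x, y))\<bar> * ennreal \<bar>f (plane_point (x, y))\<bar>"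
      by (simp add: ennreal_mult[symmetric] power2_eq_square abs_mult[symmetric])
    also have "\<dots> \<le> B x * A y" by (intro mult_mono fA fB) auto
    finally show "ennreal ((f (plane_point (x, y)))\<^sup>2) \<le> B x * A y" .
  qed
  also have "\<dots> = (\<integral>\<^sup>+x. B x \<partial>lborel) * (\<integral>\<^sup>+y. A y \<partial>lborel)"
    by (simp add: nn_integral_cmult nn_integral_multc)
  also have "(\<integral>\<^sup>+y. A y \<partial>lborel) = (\<integral>\<^sup>+z. ennreal \<bar>partial e1 f z\<bar> \<partial>lborel)"
    unfolding A_def by (rule nn_integral_plane(2)[symmetric]) measurable
  also have "(\<integral>\<^sup>+x. B x \<partial>lborel) = (\<integral>\<^sup>+z. ennreal \<bar>partial e2 f z\<bar> \<partial>lborel)"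
    unfolding B_def by (rule nn_integral_plane(1)[symmetric]) measurable
  finally show ?thesis by (simp add: mult.commute)
qed

lemma gagliardo_nirenberg:
  fixes f :: "real^2 \<Rightarrow> real"
  assumes "open \<Omega>" "C_diff 1 \<Omega> f" "compact K" "K \<subseteq> \<Omega>" "\<And>x. x \<in> \<Omega> - K \<Longrightarrow> f x = 0"
  shows "(LINT x|lebesgue_on \<Omega>. (f x)\<^sup>2) \<le> (LINT x|lebesgue_on \<Omega>. norm (grad f x))\<^sup>2"
proof -
  let ?f = "\<lambda>x. if x \<in> \<Omega> then f x else 0"
  have C1: "C_diff 1 UNIV ?f"
    by (rule C_diff_zero_extension[OF assms(1-5)])
  have f0: "?f x = 0" if "x \<notin> K" for x using that assms by auto
  have out: "grad ?f x = 0" if "x \<notin> K" for x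
    by (rule grad_zero_outside[OF compact_imp_closed[OF assms(3)] f0 that])
  have cf: "continuous_on UNIV ?f" by (rule C_diff_continuous_on[OF C1])
  have cg: "continuous_on UNIV (grad ?f)" by (rule continuous_on_grad) (use C1 in simp)
  have if2: "integrable lborel (\<lambda>x. (?f x)\<^sup>2)"
    by (rule integrable_compact_support_lborel[OF assms(3) continuous_on_subset[of UNIV]])
       (use cf f0 in \<open>auto intro!: continuous_on_power\<close>)
  have ig: "integrable lborel (\<lambda>x. norm (grad ?f x))"
    by (rule integrable_compact_support_lborel[OF assms(3) continuous_on_subset[of UNIV]])
       (use cg out in \<open>auto intro!: continuous_on_norm\<close>)
  have bound: "(\<integral>\<^sup>+z. ennreal \<bar>partial b ?f z\<bar> \<partial>lborel) \<le> ennreal (LINT x|lborel. norm (grad ?f x))"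
    if "b \<in> Basis" for b
  proof -
    have "(\<integral>\<^sup>+z. ennreal \<bar>partial b ?f z\<bar> \<partial>lborel) \<le> (\<integral>\<^sup>+z. ennreal (norm (grad ?f z)) \<partial>lborel)"
    proof (intro nn_integral_mono ennreal_leI)
      show "\<bar>partial b ?f z\<bar> \<le> norm (grad ?f z)" for z
        using Basis_le_norm[OF that, of "grad ?f z"] that by simp
    qed
    also have "\<dots> = ennreal (LINT x|lborel. norm (grad ?f x))"
      by (rule nn_integral_eq_integral[OF ig]) simp
    finally show ?thesis .
  qed
  have "ennreal (LINT x|lborel. (?f x)\<^sup>2) = (\<integral>\<^sup>+z. ennreal ((?f z)\<^sup>2) \<partial>lborel)"
    by (rule nn_integral_eq_integral[symmetric, OF if2]) simp
  also have "\<dots> \<le> (\<integral>\<^sup>+z. ennreal \<bar>partial e1 ?f z\<bar> \<partial>lborel) * (\<integral>\<^sup>+z. ennreal \<bar>partial e2 ?f z\<bar> \<partial>lborel)"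
    by (rule nn_integral_power2_le_partials[OF C1 assms(3) f0])
  also have "\<dots> \<le> ennreal (LINT x|lborel. norm (grad ?f x)) * ennreal (LINT x|lborel. norm (grad ?f x))"
    by (intro mult_mono bound) (auto simp: Basis_plane)
  also have "\<dots> = ennreal ((LINT x|lborel. norm (grad ?f x))\<^sup>2)"
    by (simp add: ennreal_mult[symmetric] power2_eq_square)
  finally have le: "(LINT x|lborel. (?f x)\<^sup>2) \<le> (LINT x|lborel. norm (grad ?f x))\<^sup>2"
    by (simp add: ennreal_le_iff)
  have leb: "\<Omega> \<in> sets lebesgue" using assms(1) by simp
  have "(LINT x|lebesgue_on \<Omega>. (f x)\<^sup>2) = (LINT x|lebesgue_on \<Omega>. (?f x)\<^sup>2)"
    by (rule Bochner_Integration.integral_cong) auto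
  moreover have "(LINT x|lebesgue_on \<Omega>. (?f x)\<^sup>2) = (LINT x|lborel. (?f x)\<^sup>2)"
    by (rule integral_lebesgue_on_eq_lborel(2)[OF leb if2]) simp
  moreover have "(LINT x|lebesgue_on \<Omega>. norm (grad f x)) = (LINT x|lebesgue_on \<Omega>. norm (grad ?f x))"
    by (rule Bochner_Integration.integral_cong) (use grad_cong[OF assms(1), of _ f ?f] in auto)
  moreover have "(LINT x|lebesgue_on \<Omega>. norm (grad ?f x)) = (LINT x|lborel. norm (grad ?f x))"
    by (rule integral_lebesgue_on_eq_lborel(2)[OF leb ig]) (use out assms(4) in auto)
  ultimately show ?thesis using le by simp
qed

text \<open>The quadratic polynomial \<open>t \<mapsto> \<integral> (p - t q)\<^sup>2\<close> is nonnegative, so its discriminant is not positive.\<close>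

lemma integral_Cauchy_Schwarz:
  fixes p q :: "'a \<Rightarrow> real"
  assumes "integrable M (\<lambda>x. (p x)\<^sup>2)" "integrable M (\<lambda>x. (q x)\<^sup>2)" "integrable M (\<lambda>x. p x * q x)"
  shows "(LINT x|M. p x * q x)\<^sup>2 \<le> (LINT x|M. (p x)\<^sup>2) * (LINT x|M. (q x)\<^sup>2)"
proof -
  define A B C where "A = (LINT x|M. (p x)\<^sup>2)" and "B = (LINT x|M. p x * q x)" and "C = (LINT x|M. (q x)\<^sup>2)"
  have quad: "0 \<le> A - 2 * t * B + t\<^sup>2 * C" for t
  proof -
    have "0 \<le> (LINT x|M. (p x - t * q x)\<^sup>2)" by simp
    also have "\<dots> = (LINT x|M. ((p x)\<^sup>2 - (2 * t) * (p x * q x)) + t\<^sup>2 * (q x)\<^sup>2)"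
      by (simp add: power2_eq_square algebra_simps)
    also have "\<dots> = A - 2 * t * B + t\<^sup>2 * C"
      unfolding A_def B_def C_def using assms
      by (subst Bochner_Integration.integral_add, simp, simp, subst Bochner_Integration.integral_diff) auto
    finally show ?thesis .
  qed
  have C0: "C \<ge> 0" by (simp add: C_def)
  have "B\<^sup>2 \<le> A * C"
  proof (cases "C = 0")
    case True
    have "B = 0"
    proof (rule ccontr)
      assume "B \<noteq> 0"
      then show False using quad[of "(A + 1) / (2 * B)"] True by simp
    qed
    then show ?thesis using True by simp
  next
    case False
    then have "0 \<le> C * (A - 2 * (B / C) * B + (B / C)\<^sup>2 * C)"
      using quad[of "B / C"] C0 by (intro mult_nonneg_nonneg)
    also have "\<dots> = A * C - B\<^sup>2" using False by (simp add: field_simps power2_eq_square)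
    finally show ?thesis by simp
  qed
  then show ?thesis by (simp add: A_def B_def C_def)
qed

section \<open>Hardy's inequality and weighted moments\<close>

lemma C_diff_inverse:
  assumes "open U" "C_diff k U f" "\<And>x. x \<in> U \<Longrightarrow> f x > 0"
  shows "C_diff k U (\<lambda>x. inverse (f x))"
proof (rule C_diff_compose[OF assms(1,2), where h="\<lambda>t. inverse t" and T="{0<..}"])
  let ?H = "{\<lambda>t. c * inverse t ^ m | c m. True} :: (real \<Rightarrow> real) set"
  show "(\<lambda>t. inverse t) \<in> ?H" by (rule CollectI, rule exI[of _ 1], rule exI[of _ 1]) simp
  fix h assume "h \<in> ?H"
  then obtain c m where h: "h = (\<lambda>t. c * inverse t ^ m)" by auto
  have "(h has_real_derivative (- real m * c) * inverse t ^ Suc m) (at t)" if "t \<in> {0<..}" for t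
  proof (cases m)
    case (Suc n)
    have "((\<lambda>t. c * inverse t ^ Suc n) has_real_derivative
        c * ((1 + real n) * (- (inverse t ^ Suc (Suc 0)) * inverse t ^ n))) (at t)"
      using that by (intro DERIV_cmult DERIV_power_Suc DERIV_inverse) auto
    then show ?thesis unfolding h Suc by (simp add: algebra_simps)
  qed (auto simp: h)
  then show "\<exists>h'\<in>?H. \<forall>t\<in>{0<..}. (h has_real_derivative h' t) (at t)"
    by (intro bexI[of _ "\<lambda>t. (- real m * c) * inverse t ^ Suc m"] ballI CollectI) blast+
qed (use assms(3) in auto)

lemma C_diff_power:
  assumes "open U" "C_diff k U f"
  shows "C_diff k U (\<lambda>x. f x ^ m)"
  by (induction m) (auto intro: C_diff_const C_diff_mult[OF assms])

lemma partial_inverse: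
  assumes "f differentiable (at x)" "f x \<noteq> 0"
  shows "partial b (\<lambda>x. inverse (f x)) x = - partial b f x / (f x)\<^sup>2"
proof -
  have "((\<lambda>t. inverse t) has_real_derivative - (1 / (f x)\<^sup>2)) (at (f x))"
    using assms(2) by (auto intro!: derivative_eq_intros simp: power2_eq_square field_simps)
  then show ?thesis using partial_chain_real[OF assms(1)] by simp
qed

lemma partial_power_Suc:
  assumes "f differentiable (at x)"
  shows "partial b (\<lambda>x. f x ^ Suc m) x = real (Suc m) * f x ^ m * partial b f x"
proof -
  have "((\<lambda>t. t ^ Suc m) has_real_derivative (1 + real m) * (1 * f x ^ m)) (at (f x))"
    by (rule DERIV_power_Suc[OF DERIV_ident])
  then have "((\<lambda>t. t ^ Suc m) has_real_derivative real (Suc m) * f x ^ m) (at (f x))"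
    by (simp only: mult_1 of_nat_Suc)
  then show ?thesis by (rule partial_chain_real[OF assms])
qed

lemma inner_grad: "grad f x \<bullet> grad g x = (\<Sum>b\<in>Basis. partial b f x * partial b g x)"
  by (subst euclidean_inner) simp

text \<open>An abstract form of the distance to the boundary. The last assumption is where the geometry enters: near
  the boundary the gradient of \<open>d\<close> does not degenerate.\<close>

locale boundary_function =
  fixes \<Omega> :: "'a::euclidean_space set" and d :: "'a \<Rightarrow> real" and D L \<epsilon> :: real
  assumes open_\<Omega>: "open \<Omega>"
    and d_C2: "C_diff 2 \<Omega> d"
    and d_pos: "\<And>x. x \<in> \<Omega> \<Longrightarrow> 0 < d x"
    and grad_le: "\<And>x. x \<in> \<Omega> \<Longrightarrow> norm (grad d x) \<le> D"
    and laplacian_le: "\<And>x. x \<in> \<Omega> \<Longrightarrow> \<bar>laplacian d x\<bar> \<le> L"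
    and \<epsilon>_pos: "0 < \<epsilon>"
    and grad_ge: "\<And>x. x \<in> \<Omega> \<Longrightarrow> d x < \<epsilon> \<Longrightarrow> 1 \<le> norm (grad d x)"
begin

text \<open>The summands come from absorbing, in \<open>hardy_pointwise\<close>, the term with \<open>\<nabla>\<eta>\<close>, the term with \<open>\<Delta>d\<close> and the region
  \<open>d \<ge> \<epsilon>\<close>, in this order.\<close>

definition hardy_const :: real where
  "hardy_const = 2 * (4 * D\<^sup>2 + L\<^sup>2 + 1 / \<epsilon>\<^sup>2)"

lemma hardy_const_pos: "0 < hardy_const"
  using \<epsilon>_pos by (auto simp: hardy_const_def intro!: add_nonneg_pos)

lemma d_C1: "C_diff 1 \<Omega> d" and partial_d_C1: "b \<in> Basis \<Longrightarrow> C_diff 1 \<Omega> (partial b d)"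
  using C_diff_le[OF _ d_C2, of 1] d_C2 by (simp_all add: numeral_2_eq_2)

lemma d_continuous: "continuous_on \<Omega> d"
  by (rule C_diff_continuous_on[OF d_C2])

lemma d_differentiable: "x \<in> \<Omega> \<Longrightarrow> d differentiable (at x)"
  using d_C1 open_\<Omega> by (simp add: differentiable_on_eq_differentiable_at)

lemma partial_d_differentiable: "x \<in> \<Omega> \<Longrightarrow> b \<in> Basis \<Longrightarrow> partial b d differentiable (at x)"
  using partial_d_C1 open_\<Omega> by (simp add: differentiable_on_eq_differentiable_at)

lemma inverse_d_C1: "C_diff 1 \<Omega> (\<lambda>x. inverse (d x))"
  by (rule C_diff_inverse[OF open_\<Omega> d_C1 d_pos])

lemma inverse_d_differentiable: "x \<in> \<Omega> \<Longrightarrow> (\<lambda>x. inverse (d x)) differentiable (at x)"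
  using inverse_d_C1 open_\<Omega> by (simp add: differentiable_on_eq_differentiable_at)

lemma hardy_field_C1:
  assumes "\<eta> \<in> test_functions \<Omega>" "b \<in> Basis"
  shows "C_diff 1 \<Omega> (\<lambda>x. (\<eta> x * \<eta> x) * (partial b d x * inverse (d x)))"
  by (intro C_diff_mult[OF open_\<Omega>] test_functions_C_diff[OF assms(1)] partial_d_C1[OF assms(2)] inverse_d_C1)

lemma partial_hardy_field:
  assumes "\<eta> \<in> test_functions \<Omega>" "b \<in> Basis" "x \<in> \<Omega>"
  shows "partial b (\<lambda>x. (\<eta> x * \<eta> x) * (partial b d x * inverse (d x))) x
    = 2 * \<eta> x / d x * (partial b \<eta> x * partial b d x)
      + (\<eta> x)\<^sup>2 / d x * partial b (partial b d) x - (\<eta> x / d x)\<^sup>2 * (partial b d x * partial b d x)"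
proof -
  note diff = test_functions_differentiable[OF assms(1)] d_differentiable[OF assms(3)]
    partial_d_differentiable[OF assms(3,2)] inverse_d_differentiable[OF assms(3)]
  have 1: "partial b (\<lambda>x. \<eta> x * \<eta> x) x = \<eta> x * partial b \<eta> x + partial b \<eta> x * \<eta> x"
    by (rule partial_mult[OF diff(1,1)])
  have 2: "partial b (\<lambda>x. partial b d x * inverse (d x)) x
      = partial b d x * (- partial b d x / (d x)\<^sup>2) + partial b (partial b d) x * inverse (d x)"
    using partial_mult[OF diff(3,4)] partial_inverse[OF diff(2)] d_pos[OF assms(3)] by simp
  have "partial b (\<lambda>x. (\<eta> x * \<eta> x) * (partial b d x * inverse (d x))) x
      = (\<eta> x * \<eta> x) * partial b (\<lambda>x. partial b d x * inverse (d x)) x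
        + partial b (\<lambda>x. \<eta> x * \<eta> x) x * (partial b d x * inverse (d x))"
    by (rule partial_mult) (use diff in \<open>auto intro!: differentiable_mult\<close>)
  also have "\<dots> = 2 * \<eta> x / d x * (partial b \<eta> x * partial b d x)
      + (\<eta> x)\<^sup>2 / d x * partial b (partial b d) x - (\<eta> x / d x)\<^sup>2 * (partial b d x * partial b d x)"
    unfolding 1 2 using d_pos[OF assms(3)] by (simp add: field_simps power2_eq_square)
  finally show ?thesis .
qed

lemma integrable_test_continuous:
  fixes f :: "'a \<Rightarrow> 'b::euclidean_space"
  assumes "\<eta> \<in> test_functions \<Omega>" "continuous_on \<Omega> f" "\<And>x. x \<in> \<Omega> \<Longrightarrow> \<eta> x = 0 \<Longrightarrow> grad \<eta> x = 0 \<Longrightarrow> f x = 0"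
  shows "integrable (lebesgue_on \<Omega>) f"
proof -
  obtain K where K: "compact K" "K \<subseteq> \<Omega>" "\<And>x. x \<notin> K \<Longrightarrow> \<eta> x = 0"
    using test_functionsE[OF assms(1)] by blast
  show ?thesis
  proof (rule integrable_compact_support[OF open_\<Omega> K(1,2) assms(2)])
    fix x assume "x \<in> \<Omega> - K"
    moreover have "grad \<eta> x = 0"
      by (rule grad_zero_outside[OF compact_imp_closed[OF K(1)] K(3)]) (use \<open>x \<in> \<Omega> - K\<close> in auto)
    ultimately show "f x = 0" using assms(3) K(3) by blast
  qed
qed

text \<open>With \<open>a = \<eta>(x)\<close> and \<open>g = \<nabla>\<eta>(x)\<close>, the first three terms on the right are minus the divergence of
  \<open>\<eta>\<^sup>2 \<nabla>d / d\<close>. Where \<open>d < \<epsilon>\<close>, the term with \<open>|\<nabla>d|\<^sup>2\<close> dominates \<open>(a/d)\<^sup>2\<close>; elsewhere \<open>(a/d)\<^sup>2 \<le> a\<^sup>2/\<epsilon>\<^sup>2\<close>. The two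
  other terms are split into a quarter of \<open>(a/d)\<^sup>2\<close> each and a multiple of the energy density.\<close>

lemma hardy_pointwise:
  assumes "x \<in> \<Omega>"
  shows "(a / d x)\<^sup>2 / 2 \<le> (a / d x)\<^sup>2 * (norm (grad d x))\<^sup>2 - 2 * a / d x * (g \<bullet> grad d x) - a\<^sup>2 / d x * laplacian d x
    + hardy_const / 2 * (a\<^sup>2 + (norm g)\<^sup>2)"
proof -
  define s where "s = a / d x"
  have dx: "d x > 0" by (rule d_pos[OF assms])
  have D0: "0 \<le> D" using grad_le[OF assms] norm_ge_zero[of "grad d x"] by linarith
  have "s\<^sup>2 \<le> s\<^sup>2 * (norm (grad d x))\<^sup>2 + a\<^sup>2 * (1 / \<epsilon>\<^sup>2)"
  proof (cases "d x < \<epsilon>")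
    case True
    then have "1 \<le> (norm (grad d x))\<^sup>2" using grad_ge[OF assms] by (simp add: one_le_power)
    then have "s\<^sup>2 * 1 \<le> s\<^sup>2 * (norm (grad d x))\<^sup>2" by (intro mult_left_mono) auto
    moreover have "0 \<le> a\<^sup>2 * (1 / \<epsilon>\<^sup>2)" by simp
    ultimately show ?thesis by linarith
  next
    case False
    then have "\<epsilon>\<^sup>2 \<le> (d x)\<^sup>2" using \<epsilon>_pos by (intro power_mono) auto
    then have "s\<^sup>2 \<le> a\<^sup>2 * (1 / \<epsilon>\<^sup>2)"
      using \<epsilon>_pos frac_le[of "a\<^sup>2" "a\<^sup>2" "\<epsilon>\<^sup>2" "(d x)\<^sup>2"] by (simp add: s_def power_divide)
    moreover have "0 \<le> s\<^sup>2 * (norm (grad d x))\<^sup>2" by simp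
    ultimately show ?thesis by linarith
  qed
  moreover have "2 * s * (g \<bullet> grad d x) \<le> s\<^sup>2 / 4 + 4 * D\<^sup>2 * (norm g)\<^sup>2"
  proof -
    have "\<bar>g \<bullet> grad d x\<bar> \<le> norm g * D"
      using Cauchy_Schwarz_ineq2[of g "grad d x"] mult_left_mono[OF grad_le[OF assms] norm_ge_zero[of g]] by linarith
    then have "\<bar>s\<bar> * \<bar>g \<bullet> grad d x\<bar> \<le> \<bar>s\<bar> * (norm g * D)" by (rule mult_left_mono) simp
    moreover have "0 \<le> (\<bar>s\<bar> / 2 - 2 * (norm g * D))\<^sup>2" by simp
    then have "2 * (\<bar>s\<bar> * (norm g * D)) \<le> s\<^sup>2 / 4 + 4 * D\<^sup>2 * (norm g)\<^sup>2"
      by (simp add: power2_eq_square algebra_simps)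
    moreover have "s * (g \<bullet> grad d x) \<le> \<bar>s\<bar> * \<bar>g \<bullet> grad d x\<bar>" by (metis abs_ge_self abs_mult)
    ultimately show ?thesis by linarith
  qed
  moreover have "a * s * laplacian d x \<le> s\<^sup>2 / 4 + L\<^sup>2 * a\<^sup>2"
  proof -
    have "\<bar>a * s\<bar> * \<bar>laplacian d x\<bar> \<le> \<bar>a * s\<bar> * L" by (intro mult_left_mono laplacian_le[OF assms]) simp
    moreover have "0 \<le> (\<bar>s\<bar> / 2 - L * \<bar>a\<bar>)\<^sup>2" by simp
    then have "\<bar>a * s\<bar> * L \<le> s\<^sup>2 / 4 + L\<^sup>2 * a\<^sup>2"
      by (simp add: power2_eq_square algebra_simps abs_mult)
    moreover have "a * s * laplacian d x \<le> \<bar>a * s\<bar> * \<bar>laplacian d x\<bar>" by (metis abs_ge_self abs_mult)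
    ultimately show ?thesis by linarith
  qed
  moreover have "4 * D\<^sup>2 * (norm g)\<^sup>2 + L\<^sup>2 * a\<^sup>2 + a\<^sup>2 * (1 / \<epsilon>\<^sup>2) \<le> hardy_const / 2 * (a\<^sup>2 + (norm g)\<^sup>2)"
  proof -
    have "0 \<le> (L\<^sup>2 + 1 / \<epsilon>\<^sup>2) * (norm g)\<^sup>2" "0 \<le> 4 * D\<^sup>2 * a\<^sup>2" by simp_all
    then show ?thesis by (simp add: hardy_const_def algebra_simps)
  qed
  ultimately have "s\<^sup>2 / 2 \<le> s\<^sup>2 * (norm (grad d x))\<^sup>2 - 2 * s * (g \<bullet> grad d x) - a * s * laplacian d x
      + hardy_const / 2 * (a\<^sup>2 + (norm g)\<^sup>2)" by linarith
  moreover have "a * s * laplacian d x = a\<^sup>2 / d x * laplacian d x" "2 * s * (g \<bullet> grad d x) = 2 * a / d x * (g \<bullet> grad d x)"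
    by (simp_all add: s_def power2_eq_square)
  ultimately show ?thesis unfolding s_def[symmetric] by linarith
qed

text \<open>Integrate the pointwise inequality: the divergence of a compactly supported field has integral zero.\<close>

lemma hardy_test:
  assumes \<eta>: "\<eta> \<in> test_functions \<Omega>"
  shows "integrable (lebesgue_on \<Omega>) (\<lambda>x. (\<eta> x / d x)\<^sup>2)"
    and "(LINT x|lebesgue_on \<Omega>. (\<eta> x / d x)\<^sup>2) \<le> hardy_const * energy \<Omega> \<eta> (grad \<eta>)"
proof -
  obtain K where K: "compact K" "K \<subseteq> \<Omega>" "\<And>x. x \<notin> K \<Longrightarrow> \<eta> x = 0"
    using test_functionsE[OF \<eta>] by blast
  have d0: "d x \<noteq> 0" if "x \<in> \<Omega>" for x using d_pos[OF that] by simp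
  show i: "integrable (lebesgue_on \<Omega>) (\<lambda>x. (\<eta> x / d x)\<^sup>2)"
    by (rule integrable_test_continuous[OF \<eta>])
       (auto intro!: continuous_intros test_functions_continuous[OF \<eta>] d_continuous simp: d0)
  define F where "F b = (\<lambda>x. (\<eta> x * \<eta> x) * (partial b d x * inverse (d x)))" for b
  define T where "T x = (\<Sum>b\<in>Basis. partial b (F b) x)" for x
  have iF: "integrable (lebesgue_on \<Omega>) (partial b (F b))" "(LINT x|lebesgue_on \<Omega>. partial b (F b) x) = 0"
    if "b \<in> Basis" for b
    using integral_partial_eq_0[OF open_\<Omega> hardy_field_C1[OF \<eta> that] K(1,2) _ that] K(3)
    by (auto simp: F_def)
  have iT: "integrable (lebesgue_on \<Omega>) T" "(LINT x|lebesgue_on \<Omega>. T x) = 0"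
    unfolding T_def[abs_def] using iF by (auto simp: Bochner_Integration.integral_sum)
  have T: "T x = 2 * \<eta> x / d x * (grad \<eta> x \<bullet> grad d x) + (\<eta> x)\<^sup>2 / d x * laplacian d x
      - (\<eta> x / d x)\<^sup>2 * (norm (grad d x))\<^sup>2" if "x \<in> \<Omega>" for x
    unfolding T_def F_def using partial_hardy_field[OF \<eta> _ that]
    by (simp add: power2_norm_eq_inner inner_grad laplacian_def sum.distrib sum_subtractf sum_distrib_left)
  have ie: "integrable (lebesgue_on \<Omega>) (\<lambda>x. (\<eta> x)\<^sup>2 + (norm (grad \<eta> x))\<^sup>2)"
    using test_square_integrable[OF open_\<Omega> \<eta>] by (auto simp: square_integrable_def)
  have "(LINT x|lebesgue_on \<Omega>. (\<eta> x / d x)\<^sup>2 / 2) \<le>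
     (LINT x|lebesgue_on \<Omega>. hardy_const / 2 * ((\<eta> x)\<^sup>2 + (norm (grad \<eta> x))\<^sup>2) - T x)"
  proof (rule Bochner_Integration.integral_mono)
    fix x assume "x \<in> space (lebesgue_on \<Omega>)"
    then have x: "x \<in> \<Omega>" by simp
    show "(\<eta> x / d x)\<^sup>2 / 2 \<le> hardy_const / 2 * ((\<eta> x)\<^sup>2 + (norm (grad \<eta> x))\<^sup>2) - T x"
      using hardy_pointwise[OF x, of "\<eta> x" "grad \<eta> x"] unfolding T[OF x] by linarith
  qed (use i ie iT in auto)
  also have "\<dots> = hardy_const / 2 * energy \<Omega> \<eta> (grad \<eta>)"
    unfolding energy_def using ie iT by (subst Bochner_Integration.integral_diff) (auto simp del: distrib_left_numeral)
  finally show "(LINT x|lebesgue_on \<Omega>. (\<eta> x / d x)\<^sup>2) \<le> hardy_const * energy \<Omega> \<eta> (grad \<eta>)"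
    by simp
qed

end

lemma energy_nonneg: "0 \<le> energy \<Omega> f G"
  unfolding energy_def by simp

locale planar_boundary_function = boundary_function \<Omega> d D L \<epsilon>
  for \<Omega> :: "(real^2) set" and d D L \<epsilon>
begin

definition moment_const :: real where
  "moment_const = 2 + 2 * D\<^sup>2 * hardy_const + hardy_const"

lemma weighted_power_C1:
  assumes "\<eta> \<in> test_functions \<Omega>"
  shows "C_diff 1 \<Omega> (\<lambda>x. \<eta> x ^ m * inverse (d x))"
  by (intro C_diff_mult[OF open_\<Omega>] C_diff_power[OF open_\<Omega>] test_functions_C_diff[OF assms] inverse_d_C1)

lemma norm_grad_weighted_power_le:
  assumes "\<eta> \<in> test_functions \<Omega>" "x \<in> \<Omega>"
  shows "norm (grad (\<lambda>x. \<eta> x ^ Suc m * inverse (d x)) x)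
    \<le> \<bar>\<eta> x ^ m / d x\<bar> * (real (Suc m) * norm (grad \<eta> x) + D * \<bar>\<eta> x / d x\<bar>)"
proof -
  note diff = test_functions_differentiable[OF assms(1)] d_differentiable[OF assms(2)] inverse_d_differentiable[OF assms(2)]
  have dp: "(\<lambda>x. \<eta> x ^ Suc m) differentiable (at x)" by (intro differentiable_power diff)
  have dx: "d x > 0" by (rule d_pos[OF assms(2)])
  have p: "partial b (\<lambda>x. \<eta> x ^ Suc m * inverse (d x)) x
      = (\<eta> x ^ m / d x) * (real (Suc m) * partial b \<eta> x - \<eta> x / d x * partial b d x)" for b
  proof -
    have "partial b (\<lambda>x. \<eta> x ^ Suc m * inverse (d x)) x
       = \<eta> x ^ Suc m * (- partial b d x / (d x)\<^sup>2) + real (Suc m) * \<eta> x ^ m * partial b \<eta> x * inverse (d x)"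
      using partial_mult[OF dp diff(3), of b] partial_inverse[OF diff(2), of b] partial_power_Suc[OF diff(1), of b m] dx
      by simp
    also have "\<dots> = (\<eta> x ^ m / d x) * (real (Suc m) * partial b \<eta> x - \<eta> x / d x * partial b d x)"
      using dx by (simp add: field_simps power2_eq_square)
    finally show ?thesis .
  qed
  have "grad (\<lambda>x. \<eta> x ^ Suc m * inverse (d x)) x
      = (\<eta> x ^ m / d x) *\<^sub>R (real (Suc m) *\<^sub>R grad \<eta> x - (\<eta> x / d x) *\<^sub>R grad d x)"
    unfolding grad_def p by (simp add: scaleR_sum_right sum_subtractf scaleR_diff_left algebra_simps)
  then have "norm (grad (\<lambda>x. \<eta> x ^ Suc m * inverse (d x)) x)
      = \<bar>\<eta> x ^ m / d x\<bar> * norm (real (Suc m) *\<^sub>R grad \<eta> x - (\<eta> x / d x) *\<^sub>R grad d x)" by simp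
  also have "\<dots> \<le> \<bar>\<eta> x ^ m / d x\<bar> * (real (Suc m) * norm (grad \<eta> x) + D * \<bar>\<eta> x / d x\<bar>)"
  proof (intro mult_left_mono)
    have "norm (real (Suc m) *\<^sub>R grad \<eta> x - (\<eta> x / d x) *\<^sub>R grad d x)
        \<le> norm (real (Suc m) *\<^sub>R grad \<eta> x) + norm ((\<eta> x / d x) *\<^sub>R grad d x)" by (rule norm_triangle_ineq4)
    also have "\<dots> = real (Suc m) * norm (grad \<eta> x) + \<bar>\<eta> x / d x\<bar> * norm (grad d x)" by simp
    also have "\<bar>\<eta> x / d x\<bar> * norm (grad d x) \<le> \<bar>\<eta> x / d x\<bar> * D"
      by (intro mult_left_mono grad_le assms(2)) simp
    finally show "norm (real (Suc m) *\<^sub>R grad \<eta> x - (\<eta> x / d x) *\<^sub>R grad d x)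
        \<le> real (Suc m) * norm (grad \<eta> x) + D * \<bar>\<eta> x / d x\<bar>" by (simp add: mult.commute)
  qed simp
  finally show ?thesis .
qed

text \<open>The gradient of \<open>\<eta>\<^sup>m\<^sup>+\<^sup>1/d\<close> contains the factor \<open>\<eta>\<^sup>m/d\<close>. The Gagliardo--Nirenberg inequality and the Cauchy--Schwarz
  inequality therefore bound its square integral by that of \<open>\<eta>\<^sup>m/d\<close> times the square integral of
  \<open>(m+1)|\<nabla>\<eta>| + D|\<eta>/d|\<close>, and the latter is controlled by the energy through Hardy's inequality.\<close>

lemma weighted_moment_Suc:
  assumes \<eta>: "\<eta> \<in> test_functions \<Omega>" and "m \<ge> 1"
  shows "(LINT x|lebesgue_on \<Omega>. (\<eta> x ^ Suc m / d x)\<^sup>2)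
    \<le> (LINT x|lebesgue_on \<Omega>. (\<eta> x ^ m / d x)\<^sup>2) * ((real (Suc m))\<^sup>2 * (moment_const * energy \<Omega> \<eta> (grad \<eta>)))"
proof -
  obtain K where K: "compact K" "K \<subseteq> \<Omega>" "\<And>x. x \<notin> K \<Longrightarrow> \<eta> x = 0"
    using test_functionsE[OF \<eta>] by blast
  have d0: "d x \<noteq> 0" if "x \<in> \<Omega>" for x using d_pos[OF that] by simp
  have cg: "continuous_on \<Omega> (grad \<eta>)"
    by (rule continuous_on_grad) (rule test_functions_continuous_partial[OF \<eta>])
  note cont = continuous_intros test_functions_continuous[OF \<eta>] d_continuous cg
  let ?p = "\<lambda>x. \<bar>\<eta> x ^ m / d x\<bar>"
  let ?q = "\<lambda>x. real (Suc m) * norm (grad \<eta> x) + D * \<bar>\<eta> x / d x\<bar>"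
  let ?f = "\<lambda>x. \<eta> x ^ Suc m * inverse (d x)"
  have ip: "integrable (lebesgue_on \<Omega>) (\<lambda>x. (?p x)\<^sup>2)"
    by (rule integrable_test_continuous[OF \<eta>]) (use assms(2) in \<open>auto intro!: cont simp: d0\<close>)
  have iq: "integrable (lebesgue_on \<Omega>) (\<lambda>x. (?q x)\<^sup>2)"
    by (rule integrable_test_continuous[OF \<eta>]) (auto intro!: cont simp: d0)
  have ipq: "integrable (lebesgue_on \<Omega>) (\<lambda>x. ?p x * ?q x)"
    by (rule integrable_test_continuous[OF \<eta>]) (use assms(2) in \<open>auto intro!: cont simp: d0\<close>)
  have ig: "integrable (lebesgue_on \<Omega>) (\<lambda>x. norm (grad ?f x))"
  proof (rule integrable_compact_support[OF open_\<Omega> K(1,2)])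
    show "continuous_on \<Omega> (\<lambda>x. norm (grad ?f x))"
      using weighted_power_C1[OF \<eta>, of "Suc m"] by (intro continuous_on_norm continuous_on_grad) simp
    fix x assume "x \<in> \<Omega> - K"
    then show "norm (grad ?f x) = 0"
      using grad_zero_outside[of K ?f x] compact_imp_closed[OF K(1)] K(3) by simp
  qed
  have ie: "integrable (lebesgue_on \<Omega>) (\<lambda>x. (\<eta> x)\<^sup>2 + (norm (grad \<eta> x))\<^sup>2)"
    using test_square_integrable[OF open_\<Omega> \<eta>] by (auto simp: square_integrable_def)
  have "(LINT x|lebesgue_on \<Omega>. (\<eta> x ^ Suc m / d x)\<^sup>2) = (LINT x|lebesgue_on \<Omega>. (?f x)\<^sup>2)"
    by (simp add: divide_inverse)
  also have "\<dots> \<le> (LINT x|lebesgue_on \<Omega>. norm (grad ?f x))\<^sup>2"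
    by (rule gagliardo_nirenberg[OF open_\<Omega> weighted_power_C1[OF \<eta>] K(1,2)]) (use K(3) in simp)
  also have "\<dots> \<le> (LINT x|lebesgue_on \<Omega>. ?p x * ?q x)\<^sup>2"
  proof (rule power_mono)
    show "(LINT x|lebesgue_on \<Omega>. norm (grad ?f x)) \<le> (LINT x|lebesgue_on \<Omega>. ?p x * ?q x)"
      by (rule Bochner_Integration.integral_mono[OF ig ipq]) (rule norm_grad_weighted_power_le[OF \<eta>], simp)
  qed simp
  also have "\<dots> \<le> (LINT x|lebesgue_on \<Omega>. (?p x)\<^sup>2) * (LINT x|lebesgue_on \<Omega>. (?q x)\<^sup>2)"
    by (rule integral_Cauchy_Schwarz[OF ip iq ipq])
  also have "\<dots> \<le> (LINT x|lebesgue_on \<Omega>. (?p x)\<^sup>2) * ((real (Suc m))\<^sup>2 * (moment_const * energy \<Omega> \<eta> (grad \<eta>)))"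
  proof (rule mult_left_mono)
    let ?M = "real (Suc m)"
    have "(LINT x|lebesgue_on \<Omega>. (?q x)\<^sup>2) \<le>
        (LINT x|lebesgue_on \<Omega>. 2 * ?M\<^sup>2 * ((\<eta> x)\<^sup>2 + (norm (grad \<eta> x))\<^sup>2) + 2 * D\<^sup>2 * (\<eta> x / d x)\<^sup>2)"
    proof (rule Bochner_Integration.integral_mono[OF iq])
      fix x
      have "(a + b)\<^sup>2 \<le> 2 * a\<^sup>2 + 2 * b\<^sup>2" for a b :: real
        using sum_squares_bound[of a b] by (simp add: power2_sum)
      from this[of "?M * norm (grad \<eta> x)" "D * \<bar>\<eta> x / d x\<bar>"]
      have "(?q x)\<^sup>2 \<le> 2 * ?M\<^sup>2 * (norm (grad \<eta> x))\<^sup>2 + 2 * D\<^sup>2 * (\<eta> x / d x)\<^sup>2"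
        unfolding power_mult_distrib power2_abs by simp
      moreover have "0 \<le> 2 * ?M\<^sup>2 * (\<eta> x)\<^sup>2" by simp
      ultimately show "(?q x)\<^sup>2 \<le> 2 * ?M\<^sup>2 * ((\<eta> x)\<^sup>2 + (norm (grad \<eta> x))\<^sup>2) + 2 * D\<^sup>2 * (\<eta> x / d x)\<^sup>2"
        unfolding distrib_left by linarith
    qed (intro Bochner_Integration.integrable_add integrable_mult_right ie hardy_test(1)[OF \<eta>])
    also have "\<dots> = 2 * ?M\<^sup>2 * energy \<Omega> \<eta> (grad \<eta>) + 2 * D\<^sup>2 * (LINT x|lebesgue_on \<Omega>. (\<eta> x / d x)\<^sup>2)"
      unfolding energy_def
      by (subst Bochner_Integration.integral_add)
         (intro integrable_mult_right ie hardy_test(1)[OF \<eta>] | simp only: integral_mult_right_zero)+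
    also have "\<dots> \<le> 2 * ?M\<^sup>2 * energy \<Omega> \<eta> (grad \<eta>) + 2 * D\<^sup>2 * (hardy_const * energy \<Omega> \<eta> (grad \<eta>))"
      by (intro add_left_mono mult_left_mono hardy_test(2)[OF \<eta>]) simp
    also have "\<dots> \<le> ?M\<^sup>2 * (moment_const * energy \<Omega> \<eta> (grad \<eta>))"
    proof -
      have "1 \<le> ?M\<^sup>2" by (simp add: one_le_power)
      moreover have "0 \<le> 2 * D\<^sup>2 * (hardy_const * energy \<Omega> \<eta> (grad \<eta>))" "0 \<le> ?M\<^sup>2 * (hardy_const * energy \<Omega> \<eta> (grad \<eta>))"
        using hardy_const_pos energy_nonneg[of \<Omega> \<eta> "grad \<eta>"] by (auto intro!: mult_nonneg_nonneg less_imp_le)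
      ultimately have "1 * (2 * D\<^sup>2 * (hardy_const * energy \<Omega> \<eta> (grad \<eta>))) \<le> ?M\<^sup>2 * (2 * D\<^sup>2 * (hardy_const * energy \<Omega> \<eta> (grad \<eta>)))"
        by (intro mult_right_mono)
      with \<open>0 \<le> ?M\<^sup>2 * (hardy_const * energy \<Omega> \<eta> (grad \<eta>))\<close> show ?thesis
        by (simp add: moment_const_def algebra_simps del: of_nat_Suc)
    qed
    finally show "(LINT x|lebesgue_on \<Omega>. (?q x)\<^sup>2) \<le> ?M\<^sup>2 * (moment_const * energy \<Omega> \<eta> (grad \<eta>))" .
  qed simp
  finally show ?thesis unfolding power2_abs .
qed

lemma moment_const_pos: "0 < moment_const"
  using hardy_const_pos by (simp add: moment_const_def add_nonneg_pos add_pos_nonneg)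

text \<open>Iteration of the previous lemma, starting from Hardy's inequality. The growth \<open>(m!)\<^sup>2 \<le> (2m)!\<close> is
  slow enough for the series of the hyperbolic cosine.\<close>

lemma weighted_moment_le:
  assumes \<eta>: "\<eta> \<in> test_functions \<Omega>"
  shows "(LINT x|lebesgue_on \<Omega>. (\<eta> x ^ Suc m / d x)\<^sup>2) \<le> (fact (Suc m))\<^sup>2 * (moment_const * energy \<Omega> \<eta> (grad \<eta>)) ^ Suc m"
proof (induction m)
  case 0
  have "(LINT x|lebesgue_on \<Omega>. (\<eta> x / d x)\<^sup>2) \<le> hardy_const * energy \<Omega> \<eta> (grad \<eta>)"
    by (rule hardy_test(2)[OF \<eta>])
  also have "\<dots> \<le> moment_const * energy \<Omega> \<eta> (grad \<eta>)"
    using hardy_const_pos by (intro mult_right_mono energy_nonneg) (simp add: moment_const_def)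
  finally show ?case by simp
next
  case (Suc m)
  let ?E = "moment_const * energy \<Omega> \<eta> (grad \<eta>)"
  have "(LINT x|lebesgue_on \<Omega>. (\<eta> x ^ Suc (Suc m) / d x)\<^sup>2)
      \<le> (LINT x|lebesgue_on \<Omega>. (\<eta> x ^ Suc m / d x)\<^sup>2) * ((real (Suc (Suc m)))\<^sup>2 * ?E)"
    by (rule weighted_moment_Suc[OF \<eta>]) simp
  also have "\<dots> \<le> ((fact (Suc m))\<^sup>2 * ?E ^ Suc m) * ((real (Suc (Suc m)))\<^sup>2 * ?E)"
    using moment_const_pos energy_nonneg[of \<Omega> \<eta> "grad \<eta>"]
    by (intro mult_right_mono Suc.IH mult_nonneg_nonneg) (auto simp del: of_nat_Suc)
  also have "\<dots> = (fact (Suc (Suc m)))\<^sup>2 * ?E ^ Suc (Suc m)"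
    by (simp add: power_mult_distrib del: of_nat_Suc)
  finally show ?case .
qed

end

section \<open>Exponential integrability\<close>

lemma cosh_minus_1_sums: "(\<lambda>m. x ^ (2 * Suc m) / fact (2 * Suc m)) sums (cosh x - 1)" for x :: real
proof -
  let ?f = "\<lambda>n. if even n then x ^ n /\<^sub>R fact n else 0"
  have "strict_mono (\<lambda>m::nat. 2 * m)" by (auto simp: strict_mono_def)
  moreover have "?f n = 0" if "n \<notin> range (\<lambda>m. 2 * m)" for n
    using that by (auto elim!: evenE)
  ultimately have "(\<lambda>m. ?f (2 * m)) sums cosh x"
    using sums_mono_reindex[of "\<lambda>m. 2 * m" ?f] cosh_converges[of x] by blast
  then have "(\<lambda>m. x ^ (2 * m) / fact (2 * m)) sums cosh x"
    by (simp add: divide_inverse mult.commute)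
  then have "(\<lambda>m. x ^ (2 * Suc m) / fact (2 * Suc m)) sums (cosh x - x ^ (2 * 0) / fact (2 * 0))"
    by (subst sums_Suc_iff)  simp
  then show ?thesis by simp
qed

lemma fact_sq_le: "(fact m :: real)\<^sup>2 \<le> fact (2 * m)"
proof -
  have "fact m * fact m dvd (fact (m + m) :: nat)" by (rule fact_fact_dvd_fact)
  then have "fact m * fact m \<le> (fact (m + m) :: nat)" by (rule dvd_imp_le) simp
  then have "real (fact m * fact m) \<le> real (fact (m + m))" by (simp only: of_nat_le_iff)
  then show ?thesis by (simp add: power2_eq_square mult_2)
qed

lemma exp_taylor2_nonneg: "0 \<le> exp t - 1 - t" for t :: real
  using exp_ge_add_one_self[of t] by linarith

lemma exp_taylor2_le_cosh: "exp t - 1 - t \<le> 2 * (cosh t - 1)" for t :: real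
  using exp_ge_add_one_self[of "- t"] by (simp add: cosh_def)

lemma cosh_add_le: "cosh (a + b) \<le> exp \<bar>b\<bar> * cosh a" for a b :: real
proof -
  have "exp (a + b) \<le> exp \<bar>b\<bar> * exp a" "exp (- (a + b)) \<le> exp \<bar>b\<bar> * exp (- a)"
    by (simp_all add: exp_add[symmetric])
  then show ?thesis by (simp add: cosh_def algebra_simps)
qed

text \<open>The weak gradient of a difference is, almost everywhere, the difference of the weak gradients.\<close>

lemma energy_weak_gradient_diff:
  assumes "open \<Omega>" "\<phi> \<in> H1_0 \<Omega>" "\<eta> \<in> test_functions \<Omega>"
  shows "energy \<Omega> (\<lambda>x. \<phi> x - \<eta> x) (weak_gradient \<Omega> (\<lambda>x. \<phi> x - \<eta> x))
    = energy \<Omega> (\<lambda>x. \<phi> x - \<eta> x) (\<lambda>x. weak_gradient \<Omega> \<phi> x - grad \<eta> x)"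
  unfolding energy_def
proof (rule integral_cong_AE)
  note D = H1_0_D[OF assms(1,2)] and T = test_square_integrable[OF assms(1,3)]
  note D' = H1_0_D[OF assms(1) H1_0_diff[OF assms(1,2) H1_0_test[OF assms(1,3)]]]
  have "AE x in lebesgue_on \<Omega>. weak_gradient \<Omega> (\<lambda>x. \<phi> x - \<eta> x) x = weak_gradient \<Omega> \<phi> x - grad \<eta> x"
    by (intro weak_gradient_AE has_weak_gradient_diff D(2) test_has_weak_gradient assms)
  then show "AE x in lebesgue_on \<Omega>. (\<phi> x - \<eta> x)\<^sup>2 + (norm (weak_gradient \<Omega> (\<lambda>x. \<phi> x - \<eta> x) x))\<^sup>2
      = (\<phi> x - \<eta> x)\<^sup>2 + (norm (weak_gradient \<Omega> \<phi> x - grad \<eta> x))\<^sup>2"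
    by eventually_elim simp
  show "(\<lambda>x. (\<phi> x - \<eta> x)\<^sup>2 + (norm (weak_gradient \<Omega> (\<lambda>x. \<phi> x - \<eta> x) x))\<^sup>2) \<in> borel_measurable (lebesgue_on \<Omega>)"
    "(\<lambda>x. (\<phi> x - \<eta> x)\<^sup>2 + (norm (weak_gradient \<Omega> \<phi> x - grad \<eta> x))\<^sup>2) \<in> borel_measurable (lebesgue_on \<Omega>)"
    using D D' T by (auto simp: square_integrable_def)
qed

text \<open>Convergence in energy is \<open>L\<^sup>1\<close> convergence of the squared differences, so a subsequence converges almost
  everywhere.\<close>

lemma H1_0_approx_sequence:
  assumes "open \<Omega>" "\<phi> \<in> H1_0 \<Omega>" "s > 0"
  obtains \<eta> where "\<And>n. \<eta> n \<in> test_functions \<Omega>"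
    "\<And>n. energy \<Omega> (\<lambda>x. \<phi> x - \<eta> n x) (\<lambda>x. weak_gradient \<Omega> \<phi> x - grad (\<eta> n) x) < s"
    "AE x in lebesgue_on \<Omega>. (\<lambda>n. \<eta> n x) \<longlonglongrightarrow> \<phi> x"
proof -
  let ?E = "\<lambda>\<eta>. energy \<Omega> (\<lambda>x. \<phi> x - \<eta> x) (\<lambda>x. weak_gradient \<Omega> \<phi> x - grad \<eta> x)"
  note D = H1_0_D[OF assms(1,2)]
  have "\<exists>\<eta>\<in>test_functions \<Omega>. ?E \<eta> < min s (1 / (real n + 1))" for n
    by (rule H1_0_approx[OF assms(1,2)]) (use assms(3) in simp)
  then obtain \<eta> where \<eta>: "\<And>n. \<eta> n \<in> test_functions \<Omega>" "\<And>n. ?E (\<eta> n) < min s (1 / (real n + 1))"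
    by metis
  have sq: "square_integrable \<Omega> (\<lambda>x. \<phi> x - \<eta> n x)" "square_integrable \<Omega> (\<lambda>x. weak_gradient \<Omega> \<phi> x - grad (\<eta> n) x)" for n
    by (intro square_integrable_diff D test_square_integrable[OF assms(1) \<eta>(1)])+
  have i: "integrable (lebesgue_on \<Omega>) (\<lambda>x. (\<phi> x - \<eta> n x)\<^sup>2)" for n
    using sq(1)[of n] by (simp add: square_integrable_def)
  have i2: "integrable (lebesgue_on \<Omega>) (\<lambda>x. (\<phi> x - \<eta> n x)\<^sup>2 + (norm (weak_gradient \<Omega> \<phi> x - grad (\<eta> n) x))\<^sup>2)" for n
    using sq[of n] by (simp add: square_integrable_def)
  have "(LINT x|lebesgue_on \<Omega>. norm ((\<phi> x - \<eta> n x)\<^sup>2)) \<le> ?E (\<eta> n)" for n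
    unfolding energy_def by (rule Bochner_Integration.integral_mono) (use i i2 in auto)
  then have le: "(LINT x|lebesgue_on \<Omega>. norm ((\<phi> x - \<eta> n x)\<^sup>2)) \<le> 1 / (real n + 1)" for n
    using \<eta>(2)[of n] by (meson less_le_trans less_imp_le min.cobounded2 order_trans)
  have "(\<lambda>n. LINT x|lebesgue_on \<Omega>. norm ((\<phi> x - \<eta> n x)\<^sup>2)) \<longlonglongrightarrow> 0"
  proof (rule tendsto_sandwich[OF _ _ tendsto_const])
    show "(\<lambda>n. 1 / (real n + 1)) \<longlonglongrightarrow> 0"
      using LIMSEQ_Suc[OF lim_1_over_n[where 'a=real]] by (simp add: add.commute)
  qed (use le in auto)
  from tendsto_L1_AE_subseq[OF i this]
  obtain r where r: "strict_mono r" "AE x in lebesgue_on \<Omega>. (\<lambda>n. (\<phi> x - \<eta> (r n) x)\<^sup>2) \<longlonglongrightarrow> 0" by blast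
  have "AE x in lebesgue_on \<Omega>. (\<lambda>n. \<eta> (r n) x) \<longlonglongrightarrow> \<phi> x"
    using r(2)
  proof eventually_elim
    case (elim x)
    then have "(\<lambda>n. sqrt ((\<phi> x - \<eta> (r n) x)\<^sup>2)) \<longlonglongrightarrow> sqrt 0" by (rule tendsto_real_sqrt)
    then have "(\<lambda>n. \<phi> x - \<eta> (r n) x) \<longlonglongrightarrow> 0" by (simp add: tendsto_rabs_zero_iff)
    then have "(\<lambda>n. \<phi> x - (\<phi> x - \<eta> (r n) x)) \<longlonglongrightarrow> \<phi> x - 0" by (intro tendsto_intros)
    then show ?case by simp
  qed
  with \<eta> show ?thesis by (intro that[of "\<lambda>n. \<eta> (r n)"]) auto
qed

context boundary_function
begin

text \<open>Fatou's lemma along an almost everywhere convergent sequence of test functions. If \<open>\<phi>\<close> and the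
  approximation errors have energy at most \<open>s/4\<close>, the approximating test functions have energy at
  most \<open>s\<close>, by the parallelogram identity.\<close>

lemma nn_integral_H1_0_le:
  fixes F :: "real \<Rightarrow> real"
  assumes F: "continuous_on UNIV F" and \<phi>: "\<phi> \<in> H1_0 \<Omega>" and "s > 0" "energy \<Omega> \<phi> (weak_gradient \<Omega> \<phi>) \<le> s / 4"
    and test: "\<And>\<eta>. \<eta> \<in> test_functions \<Omega> \<Longrightarrow> energy \<Omega> \<eta> (grad \<eta>) \<le> s
        \<Longrightarrow> (\<integral>\<^sup>+x. ennreal (F (\<eta> x) / (d x)\<^sup>2) \<partial>lebesgue_on \<Omega>) \<le> B"
  shows "(\<integral>\<^sup>+x. ennreal (F (\<phi> x) / (d x)\<^sup>2) \<partial>lebesgue_on \<Omega>) \<le> B"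
proof -
  note D = H1_0_D[OF open_\<Omega> \<phi>]
  obtain \<eta> where \<eta>: "\<And>n. \<eta> n \<in> test_functions \<Omega>"
    "\<And>n. energy \<Omega> (\<lambda>x. \<phi> x - \<eta> n x) (\<lambda>x. weak_gradient \<Omega> \<phi> x - grad (\<eta> n) x) < s / 4"
    "AE x in lebesgue_on \<Omega>. (\<lambda>n. \<eta> n x) \<longlonglongrightarrow> \<phi> x"
    using H1_0_approx_sequence[OF open_\<Omega> \<phi>, of "s / 4"] assms(3) by auto
  have e: "energy \<Omega> (\<eta> n) (grad (\<eta> n)) \<le> s" for n
  proof -
    have "energy \<Omega> (\<lambda>x. \<phi> x - (\<phi> x - \<eta> n x)) (\<lambda>x. weak_gradient \<Omega> \<phi> x - (weak_gradient \<Omega> \<phi> x - grad (\<eta> n) x))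
       \<le> 2 * energy \<Omega> \<phi> (weak_gradient \<Omega> \<phi>) + 2 * energy \<Omega> (\<lambda>x. \<phi> x - \<eta> n x) (\<lambda>x. weak_gradient \<Omega> \<phi> x - grad (\<eta> n) x)"
      by (intro energy_diff_le square_integrable_diff D test_square_integrable[OF open_\<Omega> \<eta>(1)])
    then show ?thesis using \<eta>(2)[of n] assms(4) by simp
  qed
  have d0: "d x \<noteq> 0" if "x \<in> \<Omega>" for x using d_pos[OF that] by simp
  have "(\<integral>\<^sup>+x. ennreal (F (\<phi> x) / (d x)\<^sup>2) \<partial>lebesgue_on \<Omega>)
      = (\<integral>\<^sup>+x. liminf (\<lambda>n. ennreal (F (\<eta> n x) / (d x)\<^sup>2)) \<partial>lebesgue_on \<Omega>)"
  proof (rule nn_integral_cong_AE)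
    show "AE x in lebesgue_on \<Omega>. ennreal (F (\<phi> x) / (d x)\<^sup>2) = liminf (\<lambda>n. ennreal (F (\<eta> n x) / (d x)\<^sup>2))"
      using \<eta>(3) AE_space
    proof eventually_elim
      case (elim x)
      have "isCont F (\<phi> x)" using F by (simp add: continuous_on_eq_continuous_at)
      then have "(\<lambda>n. F (\<eta> n x)) \<longlonglongrightarrow> F (\<phi> x)" using elim(1) by (rule isCont_tendsto_compose)
      then have "(\<lambda>n. ennreal (F (\<eta> n x) / (d x)\<^sup>2)) \<longlonglongrightarrow> ennreal (F (\<phi> x) / (d x)\<^sup>2)"
        using elim(2) d0[of x] by (intro tendsto_ennrealI tendsto_divide tendsto_const) auto
      then show ?case using lim_imp_Liminf[OF sequentially_bot] by metis
    qed
  qed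
  also have "\<dots> \<le> liminf (\<lambda>n. \<integral>\<^sup>+x. ennreal (F (\<eta> n x) / (d x)\<^sup>2) \<partial>lebesgue_on \<Omega>)"
  proof (rule nn_integral_liminf)
    fix n
    have "continuous_on \<Omega> (\<lambda>x. F (\<eta> n x) / (d x)\<^sup>2)"
      by (intro continuous_on_divide continuous_on_power d_continuous
          continuous_on_compose2[OF F test_functions_continuous[OF \<eta>(1)]]) (auto simp: d0)
    then have "(\<lambda>x. F (\<eta> n x) / (d x)\<^sup>2) \<in> borel_measurable (lebesgue_on \<Omega>)"
      using open_\<Omega> by (intro continuous_imp_measurable_on_sets_lebesgue) auto
    then show "(\<lambda>x. ennreal (F (\<eta> n x) / (d x)\<^sup>2)) \<in> borel_measurable (lebesgue_on \<Omega>)" by simp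
  qed
  also have "\<dots> \<le> liminf (\<lambda>n::nat. B)"
    by (intro Liminf_mono always_eventually allI test \<eta>(1) e)
  also have "\<dots> = B" by (simp add: Liminf_const)
  finally show ?thesis .
qed

lemma hardy_H1_0:
  assumes \<phi>: "\<phi> \<in> H1_0 \<Omega>" and "s > 0" "energy \<Omega> \<phi> (weak_gradient \<Omega> \<phi>) \<le> s / 4"
  shows "integrable (lebesgue_on \<Omega>) (\<lambda>x. (\<phi> x / d x)\<^sup>2)"
    and "(LINT x|lebesgue_on \<Omega>. (\<phi> x / d x)\<^sup>2) \<le> hardy_const * s"
proof -
  have "(\<integral>\<^sup>+x. ennreal ((\<eta> x)\<^sup>2 / (d x)\<^sup>2) \<partial>lebesgue_on \<Omega>) \<le> ennreal (hardy_const * s)"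
    if \<eta>: "\<eta> \<in> test_functions \<Omega>" and e: "energy \<Omega> \<eta> (grad \<eta>) \<le> s" for \<eta>
  proof -
    have "(\<integral>\<^sup>+x. ennreal ((\<eta> x / d x)\<^sup>2) \<partial>lebesgue_on \<Omega>) = ennreal (LINT x|lebesgue_on \<Omega>. (\<eta> x / d x)\<^sup>2)"
      by (rule nn_integral_eq_integral[OF hardy_test(1)[OF \<eta>]]) simp
    also have "\<dots> \<le> ennreal (hardy_const * s)"
      using hardy_test(2)[OF \<eta>] mult_left_mono[OF e less_imp_le[OF hardy_const_pos]]
      by (intro ennreal_leI) linarith
    finally show ?thesis by (simp add: power_divide)
  qed
  then have "(\<integral>\<^sup>+x. ennreal ((\<phi> x)\<^sup>2 / (d x)\<^sup>2) \<partial>lebesgue_on \<Omega>) \<le> ennreal (hardy_const * s)"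
    by (intro nn_integral_H1_0_le[OF _ assms, of "\<lambda>t. t\<^sup>2"] continuous_intros) auto
  then have le: "(\<integral>\<^sup>+x. ennreal ((\<phi> x / d x)\<^sup>2) \<partial>lebesgue_on \<Omega>) \<le> ennreal (hardy_const * s)"
    by (simp add: power_divide)
  have [measurable]: "\<phi> \<in> borel_measurable (lebesgue_on \<Omega>)"
    using H1_0_D(1)[OF open_\<Omega> \<phi>] by (simp add: square_integrable_def)
  have [measurable]: "d \<in> borel_measurable (lebesgue_on \<Omega>)"
    using open_\<Omega> d_continuous by (intro continuous_imp_measurable_on_sets_lebesgue) auto
  show i: "integrable (lebesgue_on \<Omega>) (\<lambda>x. (\<phi> x / d x)\<^sup>2)"
    unfolding integrable_iff_bounded
  proof
    have "(\<integral>\<^sup>+x. ennreal (norm ((\<phi> x / d x)\<^sup>2)) \<partial>lebesgue_on \<Omega>) \<le> ennreal (hardy_const * s)"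
      using le by simp
    then show "(\<integral>\<^sup>+x. ennreal (norm ((\<phi> x / d x)\<^sup>2)) \<partial>lebesgue_on \<Omega>) < \<infinity>"
      by (rule le_less_trans) simp
  qed measurable
  have "ennreal (LINT x|lebesgue_on \<Omega>. (\<phi> x / d x)\<^sup>2) \<le> ennreal (hardy_const * s)"
    using le nn_integral_eq_integral[OF i] by simp
  then show "(LINT x|lebesgue_on \<Omega>. (\<phi> x / d x)\<^sup>2) \<le> hardy_const * s"
    using hardy_const_pos assms(2) by (subst (asm) ennreal_le_iff) auto
qed

end

context planar_boundary_function
begin

text \<open>Termwise integration of the series: under the smallness assumption the \<open>m\<close>-th term integrates to at most
  \<open>2\<^sup>-\<^sup>m\<close>.\<close>

lemma cosh_test_le:
  assumes \<eta>: "\<eta> \<in> test_functions \<Omega>" and small: "8 * moment_const * energy \<Omega> \<eta> (grad \<eta>) \<le> 1"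
  shows "(\<integral>\<^sup>+x. ennreal ((cosh (2 * \<eta> x) - 1) / (d x)\<^sup>2) \<partial>lebesgue_on \<Omega>) \<le> 1"
proof -
  define E where "E = moment_const * energy \<Omega> \<eta> (grad \<eta>)"
  have E: "0 \<le> E" "4 * E \<le> 1 / 2"
    using small moment_const_pos energy_nonneg[of \<Omega> \<eta> "grad \<eta>"] by (auto simp: E_def)
  have d0: "d x \<noteq> 0" if "x \<in> \<Omega>" for x using d_pos[OF that] by simp
  define c where "c m = (4 ^ Suc m / fact (2 * Suc m) :: real)" for m
  have c0: "0 \<le> c m" for m by (simp add: c_def)
  have i: "integrable (lebesgue_on \<Omega>) (\<lambda>x. (\<eta> x ^ Suc m / d x)\<^sup>2)" for m
    by (rule integrable_test_continuous[OF \<eta>])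
       (auto intro!: continuous_intros test_functions_continuous[OF \<eta>] d_continuous simp: d0)
  have series: "ennreal ((cosh (2 * \<eta> x) - 1) / (d x)\<^sup>2) = (\<Sum>m. ennreal (c m * (\<eta> x ^ Suc m / d x)\<^sup>2))" for x
  proof -
    have "(\<lambda>m. (2 * \<eta> x) ^ (2 * Suc m) / fact (2 * Suc m) / (d x)\<^sup>2) sums ((cosh (2 * \<eta> x) - 1) / (d x)\<^sup>2)"
      by (rule sums_divide[OF cosh_minus_1_sums])
    moreover have "(2 * \<eta> x) ^ (2 * Suc m) / fact (2 * Suc m) / (d x)\<^sup>2 = c m * (\<eta> x ^ Suc m / d x)\<^sup>2" for m
    proof -
      have "(2 * \<eta> x) ^ (2 * Suc m) = 4 ^ Suc m * (\<eta> x ^ Suc m)\<^sup>2"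
        by (simp only: power_mult_distrib power_mult[symmetric] mult.commute[of "Suc m" 2])
           (simp only: power_mult, simp)
      then show ?thesis by (simp only: c_def power_divide times_divide_times_eq divide_divide_eq_left)
    qed
    ultimately have "(\<lambda>m. c m * (\<eta> x ^ Suc m / d x)\<^sup>2) sums ((cosh (2 * \<eta> x) - 1) / (d x)\<^sup>2)" by simp
    then show ?thesis by (intro suminf_ennreal_eq[symmetric]) (auto intro: mult_nonneg_nonneg c0)
  qed
  have term_le: "(\<integral>\<^sup>+x. ennreal (c m * (\<eta> x ^ Suc m / d x)\<^sup>2) \<partial>lebesgue_on \<Omega>) \<le> ennreal ((1 / 2) ^ Suc m)" for m
  proof -
    have "(\<integral>\<^sup>+x. ennreal (c m * (\<eta> x ^ Suc m / d x)\<^sup>2) \<partial>lebesgue_on \<Omega>)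
        = ennreal (LINT x|lebesgue_on \<Omega>. c m * (\<eta> x ^ Suc m / d x)\<^sup>2)"
      by (rule nn_integral_eq_integral[OF integrable_mult_right[OF i]])
         (intro AE_I2 mult_nonneg_nonneg c0 zero_le_power2)
    also have "(LINT x|lebesgue_on \<Omega>. c m * (\<eta> x ^ Suc m / d x)\<^sup>2) = c m * (LINT x|lebesgue_on \<Omega>. (\<eta> x ^ Suc m / d x)\<^sup>2)"
      by (rule integral_mult_right_zero)
    also have "ennreal \<dots> \<le> ennreal ((1 / 2) ^ Suc m)"
    proof (rule ennreal_leI)
      have "c m * (LINT x|lebesgue_on \<Omega>. (\<eta> x ^ Suc m / d x)\<^sup>2) \<le> c m * ((fact (Suc m))\<^sup>2 * E ^ Suc m)"
        unfolding E_def by (intro mult_left_mono weighted_moment_le[OF \<eta>] c0)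
      also have "\<dots> = ((fact (Suc m))\<^sup>2 / fact (2 * Suc m)) * (4 * E) ^ Suc m"
        by (simp only: c_def power_mult_distrib) (simp add: mult.assoc del: power_Suc fact_Suc)
      also have "\<dots> \<le> 1 * (1 / 2) ^ Suc m"
      proof (intro mult_mono power_mono)
        show "(fact (Suc m))\<^sup>2 / fact (2 * Suc m) \<le> (1::real)"
          using fact_sq_le[of "Suc m"] by (simp del: fact_Suc)
      qed (use E in auto)
      finally show "c m * (LINT x|lebesgue_on \<Omega>. (\<eta> x ^ Suc m / d x)\<^sup>2) \<le> (1 / 2) ^ Suc m" by simp
    qed
    finally show ?thesis .
  qed
  have "(\<integral>\<^sup>+x. ennreal ((cosh (2 * \<eta> x) - 1) / (d x)\<^sup>2) \<partial>lebesgue_on \<Omega>)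
      = (\<Sum>m. \<integral>\<^sup>+x. ennreal (c m * (\<eta> x ^ Suc m / d x)\<^sup>2) \<partial>lebesgue_on \<Omega>)"
    unfolding series by (rule nn_integral_suminf) (use i in \<open>auto dest!: borel_measurable_integrable simp del: power_Suc\<close>)
  also have "\<dots> \<le> (\<Sum>m. ennreal ((1 / 2) ^ Suc m))"
    by (intro suminf_le term_le) auto
  also have "\<dots> = ennreal 1"
    by (rule suminf_ennreal_eq[OF _ power_half_series]) simp
  finally show ?thesis by simp
qed

lemma cosh_integrable_small:
  assumes \<phi>: "\<phi> \<in> H1_0 \<Omega>" and small: "32 * moment_const * energy \<Omega> \<phi> (weak_gradient \<Omega> \<phi>) \<le> 1"
  shows "integrable (lebesgue_on \<Omega>) (\<lambda>x. (cosh (2 * \<phi> x) - 1) / (d x)\<^sup>2)"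
  unfolding integrable_iff_bounded
proof
  have [measurable]: "\<phi> \<in> borel_measurable (lebesgue_on \<Omega>)"
    using H1_0_D(1)[OF open_\<Omega> \<phi>] by (simp add: square_integrable_def)
  have [measurable]: "d \<in> borel_measurable (lebesgue_on \<Omega>)"
    using open_\<Omega> d_continuous by (intro continuous_imp_measurable_on_sets_lebesgue) auto
  have [measurable]: "(\<lambda>x. cosh (2 * \<phi> x)) \<in> borel_measurable (lebesgue_on \<Omega>)"
    unfolding cosh_def by measurable
  show "(\<lambda>x. (cosh (2 * \<phi> x) - 1) / (d x)\<^sup>2) \<in> borel_measurable (lebesgue_on \<Omega>)" by measurable
  \<comment> \<open>The largest energy that is admitted for test functions.\<close>
  define s where "s = 1 / (8 * moment_const)"
  have s: "s > 0" using moment_const_pos by (simp add: s_def)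
  have en: "energy \<Omega> \<phi> (weak_gradient \<Omega> \<phi>) \<le> s / 4"
    using small moment_const_pos by (simp add: s_def field_simps)
  have "(\<integral>\<^sup>+x. ennreal ((cosh (2 * \<phi> x) - 1) / (d x)\<^sup>2) \<partial>lebesgue_on \<Omega>) \<le> 1"
  proof (rule nn_integral_H1_0_le[OF _ \<phi> s en, of "\<lambda>t. cosh (2 * t) - 1"])
    show "continuous_on UNIV (\<lambda>t::real. cosh (2 * t) - 1)" by (intro continuous_intros)
    fix \<eta> assume "\<eta> \<in> test_functions \<Omega>" "energy \<Omega> \<eta> (grad \<eta>) \<le> s"
    then show "(\<integral>\<^sup>+x. ennreal ((cosh (2 * \<eta> x) - 1) / (d x)\<^sup>2) \<partial>lebesgue_on \<Omega>) \<le> 1"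
      using moment_const_pos by (intro cosh_test_le) (auto simp: s_def field_simps)
  qed
  moreover have "norm ((cosh (2 * \<phi> x) - 1) / (d x)\<^sup>2) = (cosh (2 * \<phi> x) - 1) / (d x)\<^sup>2" for x
    using cosh_real_ge_1[of "2 * \<phi> x"] by simp
  ultimately show "(\<integral>\<^sup>+x. ennreal (norm ((cosh (2 * \<phi> x) - 1) / (d x)\<^sup>2)) \<partial>lebesgue_on \<Omega>) < \<infinity>"
    by (simp only:) (rule le_less_trans, assumption, simp)
qed

text \<open>Write \<open>\<phi> = \<rho> + \<eta>\<close> with a test function \<open>\<eta>\<close> and \<open>\<rho>\<close> of small energy. Outside the support of \<open>\<eta>\<close> the functions
  \<open>\<phi>\<close> and \<open>\<rho>\<close> agree; on the support the weight \<open>1/d\<^sup>2\<close> and \<open>e\<^sup>2\<^sup>\<eta>\<close> are bounded.\<close>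

lemma exp_integrable:
  assumes \<phi>: "\<phi> \<in> H1_0 \<Omega>"
  shows "integrable (lebesgue_on \<Omega>) (\<lambda>x. (exp (2 * \<phi> x) - 1 - 2 * \<phi> x) / (d x)\<^sup>2)"
proof -
  have "1 / (32 * moment_const) > 0" using moment_const_pos by simp
  from H1_0_approx[OF open_\<Omega> \<phi> this] obtain \<eta> where \<eta>: "\<eta> \<in> test_functions \<Omega>"
    "energy \<Omega> (\<lambda>x. \<phi> x - \<eta> x) (\<lambda>x. weak_gradient \<Omega> \<phi> x - grad \<eta> x) < 1 / (32 * moment_const)" by blast
  define \<rho> where "\<rho> x = \<phi> x - \<eta> x" for x
  have \<rho>: "\<rho> \<in> H1_0 \<Omega>"
    unfolding \<rho>_def[abs_def] by (rule H1_0_diff[OF open_\<Omega> \<phi> H1_0_test[OF open_\<Omega> \<eta>(1)]])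
  note D = H1_0_D[OF open_\<Omega> \<phi>] and D\<rho> = H1_0_D[OF open_\<Omega> \<rho>]
  have "energy \<Omega> \<rho> (weak_gradient \<Omega> \<rho>) = energy \<Omega> \<rho> (\<lambda>x. weak_gradient \<Omega> \<phi> x - grad \<eta> x)"
    unfolding \<rho>_def[abs_def] by (rule energy_weak_gradient_diff[OF open_\<Omega> \<phi> \<eta>(1)])
  also have "\<dots> < 1 / (32 * moment_const)" using \<eta>(2) by (simp add: \<rho>_def[abs_def])
  finally have "32 * moment_const * energy \<Omega> \<rho> (weak_gradient \<Omega> \<rho>) \<le> 1"
    using moment_const_pos by (simp add: field_simps)
  then have i\<rho>: "integrable (lebesgue_on \<Omega>) (\<lambda>x. (cosh (2 * \<rho> x) - 1) / (d x)\<^sup>2)"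
    by (rule cosh_integrable_small[OF \<rho>])
  obtain K where K: "compact K" "K \<subseteq> \<Omega>" "\<And>x. x \<notin> K \<Longrightarrow> \<eta> x = 0"
    using test_functionsE[OF \<eta>(1)] by blast
  have "compact (\<eta> ` K)"
    by (intro compact_continuous_image test_functions_continuous[OF \<eta>(1)] K)
  then obtain b where b: "\<forall>y\<in>\<eta> ` K. \<bar>y\<bar> \<le> b" "0 < b"
    by (metis bounded_pos compact_imp_bounded real_norm_def)
  define M where "M = 2 * exp (2 * b)"
  have M: "M \<ge> 2" using b(2) by (simp add: M_def)
  have "integrable lborel (\<lambda>x. indicator K x *\<^sub>R (1 / (d x)\<^sup>2))"
    using K d_pos by (intro borel_integrable_compact continuous_intros continuous_on_subset[OF d_continuous]) force+
  then have iK: "integrable (lebesgue_on \<Omega>) (\<lambda>x. indicator K x *\<^sub>R (1 / (d x)\<^sup>2))"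
    by (rule integral_lebesgue_on_eq_lborel(1)[rotated]) (use K(2) open_\<Omega> in \<open>auto simp: indicator_def\<close>)
  show ?thesis
  proof (rule Bochner_Integration.integrable_bound)
    show "integrable (lebesgue_on \<Omega>) (\<lambda>x. M * ((cosh (2 * \<rho> x) - 1) / (d x)\<^sup>2) + M * (indicator K x *\<^sub>R (1 / (d x)\<^sup>2)))"
      by (intro Bochner_Integration.integrable_add integrable_mult_right i\<rho> iK)
    have [measurable]: "\<phi> \<in> borel_measurable (lebesgue_on \<Omega>)"
      using D(1) by (simp add: square_integrable_def)
    have [measurable]: "d \<in> borel_measurable (lebesgue_on \<Omega>)"
      using open_\<Omega> d_continuous by (intro continuous_imp_measurable_on_sets_lebesgue) auto
    show "(\<lambda>x. (exp (2 * \<phi> x) - 1 - 2 * \<phi> x) / (d x)\<^sup>2) \<in> borel_measurable (lebesgue_on \<Omega>)" by measurable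
    show "AE x in lebesgue_on \<Omega>. norm ((exp (2 * \<phi> x) - 1 - 2 * \<phi> x) / (d x)\<^sup>2)
        \<le> norm (M * ((cosh (2 * \<rho> x) - 1) / (d x)\<^sup>2) + M * (indicator K x *\<^sub>R (1 / (d x)\<^sup>2)))"
    proof (rule AE_I2)
      fix x
      have c1: "0 \<le> cosh (2 * \<rho> x) - 1" using cosh_real_ge_1[of "2 * \<rho> x"] by simp
      have num: "exp (2 * \<phi> x) - 1 - 2 * \<phi> x \<le> M * (cosh (2 * \<rho> x) - 1) + M * indicator K x"
      proof (cases "x \<in> K")
        case True
        then have "\<bar>2 * \<eta> x\<bar> \<le> 2 * b" using b by auto
        have "cosh (2 * \<phi> x) \<le> exp \<bar>2 * \<eta> x\<bar> * cosh (2 * \<rho> x)"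
          using cosh_add_le[of "2 * \<rho> x" "2 * \<eta> x"] by (simp add: \<rho>_def algebra_simps)
        also have "\<dots> \<le> exp (2 * b) * cosh (2 * \<rho> x)"
          using \<open>\<bar>2 * \<eta> x\<bar> \<le> 2 * b\<close> c1 by (intro mult_right_mono) auto
        finally have "2 * (cosh (2 * \<phi> x) - 1) \<le> M * cosh (2 * \<rho> x)" by (simp add: M_def)
        then show ?thesis using True exp_taylor2_le_cosh[of "2 * \<phi> x"] by (simp add: algebra_simps)
      next
        case False
        then have "\<phi> x = \<rho> x" using K(3) by (simp add: \<rho>_def)
        then have "exp (2 * \<phi> x) - 1 - 2 * \<phi> x \<le> 2 * (cosh (2 * \<rho> x) - 1)"
          using exp_taylor2_le_cosh[of "2 * \<phi> x"] by simp
        also have "\<dots> \<le> M * (cosh (2 * \<rho> x) - 1)" by (rule mult_right_mono[OF M c1])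
        finally show ?thesis using False by simp
      qed
      have "norm ((exp (2 * \<phi> x) - 1 - 2 * \<phi> x) / (d x)\<^sup>2) = (exp (2 * \<phi> x) - 1 - 2 * \<phi> x) / (d x)\<^sup>2"
        using exp_taylor2_nonneg[of "2 * \<phi> x"] by simp
      also have "\<dots> \<le> (M * (cosh (2 * \<rho> x) - 1) + M * indicator K x) / (d x)\<^sup>2"
        by (rule divide_right_mono[OF num]) simp
      also have "\<dots> = M * ((cosh (2 * \<rho> x) - 1) / (d x)\<^sup>2) + M * (indicator K x *\<^sub>R (1 / (d x)\<^sup>2))"
        by (simp add: add_divide_distrib)
      finally show "norm ((exp (2 * \<phi> x) - 1 - 2 * \<phi> x) / (d x)\<^sup>2)
        \<le> norm (M * ((cosh (2 * \<rho> x) - 1) / (d x)\<^sup>2) + M * (indicator K x *\<^sub>R (1 / (d x)\<^sup>2)))"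
        by simp
    qed
  qed
qed

end

section \<open>Functions that vanish at the boundary\<close>

lemma truncated_square_deriv: "((\<lambda>t. (max 0 t)\<^sup>2) has_real_derivative 2 * max 0 t) (at t)" for t :: real
proof -
  consider "t < 0" | "t > 0" | "t = 0" by linarith
  then show ?thesis
  proof cases
    case 1
    have "((\<lambda>t. 0) has_real_derivative 0) (at t)" by simp
    then have "((\<lambda>t. (max 0 t)\<^sup>2) has_real_derivative 0) (at t)"
      by (rule has_field_derivative_transform_within_open[of _ _ _ "{..<0}"]) (use 1 in auto)
    then show ?thesis using 1 by simp
  next
    case 2
    have "((\<lambda>t. t\<^sup>2) has_real_derivative 2 * t) (at t)" by (auto intro!: derivative_eq_intros)
    then have "((\<lambda>t. (max 0 t)\<^sup>2) has_real_derivative 2 * t) (at t)"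
      by (rule has_field_derivative_transform_within_open[of _ _ _ "{0<..}"]) (use 2 in auto)
    then show ?thesis using 2 by simp
  next
    case 3
    have "((\<lambda>t. (max 0 t)\<^sup>2 / t) \<longlongrightarrow> 0) (at (0::real))"
    proof (rule Lim_null_comparison[OF _ tendsto_rabs_zero[OF tendsto_ident_at]])
      show "\<forall>\<^sub>F t in at (0::real). norm ((max 0 t)\<^sup>2 / t) \<le> \<bar>t\<bar>"
        by (auto simp: eventually_at_filter max_def power2_eq_square)
    qed
    then show ?thesis using 3 by (simp add: has_field_derivative_iff)
  qed
qed

lemma integrable_const_bounded:
  fixes c :: real
  assumes "open \<Omega>" "bounded \<Omega>"
  shows "integrable (lebesgue_on \<Omega>) (\<lambda>_. c)"
proof -
  interpret finite_measure "lebesgue_on \<Omega>"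
    using assms by (intro finite_measure_lebesgue_on lmeasurable_open)
  show ?thesis by simp
qed

lemma bounded_square_integrable:
  fixes f :: "'a::euclidean_space \<Rightarrow> 'b::euclidean_space"
  assumes "open \<Omega>" "bounded \<Omega>" "f \<in> borel_measurable (lebesgue_on \<Omega>)" "\<And>x. x \<in> \<Omega> \<Longrightarrow> norm (f x) \<le> B"
  shows "square_integrable \<Omega> f"
  unfolding square_integrable_def
proof
  show "integrable (lebesgue_on \<Omega>) (\<lambda>x. (norm (f x))\<^sup>2)"
  proof (rule Bochner_Integration.integrable_bound[OF integrable_const_bounded[OF assms(1,2), of "B\<^sup>2"]])
    show "AE x in lebesgue_on \<Omega>. norm ((norm (f x))\<^sup>2) \<le> norm (B\<^sup>2)"
      using assms(4) by (intro AE_I2) (auto intro!: power_mono)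
  qed (use assms(3) in auto)
qed (rule assms(3))

context boundary_function
begin

text \<open>The factor \<open>(max 0 (1 - e/d))\<^sup>2\<close> vanishes where \<open>d \<le> e\<close>, and its gradient is \<open>O(e/d\<^sup>2)\<close>: multiplied
  with a function that is \<open>O(d)\<close> it stays bounded, and tends to zero with \<open>e\<close>.\<close>

definition cutoff :: "real \<Rightarrow> 'a \<Rightarrow> real" where
  "cutoff e x = (max 0 (1 - e * inverse (d x)))\<^sup>2"

lemma cutoff_arg_differentiable: "x \<in> \<Omega> \<Longrightarrow> (\<lambda>x. 1 - e * inverse (d x)) differentiable (at x)"
  using inverse_d_differentiable by (intro differentiable_diff differentiable_mult) auto

lemma partial_cutoff:
  assumes "x \<in> \<Omega>"
  shows "partial b (cutoff e) x = 2 * max 0 (1 - e * inverse (d x)) * (e * partial b d x / (d x)\<^sup>2)"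
proof -
  have "partial b (\<lambda>x. 1 - e * inverse (d x)) x = - (e * (- partial b d x / (d x)\<^sup>2))"
    using partial_diff[of "\<lambda>_. 1" x "\<lambda>x. e * inverse (d x)" b] inverse_d_differentiable[OF assms]
      partial_mult[of "\<lambda>_. e" x "\<lambda>x. inverse (d x)" b] partial_inverse[OF d_differentiable[OF assms], of b]
      d_pos[OF assms]
    by (simp add: differentiable_mult)
  then show ?thesis
    using partial_chain_real[OF cutoff_arg_differentiable[OF assms] truncated_square_deriv, where b=b]
    unfolding cutoff_def[abs_def] by simp
qed

lemma cutoff_C1: "C_diff 1 \<Omega> (cutoff e)"
proof -
  have "cutoff e differentiable (at x)" if "x \<in> \<Omega>" for x
    using has_derivative_chain_real[OF cutoff_arg_differentiable[OF that] truncated_square_deriv]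
    unfolding cutoff_def[abs_def] differentiable_def by blast
  then have "cutoff e differentiable_on \<Omega>" using open_\<Omega> by (simp add: differentiable_on_eq_differentiable_at)
  moreover have "continuous_on \<Omega> (partial b (cutoff e))" if "b \<in> Basis" for b
  proof -
    have "continuous_on \<Omega> (\<lambda>x. 2 * max 0 (1 - e * inverse (d x)) * (e * partial b d x / (d x)\<^sup>2))"
      using d_pos C_diff_continuous_on[OF partial_d_C1[OF that]]
      by (intro continuous_intros continuous_on_max d_continuous) force+
    then show ?thesis by (rule continuous_on_eq) (simp add: partial_cutoff)
  qed
  ultimately show ?thesis by simp
qed

lemma cutoff_bounds: "e > 0 \<Longrightarrow> x \<in> \<Omega> \<Longrightarrow> 0 \<le> cutoff e x" "e > 0 \<Longrightarrow> x \<in> \<Omega> \<Longrightarrow> cutoff e x \<le> 1"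
  using d_pos[of x] by (auto simp: cutoff_def max_def intro!: power_le_one)

lemma cutoff_zero: "x \<in> \<Omega> \<Longrightarrow> d x \<le> e \<Longrightarrow> cutoff e x = 0"
  using d_pos[of x] by (simp add: cutoff_def max_def field_simps)

lemma norm_grad_cutoff_le:
  assumes "x \<in> \<Omega>" "e > 0"
  shows "d x * norm (grad (cutoff e) x) \<le> 2 * D * min 1 (e / d x)"
proof -
  have dx: "d x > 0" by (rule d_pos[OF assms(1)])
  have D0: "0 \<le> D" using grad_le[OF assms(1)] norm_ge_zero[of "grad d x"] by linarith
  let ?m = "max 0 (1 - e * inverse (d x))"
  have "grad (cutoff e) x = (2 * ?m * (e / (d x)\<^sup>2)) *\<^sub>R grad d x"
    unfolding grad_def scaleR_sum_right
    by (intro sum.cong) (simp_all add: partial_cutoff[OF assms(1)])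
  then have "d x * norm (grad (cutoff e) x) = d x * (\<bar>2 * ?m * (e / (d x)\<^sup>2)\<bar> * norm (grad d x))" by simp
  also have "\<dots> = 2 * ?m * (e / d x) * norm (grad d x)"
    using dx assms(2) by (simp add: abs_mult power2_eq_square)
  also have "\<dots> \<le> 2 * ?m * (e / d x) * D"
    using dx assms(2) by (intro mult_left_mono grad_le assms) auto
  also have "\<dots> \<le> 2 * min 1 (e / d x) * D"
  proof (rule mult_right_mono[OF _ D0])
    show "2 * ?m * (e / d x) \<le> 2 * min 1 (e / d x)"
    proof (cases "e < d x")
      case True
      then have "?m \<le> 1" "e / d x \<le> 1" using dx assms(2) by (auto simp: field_simps)
      then have "?m * (e / d x) \<le> 1 * (e / d x)" using dx assms(2) by (intro mult_right_mono) auto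
      then show ?thesis using \<open>e / d x \<le> 1\<close> by simp
    next
      case False
      then have "?m = 0" using dx by (simp add: field_simps)
      then show ?thesis using dx assms(2) by simp
    qed
  qed
  finally show ?thesis by (simp add: mult.commute mult.left_commute)
qed

text \<open>Mollify the product of \<open>w\<close> and the cutoff. The bounds tend to zero with \<open>e\<close> at every point and are bounded
  uniformly, as dominated convergence requires.\<close>

lemma test_near_cutoff:
  fixes e :: real
  assumes w: "C_diff 1 \<Omega> w" and K: "compact {x \<in> \<Omega>. e \<le> d x}" and e: "e > 0"
    and wd: "\<And>x. x \<in> \<Omega> \<Longrightarrow> \<bar>w x\<bar> \<le> C * d x" and wB: "\<And>x. x \<in> \<Omega> \<Longrightarrow> \<bar>w x\<bar> \<le> B"
    and wG: "\<And>x. x \<in> \<Omega> \<Longrightarrow> norm (grad w x) \<le> G"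
  obtains \<eta> where "\<eta> \<in> test_functions \<Omega>"
    "\<And>x. x \<in> \<Omega> \<Longrightarrow> \<bar>w x - \<eta> x\<bar> \<le> B * (1 - cutoff e x) + e"
    "\<And>x. x \<in> \<Omega> \<Longrightarrow> norm (grad w x - grad \<eta> x) \<le> G * (1 - cutoff e x) + 2 * C * D * min 1 (e / d x) + DIM('a) * e"
proof -
  let ?K = "{x \<in> \<Omega>. e \<le> d x}"
  let ?f = "\<lambda>x. if x \<in> \<Omega> then w x * cutoff e x else 0"
  have C1: "C_diff 1 \<Omega> (\<lambda>x. w x * cutoff e x)" by (rule C_diff_mult[OF open_\<Omega> w cutoff_C1])
  have f0: "?f x = 0" if "x \<notin> ?K" for x using that cutoff_zero[of x e] by auto
  have "C_diff 1 UNIV ?f"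
    by (rule C_diff_zero_extension[OF open_\<Omega> C1 K]) (auto simp: cutoff_zero)
  from C1_approx_by_test[OF this K _ f0 open_\<Omega> e]
  obtain \<eta> where \<eta>: "\<eta> \<in> test_functions \<Omega>" "\<And>x. \<bar>?f x - \<eta> x\<bar> \<le> e"
    "\<And>x b. b \<in> Basis \<Longrightarrow> \<bar>partial b ?f x - partial b \<eta> x\<bar> \<le> e" by auto
  have wd': "w differentiable (at x)" "cutoff e differentiable (at x)" if "x \<in> \<Omega>" for x
    using w cutoff_C1[of e] open_\<Omega> that by (auto simp: differentiable_on_eq_differentiable_at)
  show thesis
  proof (rule that[OF \<eta>(1)])
    fix x assume x: "x \<in> \<Omega>"
    note c = cutoff_bounds[OF e x]
    have "\<bar>w x - w x * cutoff e x\<bar> = \<bar>w x\<bar> * (1 - cutoff e x)"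
      using c by (simp add: right_diff_distrib[of "w x" 1, simplified, symmetric] abs_mult)
    also have "\<dots> \<le> B * (1 - cutoff e x)" using c by (intro mult_right_mono wB x) auto
    finally show "\<bar>w x - \<eta> x\<bar> \<le> B * (1 - cutoff e x) + e" using \<eta>(2)[of x] x by auto
    have gf: "grad ?f x = w x *\<^sub>R grad (cutoff e) x + cutoff e x *\<^sub>R grad w x"
    proof -
      have "grad ?f x = grad (\<lambda>x. w x * cutoff e x) x" by (rule grad_cong[OF open_\<Omega> x]) simp
      also have "\<dots> = w x *\<^sub>R grad (cutoff e) x + cutoff e x *\<^sub>R grad w x"
        by (simp add: grad_def partial_mult[OF wd'[OF x]] scaleR_sum_right sum.distrib scaleR_add_left mult.commute)
      finally show ?thesis .
    qed
    have 1: "norm (grad ?f x - grad \<eta> x) \<le> DIM('a) * e"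
    proof -
      have "norm (grad ?f x - grad \<eta> x) \<le> (\<Sum>b\<in>Basis. \<bar>(grad ?f x - grad \<eta> x) \<bullet> b\<bar>)" by (rule norm_le_l1)
      also have "\<dots> \<le> (\<Sum>b\<in>(Basis :: 'a set). e)"
        using \<eta>(3) by (intro sum_mono) (simp add: inner_diff_left)
      finally show ?thesis by simp
    qed
    have 2: "norm (grad w x - grad ?f x) \<le> G * (1 - cutoff e x) + 2 * C * D * min 1 (e / d x)"
    proof -
      have "grad w x - grad ?f x = (1 - cutoff e x) *\<^sub>R grad w x - w x *\<^sub>R grad (cutoff e) x"
        unfolding gf by (simp add: algebra_simps)
      then have "norm (grad w x - grad ?f x) \<le> norm ((1 - cutoff e x) *\<^sub>R grad w x) + norm (w x *\<^sub>R grad (cutoff e) x)"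
        by (metis norm_triangle_ineq4)
      also have "norm ((1 - cutoff e x) *\<^sub>R grad w x) \<le> G * (1 - cutoff e x)"
        using c wG[OF x] by (simp add: mult.commute mult_right_mono)
      also have "norm (w x *\<^sub>R grad (cutoff e) x) \<le> 2 * C * D * min 1 (e / d x)"
      proof -
        have "0 \<le> C * d x" using wd[OF x] abs_ge_zero[of "w x"] by linarith
        then have C0: "0 \<le> C" using d_pos[OF x] by (simp add: zero_le_mult_iff)
        have "norm (w x *\<^sub>R grad (cutoff e) x) \<le> (C * d x) * norm (grad (cutoff e) x)"
          using wd[OF x] by (simp add: mult_right_mono)
        also have "\<dots> = C * (d x * norm (grad (cutoff e) x))" by simp
        also have "\<dots> \<le> C * (2 * D * min 1 (e / d x))"
          by (rule mult_left_mono[OF norm_grad_cutoff_le[OF x e] C0])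
        finally show ?thesis by (simp add: mult.assoc mult.left_commute)
      qed
      finally show ?thesis by simp
    qed
    show "norm (grad w x - grad \<eta> x) \<le> G * (1 - cutoff e x) + 2 * C * D * min 1 (e / d x) + DIM('a) * e"
      using norm_triangle_ineq[of "grad w x - grad ?f x" "grad ?f x - grad \<eta> x"] 1 2 by simp
  qed
qed

lemma H1_0_if_vanishing:
  assumes w: "C_diff 1 \<Omega> w" and K: "\<And>e. e > 0 \<Longrightarrow> compact {x \<in> \<Omega>. e \<le> d x}" and "bounded \<Omega>" "\<Omega> \<noteq> {}"
    and wd: "\<And>x. x \<in> \<Omega> \<Longrightarrow> \<bar>w x\<bar> \<le> C * d x" and wB: "\<And>x. x \<in> \<Omega> \<Longrightarrow> \<bar>w x\<bar> \<le> B"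
    and wG: "\<And>x. x \<in> \<Omega> \<Longrightarrow> norm (grad w x) \<le> G"
  shows "w \<in> H1_0 \<Omega>"
proof -
  obtain x0 where x0: "x0 \<in> \<Omega>" using assms(4) by blast
  have B0: "0 \<le> B" using wB[OF x0] abs_ge_zero[of "w x0"] by linarith
  have G0: "0 \<le> G" using wG[OF x0] norm_ge_zero[of "grad w x0"] by linarith
  have D0: "0 \<le> D" using grad_le[OF x0] norm_ge_zero[of "grad d x0"] by linarith
  have "0 \<le> C * d x0" using wd[OF x0] abs_ge_zero[of "w x0"] by linarith
  then have C0: "0 \<le> C" using d_pos[OF x0] by (simp add: zero_le_mult_iff)
  have wm: "w \<in> borel_measurable (lebesgue_on \<Omega>)" "grad w \<in> borel_measurable (lebesgue_on \<Omega>)"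
    using w open_\<Omega> C_diff_continuous_on[OF w]
    by (auto intro!: continuous_imp_measurable_on_sets_lebesgue continuous_on_grad)
  have sq: "square_integrable \<Omega> w" "square_integrable \<Omega> (grad w)"
    using bounded_square_integrable[OF open_\<Omega> assms(3) wm(1), of B]
      bounded_square_integrable[OF open_\<Omega> assms(3) wm(2), of G] wB wG by auto
  define e where "e n = 1 / (real n + 1)" for n
  have e: "0 < e n" "e n \<le> 1" for n by (auto simp: e_def)
  have e0: "e \<longlonglongrightarrow> 0"
    using LIMSEQ_Suc[OF lim_1_over_n[where 'a=real]] by (simp add: e_def[abs_def] add.commute)
  have "\<exists>\<eta>. \<eta> \<in> test_functions \<Omega> \<and>
    (\<forall>x\<in>\<Omega>. \<bar>w x - \<eta> x\<bar> \<le> B * (1 - cutoff (e n) x) + e n) \<and>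
    (\<forall>x\<in>\<Omega>. norm (grad w x - grad \<eta> x) \<le> G * (1 - cutoff (e n) x) + 2 * C * D * min 1 (e n / d x) + DIM('a) * e n)" for n
  proof (rule test_near_cutoff[where w=w and e="e n" and C=C and B=B and G=G])
    fix \<eta> assume "\<eta> \<in> test_functions \<Omega>"
      "\<And>x. x \<in> \<Omega> \<Longrightarrow> \<bar>w x - \<eta> x\<bar> \<le> B * (1 - cutoff (e n) x) + e n"
      "\<And>x. x \<in> \<Omega> \<Longrightarrow> norm (grad w x - grad \<eta> x) \<le> G * (1 - cutoff (e n) x) + 2 * C * D * min 1 (e n / d x) + DIM('a) * e n"
    then show ?thesis by blast
  qed (use w K[OF e(1)] e(1) wd wB wG in auto)
  then obtain \<eta> where \<eta>: "\<And>n. \<eta> n \<in> test_functions \<Omega>"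
    "\<And>n x. x \<in> \<Omega> \<Longrightarrow> \<bar>w x - \<eta> n x\<bar> \<le> B * (1 - cutoff (e n) x) + e n"
    "\<And>n x. x \<in> \<Omega> \<Longrightarrow> norm (grad w x - grad (\<eta> n) x) \<le> G * (1 - cutoff (e n) x) + 2 * C * D * min 1 (e n / d x) + DIM('a) * e n"
    by metis
  have "(\<lambda>n. energy \<Omega> (\<lambda>x. w x - \<eta> n x) (\<lambda>x. grad w x - grad (\<eta> n) x)) \<longlonglongrightarrow> (LINT x|lebesgue_on \<Omega>. 0)"
    unfolding energy_def
  proof (rule integral_dominated_convergence[where w="\<lambda>_. (B + 1)\<^sup>2 + (G + 2 * C * D + DIM('a))\<^sup>2"])
    show "(\<lambda>x. (w x - \<eta> n x)\<^sup>2 + (norm (grad w x - grad (\<eta> n) x))\<^sup>2) \<in> borel_measurable (lebesgue_on \<Omega>)" for n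
      using wm test_square_integrable[OF open_\<Omega> \<eta>(1)[of n]] by (auto simp: square_integrable_def)
    show "AE x in lebesgue_on \<Omega>. (\<lambda>n. (w x - \<eta> n x)\<^sup>2 + (norm (grad w x - grad (\<eta> n) x))\<^sup>2) \<longlonglongrightarrow> 0"
    proof (rule AE_I2)
      fix x assume "x \<in> space (lebesgue_on \<Omega>)"
      then have x: "x \<in> \<Omega>" by simp
      have c: "(\<lambda>n. cutoff (e n) x) \<longlonglongrightarrow> (max 0 (1 - 0 * inverse (d x)))\<^sup>2"
        unfolding cutoff_def by (intro tendsto_intros tendsto_max e0)
      have l1: "(\<lambda>n. B * (1 - cutoff (e n) x) + e n) \<longlonglongrightarrow> B * (1 - (max 0 (1 - 0 * inverse (d x)))\<^sup>2) + 0"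
        by (intro tendsto_intros c e0)
      have 1: "(\<lambda>n. w x - \<eta> n x) \<longlonglongrightarrow> 0"
      proof (rule Lim_null_comparison)
        show "\<forall>\<^sub>F n in sequentially. norm (w x - \<eta> n x) \<le> B * (1 - cutoff (e n) x) + e n"
          using \<eta>(2)[OF x] by simp
      qed (use l1 in simp)
      have l2: "(\<lambda>n. G * (1 - cutoff (e n) x) + 2 * C * D * min 1 (e n / d x) + DIM('a) * e n)
          \<longlonglongrightarrow> G * (1 - (max 0 (1 - 0 * inverse (d x)))\<^sup>2) + 2 * C * D * min 1 (0 / d x) + DIM('a) * 0"
        using d_pos[OF x] e0 by (intro tendsto_intros tendsto_min c e0) auto
      have 2: "(\<lambda>n. grad w x - grad (\<eta> n) x) \<longlonglongrightarrow> 0"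
      proof (rule Lim_null_comparison)
        show "\<forall>\<^sub>F n in sequentially. norm (grad w x - grad (\<eta> n) x)
            \<le> G * (1 - cutoff (e n) x) + 2 * C * D * min 1 (e n / d x) + DIM('a) * e n"
          using \<eta>(3)[OF x] by simp
      qed (use l2 in simp)
      have "(\<lambda>n. (w x - \<eta> n x)\<^sup>2 + (norm (grad w x - grad (\<eta> n) x))\<^sup>2) \<longlonglongrightarrow> 0\<^sup>2 + (norm (0::'a))\<^sup>2"
        by (intro tendsto_intros 1 2)
      then show "(\<lambda>n. (w x - \<eta> n x)\<^sup>2 + (norm (grad w x - grad (\<eta> n) x))\<^sup>2) \<longlonglongrightarrow> 0" by simp
    qed
    show "AE x in lebesgue_on \<Omega>. norm ((w x - \<eta> n x)\<^sup>2 + (norm (grad w x - grad (\<eta> n) x))\<^sup>2)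
        \<le> (B + 1)\<^sup>2 + (G + 2 * C * D + DIM('a))\<^sup>2" for n
    proof (rule AE_I2)
      fix x assume "x \<in> space (lebesgue_on \<Omega>)"
      then have x: "x \<in> \<Omega>" by simp
      note c = cutoff_bounds[OF e(1)[of n] x]
      have "B * (1 - cutoff (e n) x) \<le> B * 1" "G * (1 - cutoff (e n) x) \<le> G * 1"
        "2 * C * D * min 1 (e n / d x) \<le> 2 * C * D * 1" "real DIM('a) * e n \<le> real DIM('a) * 1"
        using c B0 G0 C0 D0 e(2)[of n] by (intro mult_left_mono; simp)+
      then have "\<bar>w x - \<eta> n x\<bar> \<le> B + 1" "norm (grad w x - grad (\<eta> n) x) \<le> G + 2 * C * D + DIM('a)"
        using \<eta>(2)[OF x, of n] \<eta>(3)[OF x, of n] e(2)[of n] by linarith+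
      then have "\<bar>w x - \<eta> n x\<bar>\<^sup>2 \<le> (B + 1)\<^sup>2" "(norm (grad w x - grad (\<eta> n) x))\<^sup>2 \<le> (G + 2 * C * D + DIM('a))\<^sup>2"
        by (intro power_mono abs_ge_zero norm_ge_zero; simp)+
      then show "norm ((w x - \<eta> n x)\<^sup>2 + (norm (grad w x - grad (\<eta> n) x))\<^sup>2) \<le> (B + 1)\<^sup>2 + (G + 2 * C * D + DIM('a))\<^sup>2"
        by simp
    qed
    show "integrable (lebesgue_on \<Omega>) (\<lambda>_. (B + 1)\<^sup>2 + (G + 2 * C * D + DIM('a))\<^sup>2)"
      by (rule integrable_const_bounded[OF open_\<Omega> assms(3)])
  qed auto
  then have lim: "(\<lambda>n. energy \<Omega> (\<lambda>x. w x - \<eta> n x) (\<lambda>x. grad w x - grad (\<eta> n) x)) \<longlonglongrightarrow> 0" by simp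
  show ?thesis
  proof (rule H1_0_I[OF open_\<Omega> sq(1) has_weak_gradient_grad[OF open_\<Omega> w] sq(2)])
    fix \<epsilon>' :: real assume "\<epsilon>' > 0"
    then have "\<forall>\<^sub>F n in sequentially. energy \<Omega> (\<lambda>x. w x - \<eta> n x) (\<lambda>x. grad w x - grad (\<eta> n) x) < \<epsilon>'"
      using order_tendstoD(2)[OF lim] by blast
    then obtain n where "energy \<Omega> (\<lambda>x. w x - \<eta> n x) (\<lambda>x. grad w x - grad (\<eta> n) x) < \<epsilon>'"
      using eventually_happens'[OF sequentially_bot] by blast
    then show "\<exists>\<eta>\<in>test_functions \<Omega>. energy \<Omega> (\<lambda>x. w x - \<eta> x) (\<lambda>x. grad w x - grad \<eta> x) < \<epsilon>'"
      using \<eta>(1) by blast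
  qed
qed

end

section \<open>The weak Euler--Lagrange equation\<close>

lemma mult_le_weighted_squares: "a * b \<le> t * a\<^sup>2 + b\<^sup>2 / t" if "t > 0" for a b t :: real
proof -
  have "0 \<le> (t * a - b)\<^sup>2 + (t * a)\<^sup>2 + b\<^sup>2" by simp
  then have "2 * (t * (a * b)) \<le> 2 * (t * (t * a\<^sup>2 + b\<^sup>2 / t))"
    using that by (simp add: power2_eq_square algebra_simps)
  then show ?thesis using that by simp
qed

lemma abs_exp_minus_1_le: "\<bar>exp t - 1\<bar> \<le> \<bar>t\<bar> * exp \<bar>t\<bar>" for t :: real
proof (cases "0 \<le> t")
  case True
  have "(1 - t) * exp t \<le> exp (- t) * exp t"
    using exp_ge_add_one_self[of "- t"] by (intro mult_right_mono) auto
  then have "exp t - 1 \<le> t * exp t" by (simp add: exp_minus algebra_simps)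
  then show ?thesis using True by simp
next
  case False
  then have "exp t \<le> 1" by simp
  then have "\<bar>exp t - 1\<bar> \<le> \<bar>t\<bar> * 1" using False exp_ge_add_one_self[of t] by linarith
  also have "\<dots> \<le> \<bar>t\<bar> * exp \<bar>t\<bar>" by (intro mult_left_mono) auto
  finally show ?thesis .
qed

text \<open>Strictness of \<open>1 + t \<le> e\<^sup>t\<close>, from \<open>e\<^sup>t = (e\<^sup>t\<^sup>/\<^sup>2)\<^sup>2 \<ge> (1 + t/2)\<^sup>2\<close> when \<open>1 + t/2 \<ge> 0\<close>.\<close>

lemma exp_taylor2_eq_0: "exp t - 1 - t = 0 \<Longrightarrow> t = 0" for t :: real
proof (cases "0 \<le> 1 + t / 2")
  case True
  assume *: "exp t - 1 - t = 0"
  have "(1 + t / 2)\<^sup>2 \<le> (exp (t / 2))\<^sup>2" using True exp_ge_add_one_self[of "t / 2"] by (intro power_mono)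
  also have "(exp (t / 2))\<^sup>2 = exp t" by (simp add: power2_eq_square exp_add[symmetric])
  finally have "t\<^sup>2 / 4 \<le> 0" using * by (simp add: power2_eq_square algebra_simps)
  then show "t = 0" by simp
next
  case False
  assume "exp t - 1 - t = 0"
  then show "t = 0" using False exp_gt_zero[of t] by linarith
qed

lemma C2_partial_C1: "C_diff 2 U f \<Longrightarrow> b \<in> Basis \<Longrightarrow> C_diff 1 U (partial b f)"
  by (simp add: numeral_2_eq_2)

lemma C2_laplacian_continuous: "C_diff 2 U f \<Longrightarrow> continuous_on U (laplacian f)"
  unfolding laplacian_def[abs_def] by (intro continuous_intros) (simp add: numeral_2_eq_2)

lemma laplacian_diff:
  assumes "open U" "C_diff 2 U f" "C_diff 2 U g" "x \<in> U" "\<And>y. y \<in> U \<Longrightarrow> k y = f y - g y"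
  shows "laplacian k x = laplacian f x - laplacian g x"
proof -
  have d1: "f differentiable (at y)" "g differentiable (at y)" if "y \<in> U" for y
    using C_diff_le[of 1 2, OF _ assms(2)] C_diff_le[of 1 2, OF _ assms(3)] assms(1) that
    by (auto simp: differentiable_on_eq_differentiable_at)
  have d2: "partial b f differentiable (at x)" "partial b g differentiable (at x)" if "b \<in> Basis" for b
    using C2_partial_C1[OF assms(2) that] C2_partial_C1[OF assms(3) that] assms(1,4)
    by (auto simp: differentiable_on_eq_differentiable_at)
  have "partial b (partial b k) x = partial b (partial b f) x - partial b (partial b g) x" if "b \<in> Basis" for b
  proof -
    have "partial b k y = partial b f y - partial b g y" if "y \<in> U" for y
      using partial_cong[OF assms(1) that assms(5)] partial_diff[OF d1[OF that]] by simp
    then have "partial b (partial b k) x = partial b (\<lambda>y. partial b f y - partial b g y) x"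
      by (rule partial_cong[OF assms(1,4)])
    then show ?thesis using partial_diff[OF d2[OF that]] by simp
  qed
  then show ?thesis by (simp add: laplacian_def sum_subtractf)
qed

context boundary_function
begin

text \<open>The left-hand side is continuous in \<open>h\<close> with respect to the energy: the first term because \<open>\<nabla>w\<close> is bounded, the
  second one because \<open>\<Delta>w\<close> is at most \<open>C/d\<close> and \<open>h/d\<close> obeys Hardy's inequality. It vanishes
  for test functions.\<close>

lemma euler_lagrange_test:
  assumes w: "C_diff 2 \<Omega> w" and \<eta>: "\<eta> \<in> test_functions \<Omega>"
  shows "integrable (lebesgue_on \<Omega>) (\<lambda>x. grad w x \<bullet> grad \<eta> x + laplacian w x * \<eta> x)"
    and "(LINT x|lebesgue_on \<Omega>. grad w x \<bullet> grad \<eta> x + laplacian w x * \<eta> x) = 0"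
proof -
  obtain K where K: "compact K" "K \<subseteq> \<Omega>" "\<And>x. x \<notin> K \<Longrightarrow> \<eta> x = 0"
    using test_functionsE[OF \<eta>] by blast
  have cw: "continuous_on \<Omega> (partial b w)" "continuous_on \<Omega> (partial b (partial b w))" if "b \<in> Basis" for b
    using C2_partial_C1[OF w that] C_diff_continuous_on[OF C2_partial_C1[OF w that]] that by auto
  have i: "integrable (lebesgue_on \<Omega>) (\<lambda>x. partial b w x * partial b \<eta> x)"
    "integrable (lebesgue_on \<Omega>) (\<lambda>x. partial b (partial b w) x * \<eta> x)" if "b \<in> Basis" for b
    by (intro integrable_mult_partial_test[OF open_\<Omega> _ \<eta> that] integrable_mult_test[OF open_\<Omega> _ \<eta>]
        continuous_locally_integrable cw that)+
  have eq: "grad w x \<bullet> grad \<eta> x + laplacian w x * \<eta> x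
      = (\<Sum>b\<in>Basis. partial b w x * partial b \<eta> x + partial b (partial b w) x * \<eta> x)" for x
    by (simp add: inner_grad laplacian_def sum.distrib sum_distrib_right)
  show "integrable (lebesgue_on \<Omega>) (\<lambda>x. grad w x \<bullet> grad \<eta> x + laplacian w x * \<eta> x)"
    unfolding eq using i by auto
  have "(LINT x|lebesgue_on \<Omega>. partial b w x * partial b \<eta> x + partial b (partial b w) x * \<eta> x) = 0"
    if "b \<in> Basis" for b
    using integral_by_parts[OF open_\<Omega> C2_partial_C1[OF w that] test_functions_C_diff[OF \<eta>] K(1,2) _ that] K(3)
      Bochner_Integration.integral_add[OF i[OF that]] by simp
  then show "(LINT x|lebesgue_on \<Omega>. grad w x \<bullet> grad \<eta> x + laplacian w x * \<eta> x) = 0"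
    unfolding eq using i by (subst Bochner_Integration.integral_sum) auto
qed

lemma euler_lagrange:
  assumes bnd: "bounded \<Omega>" and w: "C_diff 2 \<Omega> w" and wG: "\<And>x. x \<in> \<Omega> \<Longrightarrow> norm (grad w x) \<le> G"
    and lap: "\<And>x. x \<in> \<Omega> \<Longrightarrow> \<bar>laplacian w x\<bar> \<le> C / d x" and h: "h \<in> H1_0 \<Omega>"
  shows "integrable (lebesgue_on \<Omega>) (\<lambda>x. grad w x \<bullet> weak_gradient \<Omega> h x + laplacian w x * h x)"
    and "(LINT x|lebesgue_on \<Omega>. grad w x \<bullet> weak_gradient \<Omega> h x + laplacian w x * h x) = 0"
proof -
  note H = H1_0_D[OF open_\<Omega> h]
  have wm [measurable]: "grad w \<in> borel_measurable (lebesgue_on \<Omega>)" "laplacian w \<in> borel_measurable (lebesgue_on \<Omega>)"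
    using open_\<Omega> C_diff_continuous_on[OF C2_partial_C1[OF w]] C2_laplacian_continuous[OF w]
    by (auto intro!: continuous_imp_measurable_on_sets_lebesgue continuous_on_grad)
  have pointwise: "\<bar>grad w x \<bullet> F + laplacian w x * f\<bar> \<le> t * (G\<^sup>2 + C\<^sup>2) + ((norm F)\<^sup>2 + (f / d x)\<^sup>2) / t"
    if "x \<in> \<Omega>" "t > 0" for x t f F
  proof -
    have "\<bar>grad w x \<bullet> F\<bar> \<le> norm (grad w x) * norm F" by (rule Cauchy_Schwarz_ineq2)
    also have "\<dots> \<le> G * norm F" by (intro mult_right_mono wG that) simp
    also have "\<dots> \<le> t * G\<^sup>2 + (norm F)\<^sup>2 / t" by (rule mult_le_weighted_squares[OF that(2)])
    finally have 1: "\<bar>grad w x \<bullet> F\<bar> \<le> t * G\<^sup>2 + (norm F)\<^sup>2 / t" .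
    have "\<bar>laplacian w x * f\<bar> \<le> C / d x * \<bar>f\<bar>"
      unfolding abs_mult by (intro mult_right_mono lap that) simp
    also have "\<dots> = C * \<bar>f / d x\<bar>" using d_pos[OF that(1)] by simp
    also have "\<dots> \<le> t * C\<^sup>2 + \<bar>f / d x\<bar>\<^sup>2 / t" by (rule mult_le_weighted_squares[OF that(2)])
    finally have 2: "\<bar>laplacian w x * f\<bar> \<le> t * C\<^sup>2 + (f / d x)\<^sup>2 / t" unfolding power2_abs .
    have "\<bar>grad w x \<bullet> F + laplacian w x * f\<bar> \<le> (t * G\<^sup>2 + (norm F)\<^sup>2 / t) + (t * C\<^sup>2 + (f / d x)\<^sup>2 / t)"
      using abs_triangle_ineq[of "grad w x \<bullet> F" "laplacian w x * f"] 1 2 by linarith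
    also have "\<dots> = t * (G\<^sup>2 + C\<^sup>2) + ((norm F)\<^sup>2 + (f / d x)\<^sup>2) / t"
      by (simp add: distrib_left add_divide_distrib)
    finally show ?thesis .
  qed
  define V where "V = (LINT x|lebesgue_on \<Omega>. G\<^sup>2 + C\<^sup>2)"
  have iV: "integrable (lebesgue_on \<Omega>) (\<lambda>x. G\<^sup>2 + C\<^sup>2)" by (rule integrable_const_bounded[OF open_\<Omega> bnd])
  have est: "integrable (lebesgue_on \<Omega>) (\<lambda>x. grad w x \<bullet> F x + laplacian w x * f x)"
    "\<bar>LINT x|lebesgue_on \<Omega>. grad w x \<bullet> F x + laplacian w x * f x\<bar> \<le> t * V + (energy \<Omega> f F + hardy_const * s) / t"
    if "f \<in> H1_0 \<Omega>" "square_integrable \<Omega> F" "s > 0" "energy \<Omega> f (weak_gradient \<Omega> f) \<le> s / 4" "t > 0" for f F s t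
  proof -
    have [measurable]: "f \<in> borel_measurable (lebesgue_on \<Omega>)" "F \<in> borel_measurable (lebesgue_on \<Omega>)"
      using H1_0_D(1)[OF open_\<Omega> that(1)] that(2) by (auto simp: square_integrable_def)
    note hd = hardy_H1_0[OF that(1,3,4)]
    have iF: "integrable (lebesgue_on \<Omega>) (\<lambda>x. (norm (F x))\<^sup>2)" using that(2) by (simp add: square_integrable_def)
    have if2: "integrable (lebesgue_on \<Omega>) (\<lambda>x. (f x)\<^sup>2 + (norm (F x))\<^sup>2)"
      using iF H1_0_D(1)[OF open_\<Omega> that(1)] by (simp add: square_integrable_def)
    have i: "integrable (lebesgue_on \<Omega>) (\<lambda>x. t * (G\<^sup>2 + C\<^sup>2) + ((norm (F x))\<^sup>2 + (f x / d x)\<^sup>2) / t)"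
      by (intro Bochner_Integration.integrable_add integrable_mult_right iV integrable_divide_zero iF hd(1)) 
    have le: "\<bar>grad w x \<bullet> F x + laplacian w x * f x\<bar> \<le> t * (G\<^sup>2 + C\<^sup>2) + ((norm (F x))\<^sup>2 + (f x / d x)\<^sup>2) / t"
      if "x \<in> space (lebesgue_on \<Omega>)" for x using pointwise[of x t "F x" "f x"] that \<open>t > 0\<close> by simp
    show i': "integrable (lebesgue_on \<Omega>) (\<lambda>x. grad w x \<bullet> F x + laplacian w x * f x)"
    proof (rule Bochner_Integration.integrable_bound[OF i])
      show "AE x in lebesgue_on \<Omega>. norm (grad w x \<bullet> F x + laplacian w x * f x)
          \<le> norm (t * (G\<^sup>2 + C\<^sup>2) + ((norm (F x))\<^sup>2 + (f x / d x)\<^sup>2) / t)"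
        using order_trans[OF le abs_ge_self] by (intro AE_I2) (simp only: real_norm_def)
    qed measurable
    have "\<bar>LINT x|lebesgue_on \<Omega>. grad w x \<bullet> F x + laplacian w x * f x\<bar>
        \<le> (LINT x|lebesgue_on \<Omega>. \<bar>grad w x \<bullet> F x + laplacian w x * f x\<bar>)" by (rule integral_abs_bound)
    also have "\<dots> \<le> (LINT x|lebesgue_on \<Omega>. t * (G\<^sup>2 + C\<^sup>2) + ((norm (F x))\<^sup>2 + (f x / d x)\<^sup>2) / t)"
      by (rule Bochner_Integration.integral_mono[OF integrable_abs[OF i'] i le])
    also have "\<dots> = t * V + ((LINT x|lebesgue_on \<Omega>. (norm (F x))\<^sup>2) + (LINT x|lebesgue_on \<Omega>. (f x / d x)\<^sup>2)) / t"
    proof -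
      have "(LINT x|lebesgue_on \<Omega>. t * (G\<^sup>2 + C\<^sup>2) + ((norm (F x))\<^sup>2 + (f x / d x)\<^sup>2) / t)
          = (LINT x|lebesgue_on \<Omega>. t * (G\<^sup>2 + C\<^sup>2)) + (LINT x|lebesgue_on \<Omega>. ((norm (F x))\<^sup>2 + (f x / d x)\<^sup>2) / t)"
        by (intro Bochner_Integration.integral_add integrable_mult_right iV integrable_divide_zero
            Bochner_Integration.integrable_add iF hd(1))
      then show ?thesis
        unfolding V_def integral_mult_right_zero integral_divide_zero Bochner_Integration.integral_add[OF iF hd(1)] .
    qed
    also have "\<dots> \<le> t * V + (energy \<Omega> f F + hardy_const * s) / t"
    proof -
      have "(LINT x|lebesgue_on \<Omega>. (norm (F x))\<^sup>2) \<le> energy \<Omega> f F"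
        unfolding energy_def by (rule Bochner_Integration.integral_mono[OF iF if2]) simp
      then show ?thesis using hd(2) that(5) by (intro add_left_mono divide_right_mono add_mono) auto
    qed
    finally show "\<bar>LINT x|lebesgue_on \<Omega>. grad w x \<bullet> F x + laplacian w x * f x\<bar>
        \<le> t * V + (energy \<Omega> f F + hardy_const * s) / t" .
  qed
  define s0 where "s0 = 4 * energy \<Omega> h (weak_gradient \<Omega> h) + 1"
  have s0: "s0 > 0" "energy \<Omega> h (weak_gradient \<Omega> h) \<le> s0 / 4"
    using energy_nonneg[of \<Omega> h "weak_gradient \<Omega> h"] by (simp_all add: s0_def)
  let ?L = "LINT x|lebesgue_on \<Omega>. grad w x \<bullet> weak_gradient \<Omega> h x + laplacian w x * h x"
  show ih: "integrable (lebesgue_on \<Omega>) (\<lambda>x. grad w x \<bullet> weak_gradient \<Omega> h x + laplacian w x * h x)"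
    by (rule est(1)[OF h H(3) s0 zero_less_one])
  have "\<bar>?L\<bar> \<le> t * (V + 1 + 4 * hardy_const)" if t: "t > 0" for t
  proof -
    \<comment> \<open>Errors of energy \<open>t\<^sup>2\<close> balance the weight \<open>t\<close> in the estimate, and all terms are of order \<open>t\<close>.\<close>
    have "0 < t\<^sup>2" using t by simp
    from H1_0_approx[OF open_\<Omega> h this] obtain \<eta> where \<eta>: "\<eta> \<in> test_functions \<Omega>"
      "energy \<Omega> (\<lambda>x. h x - \<eta> x) (\<lambda>x. weak_gradient \<Omega> h x - grad \<eta> x) < t\<^sup>2" by blast
    have e: "energy \<Omega> (\<lambda>x. h x - \<eta> x) (weak_gradient \<Omega> (\<lambda>x. h x - \<eta> x)) \<le> 4 * t\<^sup>2 / 4"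
      unfolding energy_weak_gradient_diff[OF open_\<Omega> h \<eta>(1)] using \<eta>(2) by simp
    have "?L = ?L - (LINT x|lebesgue_on \<Omega>. grad w x \<bullet> grad \<eta> x + laplacian w x * \<eta> x)"
      using euler_lagrange_test(2)[OF w \<eta>(1)] by simp
    also have "\<dots> = (LINT x|lebesgue_on \<Omega>. (grad w x \<bullet> weak_gradient \<Omega> h x + laplacian w x * h x)
        - (grad w x \<bullet> grad \<eta> x + laplacian w x * \<eta> x))"
      by (rule Bochner_Integration.integral_diff[OF ih euler_lagrange_test(1)[OF w \<eta>(1)], symmetric])
    also have "\<dots> = (LINT x|lebesgue_on \<Omega>. grad w x \<bullet> (weak_gradient \<Omega> h x - grad \<eta> x) + laplacian w x * (h x - \<eta> x))"
      by (simp add: inner_diff_right algebra_simps)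
    also have "\<bar>\<dots>\<bar> \<le> t * V + (energy \<Omega> (\<lambda>x. h x - \<eta> x) (\<lambda>x. weak_gradient \<Omega> h x - grad \<eta> x) + hardy_const * (4 * t\<^sup>2)) / t"
      using t by (intro est(2)[OF _ _ _ e] H1_0_diff[OF open_\<Omega> h] H1_0_test[OF open_\<Omega> \<eta>(1)]
          square_integrable_diff H(3) test_square_integrable[OF open_\<Omega> \<eta>(1)]) auto
    also have "\<dots> \<le> t * V + (t\<^sup>2 + hardy_const * (4 * t\<^sup>2)) / t"
      using \<eta>(2) t by (intro add_left_mono divide_right_mono add_right_mono) auto
    also have "\<dots> = t * (V + 1 + 4 * hardy_const)" using t by (simp add: field_simps power2_eq_square)
    finally show ?thesis .
  qed
  then have le: "\<bar>?L\<bar> \<le> t * (V + 1 + 4 * hardy_const)" if "t \<in> {0<..<1}" for t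
    using that by simp
  have "\<forall>\<^sub>F t in at_right (0::real). t \<in> {0<..<1}"
    by (rule eventually_at_right_real) simp
  then have "\<forall>\<^sub>F t in at_right 0. \<bar>?L\<bar> \<le> t * (V + 1 + 4 * hardy_const)"
    by (rule eventually_mono) (rule le)
  moreover have "((\<lambda>t. t * (V + 1 + 4 * hardy_const)) \<longlongrightarrow> 0 * (V + 1 + 4 * hardy_const)) (at_right 0)"
    by (intro tendsto_intros)
  ultimately have "\<bar>?L\<bar> \<le> 0 * (V + 1 + 4 * hardy_const)"
    by (intro tendsto_lowerbound[OF _ _ trivial_limit_at_right_real])
  then show "?L = 0" by simp
qed

end

section \<open>Expansion of the functional\<close>

context planar_boundary_function
begin

text \<open>The exponential term is a bounded multiple of \<open>(e\<^sup>2\<^sup>\<phi> - 1 - 2\<phi>)/d\<^sup>2\<close>, and the linear term is at most a constant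
  times \<open>|\<phi>/d|\<close>, which is square integrable.\<close>

lemma R_integrable:
  assumes bnd: "bounded \<Omega>" and vm: "v \<in> borel_measurable (lebesgue_on \<Omega>)"
    and rm: "liouville_residual v \<in> borel_measurable (lebesgue_on \<Omega>)"
    and ev: "\<And>x. x \<in> \<Omega> \<Longrightarrow> exp (v x) \<le> Cv / d x"
    and rv: "\<And>x. x \<in> \<Omega> \<Longrightarrow> \<bar>liouville_residual v x\<bar> \<le> Cr / d x"
    and \<phi>: "\<phi> \<in> H1_0 \<Omega>"
  shows "integrable (lebesgue_on \<Omega>) (\<lambda>x. (norm (weak_gradient \<Omega> \<phi> x))\<^sup>2
     + 4 * exp (2 * v x) * (exp (2 * \<phi> x) - 1 - 2 * \<phi> x) + 2 * liouville_residual v x * \<phi> x)"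
proof -
  note H = H1_0_D[OF open_\<Omega> \<phi>]
  note vm [measurable] rm [measurable]
  have [measurable]: "\<phi> \<in> borel_measurable (lebesgue_on \<Omega>)" using H(1) by (simp add: square_integrable_def)
  have 1: "integrable (lebesgue_on \<Omega>) (\<lambda>x. (norm (weak_gradient \<Omega> \<phi> x))\<^sup>2)"
    using H(3) by (simp add: square_integrable_def)
  have 2: "integrable (lebesgue_on \<Omega>) (\<lambda>x. 4 * exp (2 * v x) * (exp (2 * \<phi> x) - 1 - 2 * \<phi> x))"
  proof (rule Bochner_Integration.integrable_bound)
    show "integrable (lebesgue_on \<Omega>) (\<lambda>x. 4 * Cv\<^sup>2 * ((exp (2 * \<phi> x) - 1 - 2 * \<phi> x) / (d x)\<^sup>2))"
      by (rule integrable_mult_right[OF exp_integrable[OF \<phi>]])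
    show "AE x in lebesgue_on \<Omega>. norm (4 * exp (2 * v x) * (exp (2 * \<phi> x) - 1 - 2 * \<phi> x))
        \<le> norm (4 * Cv\<^sup>2 * ((exp (2 * \<phi> x) - 1 - 2 * \<phi> x) / (d x)\<^sup>2))"
    proof (rule AE_I2)
      fix x assume "x \<in> space (lebesgue_on \<Omega>)"
      then have x: "x \<in> \<Omega>" by simp
      have E: "0 \<le> exp (2 * \<phi> x) - 1 - 2 * \<phi> x" by (rule exp_taylor2_nonneg)
      have "exp (2 * v x) = (exp (v x))\<^sup>2" by (simp add: power2_eq_square exp_add[symmetric])
      also have "\<dots> \<le> (Cv / d x)\<^sup>2" by (intro power_mono ev x) simp
      finally have "4 * exp (2 * v x) * (exp (2 * \<phi> x) - 1 - 2 * \<phi> x) \<le> 4 * (Cv / d x)\<^sup>2 * (exp (2 * \<phi> x) - 1 - 2 * \<phi> x)"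
        by (intro mult_right_mono[OF _ E]) simp
      also have "\<dots> = 4 * Cv\<^sup>2 * ((exp (2 * \<phi> x) - 1 - 2 * \<phi> x) / (d x)\<^sup>2)" by (simp add: power_divide)
      finally show "norm (4 * exp (2 * v x) * (exp (2 * \<phi> x) - 1 - 2 * \<phi> x))
        \<le> norm (4 * Cv\<^sup>2 * ((exp (2 * \<phi> x) - 1 - 2 * \<phi> x) / (d x)\<^sup>2))"
        using E by (simp add: abs_mult)
    qed
  qed measurable
  have 3: "integrable (lebesgue_on \<Omega>) (\<lambda>x. 2 * liouville_residual v x * \<phi> x)"
  proof (rule Bochner_Integration.integrable_bound)
    define s where "s = 4 * energy \<Omega> \<phi> (weak_gradient \<Omega> \<phi>) + 1"
    have s: "s > 0" "energy \<Omega> \<phi> (weak_gradient \<Omega> \<phi>) \<le> s / 4"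
      using energy_nonneg[of \<Omega> \<phi> "weak_gradient \<Omega> \<phi>"] by (simp_all add: s_def)
    show "integrable (lebesgue_on \<Omega>) (\<lambda>x. 2 * (Cr\<^sup>2 + (\<phi> x / d x)\<^sup>2))"
      by (intro integrable_mult_right Bochner_Integration.integrable_add hardy_H1_0(1)[OF \<phi> s]
          integrable_const_bounded[OF open_\<Omega> bnd])
    show "AE x in lebesgue_on \<Omega>. norm (2 * liouville_residual v x * \<phi> x) \<le> norm (2 * (Cr\<^sup>2 + (\<phi> x / d x)\<^sup>2))"
    proof (rule AE_I2)
      fix x assume "x \<in> space (lebesgue_on \<Omega>)"
      then have x: "x \<in> \<Omega>" by simp
      have "\<bar>liouville_residual v x\<bar> * \<bar>\<phi> x\<bar> \<le> Cr / d x * \<bar>\<phi> x\<bar>"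
        by (intro mult_right_mono rv x) simp
      also have "\<dots> = Cr * \<bar>\<phi> x / d x\<bar>" using d_pos[OF x] by simp
      also have "\<dots> \<le> 1 * Cr\<^sup>2 + \<bar>\<phi> x / d x\<bar>\<^sup>2 / 1" by (rule mult_le_weighted_squares) simp
      finally have "\<bar>liouville_residual v x\<bar> * \<bar>\<phi> x\<bar> \<le> Cr\<^sup>2 + (\<phi> x / d x)\<^sup>2" unfolding power2_abs by simp
      then show "norm (2 * liouville_residual v x * \<phi> x) \<le> norm (2 * (Cr\<^sup>2 + (\<phi> x / d x)\<^sup>2))"
        by (simp add: abs_mult)
    qed
  qed measurable
  show ?thesis by (intro Bochner_Integration.integrable_add 1 2 3)
qed

text \<open>Pointwise, \<open>e\<^sup>2\<^sup>v e\<^sup>2\<^sup>\<phi> = e\<^sup>2\<^sup>u e\<^sup>2\<^sup>h\<close>, and the terms that are linear in \<open>h\<close> add up to \<open>2(\<nabla>w \<bullet> \<nabla>h + h \<Delta>w)\<close>, whose integral is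
  zero by the weak Euler--Lagrange equation. The bound \<open>\<Delta>w = O(1/d)\<close> holds because \<open>|e\<^sup>2\<^sup>w - 1| = O(d)\<close>
  compensates one of the two powers of \<open>1/d\<close> in \<open>e\<^sup>2\<^sup>v\<close>.\<close>

lemma R_expansion:
  assumes bnd: "bounded \<Omega>"
    and u: "C_diff 2 \<Omega> u" "\<And>x. x \<in> \<Omega> \<Longrightarrow> liouville_residual u x = 0"
    and w: "C_diff 2 \<Omega> w" "w \<in> H1_0 \<Omega>"
    and uvw: "\<And>x. x \<in> \<Omega> \<Longrightarrow> u x = v x + w x"
    and wB: "\<And>x. x \<in> \<Omega> \<Longrightarrow> \<bar>w x\<bar> \<le> B" and wd: "\<And>x. x \<in> \<Omega> \<Longrightarrow> \<bar>w x\<bar> \<le> C * d x"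
    and wG: "\<And>x. x \<in> \<Omega> \<Longrightarrow> norm (grad w x) \<le> G"
    and ev: "\<And>x. x \<in> \<Omega> \<Longrightarrow> exp (v x) \<le> Cv / d x"
    and rv: "\<And>x. x \<in> \<Omega> \<Longrightarrow> \<bar>liouville_residual v x\<bar> \<le> Cr / d x"
    and \<phi>: "\<phi> \<in> H1_0 \<Omega>"
  defines "J \<equiv> \<lambda>x. (norm (weak_gradient \<Omega> (\<lambda>x. \<phi> x - w x) x))\<^sup>2
    + 4 * exp (2 * u x) * (exp (2 * (\<phi> x - w x)) - 1 - 2 * (\<phi> x - w x))"
  shows "integrable (lebesgue_on \<Omega>) J" and "R \<Omega> \<phi> v = R \<Omega> w v + (LINT x|lebesgue_on \<Omega>. J x)"
proof -
  define h where "h x = \<phi> x - w x" for x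
  have h: "h \<in> H1_0 \<Omega>" unfolding h_def[abs_def] by (rule H1_0_diff[OF open_\<Omega> \<phi> w(2)])
  have J: "J x = (norm (weak_gradient \<Omega> h x))\<^sup>2 + 4 * exp (2 * u x) * (exp (2 * h x) - 1 - 2 * h x)" for x
    by (simp add: J_def h_def[abs_def])
  note H = H1_0_D[OF open_\<Omega> h] and HW = H1_0_D[OF open_\<Omega> w(2)] and HP = H1_0_D[OF open_\<Omega> \<phi>]
  have v: "v x = u x - w x" if "x \<in> \<Omega>" for x using uvw[OF that] by simp
  have lapv: "laplacian v x = laplacian u x - laplacian w x" if "x \<in> \<Omega>" for x
    by (rule laplacian_diff[OF open_\<Omega> u(1) w(1) that v])
  have lapw: "laplacian w x = liouville_residual v x + 4 * exp (2 * u x) - 4 * exp (2 * v x)" if "x \<in> \<Omega>" for x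
    using u(2)[OF that] lapv[OF that] by (simp add: liouville_residual_def)
  have e2u: "exp (2 * u x) = exp (2 * v x) * exp (2 * w x)" if "x \<in> \<Omega>" for x
    using uvw[OF that] by (simp add: exp_add[symmetric] distrib_left)
  have cont: "continuous_on \<Omega> u" "continuous_on \<Omega> w"
    using C_diff_continuous_on[OF u(1)] C_diff_continuous_on[OF w(1)] by auto
  have cv: "continuous_on \<Omega> v"
    using continuous_on_diff[OF cont] by (rule continuous_on_eq) (simp add: v)
  have "continuous_on \<Omega> (\<lambda>x. - (laplacian u x - laplacian w x) + 4 * exp (2 * v x))"
    by (intro continuous_intros cv C2_laplacian_continuous u(1) w(1))
  then have cr: "continuous_on \<Omega> (liouville_residual v)"
    by (rule continuous_on_eq) (simp add: liouville_residual_def lapv)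
  have m [measurable]: "u \<in> borel_measurable (lebesgue_on \<Omega>)" "v \<in> borel_measurable (lebesgue_on \<Omega>)"
    "liouville_residual v \<in> borel_measurable (lebesgue_on \<Omega>)"
    using open_\<Omega> cont cv cr by (auto intro!: continuous_imp_measurable_on_sets_lebesgue)
  have m' [measurable]: "h \<in> borel_measurable (lebesgue_on \<Omega>)" "weak_gradient \<Omega> h \<in> borel_measurable (lebesgue_on \<Omega>)"
    using H by (auto simp: square_integrable_def)
  have Jm: "J \<in> borel_measurable (lebesgue_on \<Omega>)" unfolding J[abs_def] by measurable
  have lap_bound: "\<bar>laplacian w x\<bar> \<le> (Cr + 8 * Cv\<^sup>2 * C * exp (2 * B)) / d x" if x: "x \<in> \<Omega>" for x
  proof -
    have dx: "d x > 0" by (rule d_pos[OF x])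
    have C0: "0 \<le> C" using order_trans[OF abs_ge_zero wd[OF x]] dx by (simp add: zero_le_mult_iff)
    have "exp (2 * v x) = (exp (v x))\<^sup>2" by (simp add: power2_eq_square exp_add[symmetric])
    also have "\<dots> \<le> (Cv / d x)\<^sup>2" by (intro power_mono ev x) simp
    finally have 1: "exp (2 * v x) \<le> (Cv / d x)\<^sup>2" .
    have "\<bar>exp (2 * w x) - 1\<bar> \<le> \<bar>2 * w x\<bar> * exp \<bar>2 * w x\<bar>" by (rule abs_exp_minus_1_le)
    also have "\<dots> \<le> (2 * (C * d x)) * exp (2 * B)"
      using wd[OF x] wB[OF x] C0 dx by (intro mult_mono) (auto simp: abs_mult)
    finally have 2: "\<bar>exp (2 * w x) - 1\<bar> \<le> 2 * (C * d x) * exp (2 * B)" .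
    have "laplacian w x = liouville_residual v x + 4 * (exp (2 * v x) * (exp (2 * w x) - 1))"
      unfolding lapw[OF x] e2u[OF x] by (simp add: algebra_simps)
    then have "\<bar>laplacian w x\<bar> \<le> \<bar>liouville_residual v x\<bar> + 4 * (exp (2 * v x) * \<bar>exp (2 * w x) - 1\<bar>)"
      using abs_triangle_ineq[of "liouville_residual v x" "4 * (exp (2 * v x) * (exp (2 * w x) - 1))"]
      by (simp add: abs_mult)
    also have "\<dots> \<le> Cr / d x + 4 * ((Cv / d x)\<^sup>2 * (2 * (C * d x) * exp (2 * B)))"
      by (intro add_mono rv x mult_left_mono mult_mono 1 2) auto
    also have "\<dots> = (Cr + 8 * Cv\<^sup>2 * C * exp (2 * B)) / d x"
      using dx by (simp add: field_simps power2_eq_square)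
    finally show ?thesis .
  qed
  note EL = euler_lagrange[OF bnd w(1) wG lap_bound h]
  define I where "I \<psi> x = (norm (weak_gradient \<Omega> \<psi> x))\<^sup>2 + 4 * exp (2 * v x) * (exp (2 * \<psi> x) - 1 - 2 * \<psi> x)
     + 2 * liouville_residual v x * \<psi> x" for \<psi> x
  have iI: "integrable (lebesgue_on \<Omega>) (I \<psi>)" if "\<psi> \<in> H1_0 \<Omega>" for \<psi>
    unfolding I_def[abs_def] by (rule R_integrable[OF bnd m(2,3) ev rv that])
  have RI: "R \<Omega> \<psi> v = (LINT x|lebesgue_on \<Omega>. I \<psi> x)" for \<psi>
    by (simp add: R_def I_def)
  have "AE x in lebesgue_on \<Omega>. weak_gradient \<Omega> w x = grad w x"
    using has_weak_gradient_grad[OF open_\<Omega> C_diff_le[of 1 2, OF _ w(1)]]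
    by (intro weak_gradient_AE[OF open_\<Omega>]) simp
  moreover have "AE x in lebesgue_on \<Omega>. weak_gradient \<Omega> h x = weak_gradient \<Omega> \<phi> x - weak_gradient \<Omega> w x"
    unfolding h_def[abs_def] by (intro weak_gradient_AE has_weak_gradient_diff open_\<Omega> HP(2) HW(2))
  ultimately have expand: "AE x in lebesgue_on \<Omega>. I \<phi> x - I w x
      - 2 * (grad w x \<bullet> weak_gradient \<Omega> h x + laplacian w x * h x) = J x"
    using AE_space
  proof eventually_elim
    case (elim x)
    then have x: "x \<in> \<Omega>" by simp
    have wg: "weak_gradient \<Omega> \<phi> x = grad w x + weak_gradient \<Omega> h x" "weak_gradient \<Omega> w x = grad w x"
      using elim by simp_all
    have n: "(norm (weak_gradient \<Omega> \<phi> x))\<^sup>2 = (norm (grad w x))\<^sup>2 + 2 * (grad w x \<bullet> weak_gradient \<Omega> h x) + (norm (weak_gradient \<Omega> h x))\<^sup>2"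
      unfolding wg by (simp add: power2_norm_eq_inner inner_add_left inner_add_right inner_commute)
    have e: "exp (2 * \<phi> x) = exp (2 * w x) * exp (2 * h x)"
      unfolding exp_add[symmetric] h_def by (simp add: algebra_simps)
    have p: "\<phi> x = w x + h x" by (simp add: h_def)
    show ?case
      unfolding I_def J unfolding n e lapw[OF x] e2u[OF x] wg(2) unfolding p by (simp add: algebra_simps)
  qed
  have iL: "integrable (lebesgue_on \<Omega>) (\<lambda>x. I \<phi> x - I w x - 2 * (grad w x \<bullet> weak_gradient \<Omega> h x + laplacian w x * h x))"
    by (intro Bochner_Integration.integrable_diff iI \<phi> w(2) integrable_mult_right EL(1))
  show "integrable (lebesgue_on \<Omega>) J"
    using integrable_cong_AE[OF borel_measurable_integrable[OF iL] Jm expand] iL by simp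
  have "(LINT x|lebesgue_on \<Omega>. J x) =
      (LINT x|lebesgue_on \<Omega>. I \<phi> x - I w x - 2 * (grad w x \<bullet> weak_gradient \<Omega> h x + laplacian w x * h x))"
    by (rule integral_cong_AE[symmetric, OF borel_measurable_integrable[OF iL] Jm expand])
  also have "\<dots> = (LINT x|lebesgue_on \<Omega>. I \<phi> x - I w x)
      - (LINT x|lebesgue_on \<Omega>. 2 * (grad w x \<bullet> weak_gradient \<Omega> h x + laplacian w x * h x))"
    by (intro Bochner_Integration.integral_diff Bochner_Integration.integrable_diff iI \<phi> w(2) integrable_mult_right EL(1))
  also have "\<dots> = R \<Omega> \<phi> v - R \<Omega> w v"
    unfolding RI integral_mult_right_zero Bochner_Integration.integral_diff[OF iI[OF \<phi>] iI[OF w(2)]]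
    using EL(2) by simp
  finally show "R \<Omega> \<phi> v = R \<Omega> w v + (LINT x|lebesgue_on \<Omega>. J x)" by simp
qed

end


section \<open>Bounds up to the boundary and the distance function\<close>

lemma extends_to_closure_bounded:
  fixes f :: "'a::euclidean_space \<Rightarrow> real"
  assumes "extends_to_closure \<Omega> f" "bounded \<Omega>"
  obtains B where "\<And>x. x \<in> \<Omega> \<Longrightarrow> \<bar>f x\<bar> \<le> B"
proof -
  obtain g where g: "continuous_on (closure \<Omega>) g" "\<forall>x\<in>\<Omega>. g x = f x"
    using assms(1) by (auto simp: extends_to_closure_def)
  have "compact (g ` closure \<Omega>)" using g(1) assms(2) by (intro compact_continuous_image) auto
  then have "bounded (g ` closure \<Omega>)" by (rule compact_imp_bounded)
  then obtain B where B: "\<forall>y\<in>g ` closure \<Omega>. norm y \<le> B" by (auto simp only: bounded_iff)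
  show ?thesis
  proof (rule that)
    fix x assume "x \<in> \<Omega>"
    then have "g x \<in> g ` closure \<Omega>" using closure_subset[of \<Omega>] by (intro imageI) (rule subsetD)
    then have "norm (g x) \<le> B" using B by (rule bspec[rotated])
    then show "\<bar>f x\<bar> \<le> B" using g(2) \<open>x \<in> \<Omega>\<close> by simp
  qed
qed

lemma C_holder_extends: "C_holder k \<alpha> \<Omega> f \<Longrightarrow> extends_to_closure \<Omega> f"
  by (cases k) auto

lemma C_holder_imp_C_diff: "C_holder k \<alpha> \<Omega> f \<Longrightarrow> C_diff k \<Omega> f"
proof (induction k arbitrary: f)
  case 0
  then obtain g where g: "continuous_on (closure \<Omega>) g" "\<forall>x\<in>\<Omega>. g x = f x"
    by (auto simp: extends_to_closure_def)
  have "continuous_on \<Omega> g" using g(1) closure_subset by (rule continuous_on_subset)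
  then show ?case using g(2) continuous_on_cong[of \<Omega> \<Omega> g f] by simp
qed auto

lemma C_holder_grad_bounded:
  assumes "C_holder (Suc k) \<alpha> \<Omega> f" "bounded \<Omega>"
  obtains G where "\<And>x. x \<in> \<Omega> \<Longrightarrow> norm (grad f x) \<le> G"
proof -
  have "\<exists>B. \<forall>x\<in>\<Omega>. \<bar>partial b f x\<bar> \<le> B" if "b \<in> Basis" for b
  proof -
    have "extends_to_closure \<Omega> (partial b f)" using assms(1) that by (auto intro: C_holder_extends)
    from extends_to_closure_bounded[OF this assms(2)] show ?thesis by metis
  qed
  then obtain B where B: "\<And>b x. b \<in> Basis \<Longrightarrow> x \<in> \<Omega> \<Longrightarrow> \<bar>partial b f x\<bar> \<le> B b" by metis
  have "norm (grad f x) \<le> (\<Sum>b\<in>Basis. B b)" if "x \<in> \<Omega>" for x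
  proof -
    have "norm (grad f x) \<le> (\<Sum>b\<in>Basis. \<bar>grad f x \<bullet> b\<bar>)" by (rule norm_le_l1)
    also have "\<dots> \<le> (\<Sum>b\<in>Basis. B b)" by (intro sum_mono) (simp add: B that)
    finally show ?thesis .
  qed
  then show ?thesis by (rule that)
qed

lemma C_holder_laplacian_bounded:
  assumes "C_holder 2 \<alpha> \<Omega> f" "bounded \<Omega>"
  obtains L where "\<And>x. x \<in> \<Omega> \<Longrightarrow> \<bar>laplacian f x\<bar> \<le> L"
proof -
  have "\<exists>B. \<forall>x\<in>\<Omega>. \<bar>partial b (partial b f) x\<bar> \<le> B" if "b \<in> Basis" for b
  proof -
    have "extends_to_closure \<Omega> (partial b (partial b f))"
      using assms(1) that by (simp add: numeral_2_eq_2)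
    from extends_to_closure_bounded[OF this assms(2)] show ?thesis by metis
  qed
  then obtain B where B: "\<And>b x. b \<in> Basis \<Longrightarrow> x \<in> \<Omega> \<Longrightarrow> \<bar>partial b (partial b f) x\<bar> \<le> B b" by metis
  have "\<bar>laplacian f x\<bar> \<le> (\<Sum>b\<in>Basis. B b)" if "x \<in> \<Omega>" for x
  proof -
    have "\<bar>laplacian f x\<bar> \<le> (\<Sum>b\<in>Basis. \<bar>partial b (partial b f) x\<bar>)"
      unfolding laplacian_def by (rule sum_abs)
    also have "\<dots> \<le> (\<Sum>b\<in>Basis. B b)" by (intro sum_mono) (simp add: B that)
    finally show ?thesis .
  qed
  then show ?thesis by (rule that)
qed

lemma bigo_bdryD:
  fixes f g :: "real^2 \<Rightarrow> real"
  assumes "f \<in> O[bdry \<Omega> d](g)"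
  shows "\<exists>c. \<exists>e>0. \<forall>x\<in>\<Omega>. 0 < d x \<longrightarrow> d x < e \<longrightarrow> \<bar>f x\<bar> \<le> c * \<bar>g x\<bar>"
  using assms
proof (rule landau_o.bigE)
  fix c assume "\<forall>\<^sub>F x in bdry \<Omega> d. norm (f x) \<le> c * norm (g x)"
  then have "\<exists>P. eventually P (at_right 0) \<and> (\<forall>x. P (d x) \<longrightarrow> x \<in> \<Omega> \<longrightarrow> norm (f x) \<le> c * norm (g x))"
    by (simp only: bdry_def eventually_inf_principal eventually_filtercomap)
  then show ?thesis
  proof (elim exE conjE)
    fix P assume P: "eventually P (at_right 0)" "\<forall>x. P (d x) \<longrightarrow> x \<in> \<Omega> \<longrightarrow> norm (f x) \<le> c * norm (g x)"
    have "\<exists>e>0. \<forall>t>0. t < e \<longrightarrow> P t"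
      by (rule iffD1[OF eventually_at_right_field P(1)])
    then show ?thesis
    proof (elim exE conjE)
      fix e assume e: "0 < e" "\<forall>t>0. t < e \<longrightarrow> P t"
      have "\<bar>f x\<bar> \<le> c * \<bar>g x\<bar>" if "x \<in> \<Omega>" "0 < d x" "d x < e" for x
        using spec[OF P(2), of x] spec[OF e(2), of "d x"] that by simp
      then show ?thesis using e(1) by (intro exI[of _ c] exI[of _ e]) simp
    qed
  qed
qed

text \<open>Away from the boundary \<open>f/g\<close> is continuous on a compact set, so a bound near the boundary extends to all of \<open>\<Omega>\<close>.\<close>

lemma bigo_bdry_global_bound:
  fixes f g :: "real^2 \<Rightarrow> real"
  assumes "f \<in> O[bdry \<Omega> d](g)" and K: "\<And>e. e > 0 \<Longrightarrow> compact {x \<in> \<Omega>. e \<le> d x}"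
    and "\<And>x. x \<in> \<Omega> \<Longrightarrow> 0 < d x" "\<And>x. x \<in> \<Omega> \<Longrightarrow> 0 < g x" "continuous_on \<Omega> f" "continuous_on \<Omega> g"
  obtains C where "\<And>x. x \<in> \<Omega> \<Longrightarrow> \<bar>f x\<bar> \<le> C * g x"
proof -
  obtain c e where e: "e > 0" "\<forall>x\<in>\<Omega>. 0 < d x \<longrightarrow> d x < e \<longrightarrow> \<bar>f x\<bar> \<le> c * \<bar>g x\<bar>"
    using bigo_bdryD[OF assms(1)] by blast
  let ?K = "{x \<in> \<Omega>. e \<le> d x}"
  have "continuous_on ?K f" "continuous_on ?K g"
    by (rule continuous_on_subset[OF assms(5)] continuous_on_subset[OF assms(6)], simp)+
  moreover have "g x \<noteq> 0" if "x \<in> ?K" for x using assms(4)[of x] that by simp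
  ultimately have "continuous_on ?K (\<lambda>x. f x / g x)" by (intro continuous_on_divide ballI)
  then have "compact ((\<lambda>x. f x / g x) ` ?K)" by (rule compact_continuous_image[OF _ K[OF e(1)]])
  then have "bounded ((\<lambda>x. f x / g x) ` ?K)" by (rule compact_imp_bounded)
  then obtain M where M: "\<forall>y\<in>(\<lambda>x. f x / g x) ` ?K. norm y \<le> M" by (auto simp only: bounded_iff)
  have "\<bar>f x\<bar> \<le> max c M * g x" if x: "x \<in> \<Omega>" for x
  proof (cases "d x < e")
    case True
    then have "\<bar>f x\<bar> \<le> c * g x" using bspec[OF e(2) x] assms(3)[OF x] abs_of_pos[OF assms(4)[OF x]] by simp
    also have "\<dots> \<le> max c M * g x" using assms(4)[OF x] by (intro mult_right_mono) auto
    finally show ?thesis .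
  next
    case False
    then have "f x / g x \<in> (\<lambda>x. f x / g x) ` ?K" using x by (intro imageI) simp
    then have "norm (f x / g x) \<le> M" by (rule bspec[OF M])
    then have "\<bar>f x\<bar> / g x \<le> M" using assms(4)[OF x] by simp
    then have "\<bar>f x\<bar> \<le> M * g x" using assms(4)[OF x] by (simp add: pos_divide_le_eq)
    also have "\<dots> \<le> max c M * g x" using assms(4)[OF x] by (intro mult_right_mono) auto
    finally show ?thesis .
  qed
  then show ?thesis by (rule that)
qed

text \<open>The set does not change when \<open>\<Omega>\<close> is replaced by its closure, as boundary points have distance zero.\<close>

lemma interior_compact:
  fixes \<Omega> :: "(real^2) set"
  assumes "open \<Omega>" "bounded \<Omega>" "\<Omega> \<noteq> {}" "\<delta> > 0"
  shows "compact {x \<in> \<Omega>. \<delta> \<le> infdist x (frontier \<Omega>)}"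
proof -
  have "{x \<in> \<Omega>. \<delta> \<le> infdist x (frontier \<Omega>)} = closure \<Omega> \<inter> {x. \<delta> \<le> infdist x (frontier \<Omega>)}"
  proof -
    have "x \<in> \<Omega>" if "x \<in> closure \<Omega>" "\<delta> \<le> infdist x (frontier \<Omega>)" for x
      using that assms(1,4) by (cases "x \<in> frontier \<Omega>") (auto simp: frontier_def interior_open)
    then show ?thesis using closure_subset by auto
  qed
  moreover have "compact (closure \<Omega>)" using assms(2) by simp
  moreover have "closed {x. \<delta> \<le> infdist x (frontier \<Omega>)}"
    by (intro closed_Collect_le continuous_intros)
  ultimately show ?thesis by (simp only: compact_Int_closed)
qed

text \<open>On the compact set of points at distance at least \<open>\<delta>\<close> from the boundary, \<open>d\<close> has a positive minimum.\<close>

lemma boundary_distance_small: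
  fixes \<Omega> :: "(real^2) set" and d :: "real^2 \<Rightarrow> real"
  assumes "open \<Omega>" "bounded \<Omega>" "\<Omega> \<noteq> {}" "\<delta> > 0" "continuous_on \<Omega> d" "\<And>x. x \<in> \<Omega> \<Longrightarrow> 0 < d x"
  obtains e where "e > 0" "\<And>x. x \<in> \<Omega> \<Longrightarrow> d x < e \<Longrightarrow> infdist x (frontier \<Omega>) < \<delta>"
proof -
  let ?K = "{x \<in> \<Omega>. \<delta> \<le> infdist x (frontier \<Omega>)}"
  show ?thesis
  proof (cases "?K = {}")
    case True
    then show ?thesis by (intro that[of 1]) (auto simp: not_le)
  next
    case False
    have "continuous_on ?K d" using assms(5) by (rule continuous_on_subset) auto
    then obtain z where z: "z \<in> ?K" "\<forall>x\<in>?K. d z \<le> d x"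
      using continuous_attains_inf[OF interior_compact[OF assms(1-4)] False] by blast
    show ?thesis
    proof (rule that[of "d z"])
      show "0 < d z" using z(1) assms(6) by simp
      show "infdist x (frontier \<Omega>) < \<delta>" if "x \<in> \<Omega>" "d x < d z" for x
      proof (rule ccontr)
        assume "\<not> infdist x (frontier \<Omega>) < \<delta>"
        then have "x \<in> ?K" using that by simp
        then show False using z(2) that(2) by force
      qed
    qed
  qed
qed

lemma superlevel_compact:
  fixes \<Omega> :: "(real^2) set"
  assumes "open \<Omega>" "bounded \<Omega>" "\<Omega> \<noteq> {}" "is_boundary_distance \<Omega> d" "continuous_on \<Omega> d" "e > 0"
  shows "compact {x \<in> \<Omega>. e \<le> d x}"
proof -
  obtain \<delta> where \<delta>: "\<delta> > 0" "\<And>x. x \<in> \<Omega> \<Longrightarrow> infdist x (frontier \<Omega>) < \<delta> \<Longrightarrow> d x = infdist x (frontier \<Omega>)"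
    using assms(4) by (auto simp: is_boundary_distance_def)
  let ?K = "{x \<in> \<Omega>. min \<delta> e \<le> infdist x (frontier \<Omega>)}"
  have K: "compact ?K" using \<delta>(1) assms(6) by (intro interior_compact assms) auto
  have "continuous_on ?K d" using assms(5) by (rule continuous_on_subset) auto
  then have "closed (?K \<inter> d -` {e..})"
    by (rule continuous_closed_preimage[OF _ compact_imp_closed[OF K]]) simp
  then have "compact (?K \<inter> (?K \<inter> d -` {e..}))" by (rule compact_Int_closed[OF K])
  moreover have "?K \<inter> (?K \<inter> d -` {e..}) = {x \<in> \<Omega>. e \<le> d x}"
  proof -
    have "min \<delta> e \<le> infdist x (frontier \<Omega>)" if "x \<in> \<Omega>" "e \<le> d x" for x
      using \<delta>(2)[OF that(1)] that(2) by linarith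
    then show ?thesis by auto
  qed
  ultimately show ?thesis by simp
qed

text \<open>On the segment from \<open>x\<close> to a nearest boundary point the distance to the boundary decreases at unit rate, so the
  derivative of \<open>d\<close> in that direction is \<open>-1\<close>.\<close>

lemma boundary_distance_grad:
  fixes \<Omega> :: "(real^2) set"
  assumes "open \<Omega>" "bounded \<Omega>" "x \<in> \<Omega>" "d differentiable (at x)"
    and \<delta>: "\<And>x. x \<in> \<Omega> \<Longrightarrow> infdist x (frontier \<Omega>) < \<delta> \<Longrightarrow> d x = infdist x (frontier \<Omega>)"
    and "infdist x (frontier \<Omega>) < \<delta>"
  shows "1 \<le> norm (grad d x)"
proof -
  let ?F = "frontier \<Omega>"
  have "\<Omega> \<noteq> UNIV" using assms(2) not_bounded_UNIV by auto
  then have ne: "?F \<noteq> {}" using assms(3) frontier_not_empty by blast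
  obtain y where y: "y \<in> ?F" "infdist x ?F = dist x y"
    using infdist_attains_inf[OF frontier_closed ne] by blast
  define r where "r = dist x y"
  have "x \<notin> ?F" using assms(1,3) by (simp add: frontier_def interior_open)
  then have r: "r > 0" using y(1) by (auto simp: r_def)
  have val: "d (x + t *\<^sub>R (y - x)) = (1 - t) * r" if "x + t *\<^sub>R (y - x) \<in> \<Omega>" "0 \<le> t" "t < 1" for t
  proof -
    let ?z = "x + t *\<^sub>R (y - x)"
    have dz: "dist x ?z = t * r" using that by (simp add: dist_norm r_def norm_minus_commute)
    have "?z - y = (1 - t) *\<^sub>R (x - y)" by (simp add: algebra_simps)
    then have zy: "dist ?z y = (1 - t) * r" using that by (simp add: dist_norm r_def)
    have "infdist ?z ?F \<le> (1 - t) * r" using infdist_le[OF y(1), of ?z] zy by simp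
    moreover have "r \<le> infdist ?z ?F + t * r"
      using infdist_triangle[of x ?F ?z] y(2) dz by (simp add: r_def)
    ultimately have eq: "infdist ?z ?F = (1 - t) * r" by (simp add: algebra_simps)
    have "(1 - t) * r \<le> r" using that r by (simp add: algebra_simps)
    then have "infdist ?z ?F < \<delta>" using eq y(2) assms(6) by (simp add: r_def)
    then show ?thesis using \<delta>[OF that(1)] eq by simp
  qed
  have "((\<lambda>t. x + t *\<^sub>R (y - x)) \<longlongrightarrow> x + 0 *\<^sub>R (y - x)) (at_right 0)"
    by (intro tendsto_intros)
  then have "\<forall>\<^sub>F t in at_right 0. x + t *\<^sub>R (y - x) \<in> \<Omega>"
    using assms(1,3) topological_tendstoD[of _ x] by simp
  moreover have "\<forall>\<^sub>F t in at_right (0::real). t \<in> {0<..<1}" by (rule eventually_at_right_real) simp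
  ultimately have "\<forall>\<^sub>F t in at_right 0. (d (x + t *\<^sub>R (y - x)) - d x) / t = - r"
  proof eventually_elim
    case (elim t)
    then show ?case using val[of t] val[of 0] assms(3) by (simp add: field_simps)
  qed
  then have l1: "((\<lambda>t. (d (x + t *\<^sub>R (y - x)) - d x) / t) \<longlongrightarrow> - r) (at_right 0)"
    by (rule tendsto_eventually)
  have "((\<lambda>t. d (x + t *\<^sub>R (y - x))) has_real_derivative partial (y - x) d (x + 0 *\<^sub>R (y - x))) (at 0)"
    by (rule has_real_derivative_along_line) (use assms(4) in simp)
  then have "((\<lambda>t. (d (x + t *\<^sub>R (y - x)) - d x) / t) \<longlongrightarrow> partial (y - x) d x) (at 0)"
    by (simp add: has_field_derivative_iff)
  then have l2: "((\<lambda>t. (d (x + t *\<^sub>R (y - x)) - d x) / t) \<longlongrightarrow> partial (y - x) d x) (at_right 0)"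
    by (simp add: filterlim_at_split)
  have "partial (y - x) d x = - r"
    by (rule tendsto_unique[OF trivial_limit_at_right_real l2 l1])
  then have "r = \<bar>grad d x \<bullet> (y - x)\<bar>" using partial_eq_grad_inner[OF assms(4)] r by simp
  also have "\<dots> \<le> norm (grad d x) * r"
    using Cauchy_Schwarz_ineq2[of "grad d x" "y - x"] by (simp add: r_def dist_norm norm_minus_commute)
  finally show ?thesis using r by simp
qed


section \<open>Minimality of the maximal solution\<close>

theorem theorem3:
  fixes \<alpha> :: real and \<Omega> :: "(real^2) set" and d u v w :: "real^2 \<Rightarrow> real"
  assumes "0 < \<alpha>" "\<alpha> < 1"
    and "bounded \<Omega>" "holder_domain 2 \<alpha> \<Omega>"
    and "C_holder 2 \<alpha> \<Omega> d" "is_boundary_distance \<Omega> d"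
    and "maximal_liouville_solution \<Omega> u"
    and "\<forall>x\<in>\<Omega>. u x = v x + w x"
    and P1: "C_holder 1 \<alpha> \<Omega> w" "C_diff 2 \<Omega> w"
    and P2: "w \<in> O[bdry \<Omega> d](d)"
    and P3: "(\<lambda>x. exp (v x)) \<in> O[bdry \<Omega> d](\<lambda>x. 1 / d x)"
    and P4: "liouville_residual v \<in> O[bdry \<Omega> d](\<lambda>x. 1 / d x)"
  shows "u \<in> plus_H1_0 \<Omega> v \<and>
    bdd_below ((\<lambda>\<psi>. R \<Omega> (\<lambda>x. \<psi> x - v x) v) ` plus_H1_0 \<Omega> v) \<and>
    (\<forall>\<psi>\<in>plus_H1_0 \<Omega> v.
       R \<Omega> (\<lambda>x. \<psi> x - v x) v = (INF \<psi>'\<in>plus_H1_0 \<Omega> v. R \<Omega> (\<lambda>x. \<psi>' x - v x) v)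
       \<longleftrightarrow> (AE x in lebesgue_on \<Omega>. \<psi> x = u x))"
proof -
  have \<Omega>: "open \<Omega>" "\<Omega> \<noteq> {}" using assms(4) by (auto simp: holder_domain_def)
  note bnd = \<open>bounded \<Omega>\<close>
  have u: "C_diff 2 \<Omega> u" "\<And>x. x \<in> \<Omega> \<Longrightarrow> liouville_residual u x = 0"
    using assms(7) by (auto simp: maximal_liouville_solution_def liouville_solution_def)
  have uvw: "u x = v x + w x" if "x \<in> \<Omega>" for x using assms(8) that by blast
  have d_C2: "C_diff 2 \<Omega> d" by (rule C_holder_imp_C_diff[OF assms(5)])
  have cd: "continuous_on \<Omega> d" by (rule C_diff_continuous_on[OF d_C2])
  have d_diff: "d differentiable (at x)" if "x \<in> \<Omega>" for x
    using C_diff_differentiable_at[of 1 \<Omega> d] d_C2 \<Omega>(1) that by (simp add: numeral_2_eq_2)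
  have d_pos: "0 < d x" if "x \<in> \<Omega>" for x
    using assms(6) that by (auto simp: is_boundary_distance_def)
  obtain \<delta> where \<delta>: "\<delta> > 0" "\<And>x. x \<in> \<Omega> \<Longrightarrow> infdist x (frontier \<Omega>) < \<delta> \<Longrightarrow> d x = infdist x (frontier \<Omega>)"
    using assms(6) by (auto simp: is_boundary_distance_def)
  obtain \<epsilon> where \<epsilon>: "\<epsilon> > 0" "\<And>x. x \<in> \<Omega> \<Longrightarrow> d x < \<epsilon> \<Longrightarrow> infdist x (frontier \<Omega>) < \<delta>"
    using boundary_distance_small[OF \<Omega>(1) bnd \<Omega>(2) \<delta>(1) cd d_pos] by blast
  obtain D where D: "\<And>x. x \<in> \<Omega> \<Longrightarrow> norm (grad d x) \<le> D"
    using C_holder_grad_bounded[OF _ bnd, of 1 \<alpha> d] assms(5) by (metis One_nat_def numeral_2_eq_2)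
  obtain L where L: "\<And>x. x \<in> \<Omega> \<Longrightarrow> \<bar>laplacian d x\<bar> \<le> L"
    using C_holder_laplacian_bounded[OF assms(5) bnd] by blast
  interpret planar_boundary_function \<Omega> d D L \<epsilon>
    by unfold_locales (use \<Omega>(1) d_C2 d_pos D L \<epsilon>(1) in \<open>auto intro!: boundary_distance_grad[OF \<Omega>(1) bnd _ d_diff \<delta>(2) \<epsilon>(2)]\<close>)
  have K: "compact {x \<in> \<Omega>. e \<le> d x}" if "e > 0" for e
    by (rule superlevel_compact[OF \<Omega>(1) bnd \<Omega>(2) assms(6) cd that])
  have w1: "C_diff 1 \<Omega> w" using C_diff_le[of 1 2, OF _ P1(2)] by simp
  have cw: "continuous_on \<Omega> w" by (rule C_diff_continuous_on[OF w1])
  obtain B where B: "\<And>x. x \<in> \<Omega> \<Longrightarrow> \<bar>w x\<bar> \<le> B"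
    using extends_to_closure_bounded[OF C_holder_extends[OF P1(1)] bnd] by blast
  obtain G where G: "\<And>x. x \<in> \<Omega> \<Longrightarrow> norm (grad w x) \<le> G"
    using C_holder_grad_bounded[OF _ bnd, of 0 \<alpha> w] P1(1) by (metis One_nat_def)
  have cv: "continuous_on \<Omega> v"
    using continuous_on_diff[OF C_diff_continuous_on[OF u(1)] cw] by (rule continuous_on_eq) (simp add: uvw)
  have cr: "continuous_on \<Omega> (liouville_residual v)"
  proof -
    have "laplacian v x = laplacian u x - laplacian w x" if "x \<in> \<Omega>" for x
      by (rule laplacian_diff[OF \<Omega>(1) u(1) P1(2) that]) (simp add: uvw)
    moreover have "continuous_on \<Omega> (\<lambda>x. - (laplacian u x - laplacian w x) + 4 * exp (2 * v x))"
      by (intro continuous_intros cv C2_laplacian_continuous u(1) P1(2))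
    ultimately show ?thesis by (elim continuous_on_eq) (simp add: liouville_residual_def)
  qed
  have inv: "0 < 1 / d x" if "x \<in> \<Omega>" for x using d_pos[OF that] by simp
  have cinv: "continuous_on \<Omega> (\<lambda>x. 1 / d x)"
    by (intro continuous_intros cd) (auto dest: d_pos)
  obtain C where C: "\<And>x. x \<in> \<Omega> \<Longrightarrow> \<bar>w x\<bar> \<le> C * d x"
    using bigo_bdry_global_bound[OF P2 K d_pos d_pos cw cd] by blast
  obtain Cv where Cv: "\<And>x. x \<in> \<Omega> \<Longrightarrow> \<bar>exp (v x)\<bar> \<le> Cv * (1 / d x)"
    using bigo_bdry_global_bound[OF P3 K d_pos inv continuous_on_exp[OF cv] cinv] by blast
  obtain Cr where Cr: "\<And>x. x \<in> \<Omega> \<Longrightarrow> \<bar>liouville_residual v x\<bar> \<le> Cr * (1 / d x)"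
    using bigo_bdry_global_bound[OF P4 K d_pos inv cr cinv] by blast
  have ev: "exp (v x) \<le> Cv / d x" if "x \<in> \<Omega>" for x using Cv[OF that] by simp
  have rv: "\<bar>liouville_residual v x\<bar> \<le> Cr / d x" if "x \<in> \<Omega>" for x using Cr[OF that] by simp
  \<comment> \<open>Functions are given on the whole plane, while \<open>u = v + w\<close> holds on \<open>\<Omega>\<close> only. To have \<open>u\<close> itself in
    \<open>v + H\<^sup>1\<^sub>0(\<Omega>)\<close>, the function \<open>w\<close> is replaced by \<open>u - v\<close>, which agrees with it on \<open>\<Omega>\<close>.\<close>
  define w' where "w' x = u x - v x" for x
  have w'w: "w' x = w x" if "x \<in> \<Omega>" for x using uvw[OF that] by (simp add: w'_def)
  have w': "C_diff 2 \<Omega> w'" by (rule C_diff_cong[OF \<Omega>(1) P1(2)]) (simp add: w'w)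
  have w'1: "C_diff 1 \<Omega> w'" by (rule C_diff_cong[OF \<Omega>(1) w1]) (simp add: w'w)
  have w'B: "\<bar>w' x\<bar> \<le> B" "\<bar>w' x\<bar> \<le> C * d x" if "x \<in> \<Omega>" for x using B[OF that] C[OF that] w'w[OF that] by simp_all
  have w'G: "norm (grad w' x) \<le> G" if "x \<in> \<Omega>" for x
    using G[OF that] grad_cong[OF \<Omega>(1) that w'w] by simp
  have wH: "w' \<in> H1_0 \<Omega>"
    by (rule H1_0_if_vanishing[OF w'1 K bnd \<Omega>(2) w'B(2,1) w'G])
  have uvw': "u x = v x + w' x" for x by (simp add: w'_def)
  define J where "J \<phi> x = (norm (weak_gradient \<Omega> (\<lambda>x. \<phi> x - w' x) x))\<^sup>2
    + 4 * exp (2 * u x) * (exp (2 * (\<phi> x - w' x)) - 1 - 2 * (\<phi> x - w' x))" for \<phi> x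
  have J0: "0 \<le> J \<phi> x" for \<phi> x
    unfolding J_def using exp_taylor2_nonneg[of "2 * (\<phi> x - w' x)"] by (intro add_nonneg_nonneg mult_nonneg_nonneg) auto
  have iJ: "integrable (lebesgue_on \<Omega>) (J \<phi>)"
    and RJ: "R \<Omega> \<phi> v = R \<Omega> w' v + (LINT x|lebesgue_on \<Omega>. J \<phi> x)" if "\<phi> \<in> H1_0 \<Omega>" for \<phi>
    using R_expansion[OF bnd u w' wH uvw' w'B w'G ev rv that] by (simp_all add: J_def[abs_def])
  have le: "R \<Omega> w' v \<le> R \<Omega> \<phi> v" if "\<phi> \<in> H1_0 \<Omega>" for \<phi>
    unfolding RJ[OF that] using J0 by (simp add: Bochner_Integration.integral_nonneg)
  have eq_iff: "R \<Omega> \<phi> v = R \<Omega> w' v \<longleftrightarrow> (AE x in lebesgue_on \<Omega>. \<phi> x = w' x)" if "\<phi> \<in> H1_0 \<Omega>" for \<phi>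
  proof -
    have h: "(\<lambda>x. \<phi> x - w' x) \<in> H1_0 \<Omega>" by (rule H1_0_diff[OF \<Omega>(1) that wH])
    have "R \<Omega> \<phi> v = R \<Omega> w' v \<longleftrightarrow> (LINT x|lebesgue_on \<Omega>. J \<phi> x) = 0"
      unfolding RJ[OF that] by simp
    also have "\<dots> \<longleftrightarrow> (AE x in lebesgue_on \<Omega>. J \<phi> x = 0)"
      by (rule integral_nonneg_eq_0_iff_AE[OF iJ[OF that]]) (simp add: J0)
    also have "\<dots> \<longleftrightarrow> (AE x in lebesgue_on \<Omega>. \<phi> x = w' x)"
    proof
      assume "AE x in lebesgue_on \<Omega>. J \<phi> x = 0"
      then show "AE x in lebesgue_on \<Omega>. \<phi> x = w' x"
      proof eventually_elim
        case (elim x)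
        have E: "0 \<le> exp (2 * (\<phi> x - w' x)) - 1 - 2 * (\<phi> x - w' x)" by (rule exp_taylor2_nonneg)
        then have "0 \<le> 4 * exp (2 * u x) * (exp (2 * (\<phi> x - w' x)) - 1 - 2 * (\<phi> x - w' x))" by (intro mult_nonneg_nonneg) auto
        then have "4 * exp (2 * u x) * (exp (2 * (\<phi> x - w' x)) - 1 - 2 * (\<phi> x - w' x)) = 0"
          using elim zero_le_power2[of "norm (weak_gradient \<Omega> (\<lambda>x. \<phi> x - w' x) x)"] unfolding J_def by linarith
        then have "exp (2 * (\<phi> x - w' x)) - 1 - 2 * (\<phi> x - w' x) = 0"
          by (simp only: mult_eq_0_iff exp_not_eq_zero) simp
        then show ?case using exp_taylor2_eq_0 by fastforce
      qed
    next
      assume *: "AE x in lebesgue_on \<Omega>. \<phi> x = w' x"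
      then have "AE x in lebesgue_on \<Omega>. \<phi> x - w' x = 0" by eventually_elim simp
      then have "AE x in lebesgue_on \<Omega>. weak_gradient \<Omega> (\<lambda>x. \<phi> x - w' x) x = 0"
        by (rule weak_gradient_zero[OF \<Omega>(1) H1_0_D(2)[OF \<Omega>(1) h]])
      with * show "AE x in lebesgue_on \<Omega>. J \<phi> x = 0"
        by eventually_elim (simp add: J_def)
    qed
    finally show ?thesis .
  qed
  let ?F = "\<lambda>\<psi>. R \<Omega> (\<lambda>x. \<psi> x - v x) v"
  have u_mem: "u \<in> plus_H1_0 \<Omega> v"
  proof -
    have "u = (\<lambda>x. v x + w' x)" by (rule ext) (rule uvw')
    then show ?thesis unfolding plus_H1_0_def using wH by blast
  qed
  have Fu: "?F u = R \<Omega> w' v" by (simp add: w'_def[abs_def])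
  have lower: "?F u \<le> ?F \<psi>" if mem: "\<psi> \<in> plus_H1_0 \<Omega> v" for \<psi>
  proof -
    obtain \<phi> where "\<phi> \<in> H1_0 \<Omega>" "\<psi> = (\<lambda>x. v x + \<phi> x)" using mem unfolding plus_H1_0_def by blast
    then show ?thesis using le[of \<phi>] unfolding Fu by simp
  qed
  have INF: "(INF \<psi>'\<in>plus_H1_0 \<Omega> v. ?F \<psi>') = ?F u"
    by (rule cInf_eq_minimum) (use u_mem lower in auto)
  have "?F \<psi> = (INF \<psi>'\<in>plus_H1_0 \<Omega> v. ?F \<psi>') \<longleftrightarrow> (AE x in lebesgue_on \<Omega>. \<psi> x = u x)"
    if mem: "\<psi> \<in> plus_H1_0 \<Omega> v" for \<psi>
  proof -
    obtain \<phi> where \<phi>: "\<phi> \<in> H1_0 \<Omega>" "\<psi> = (\<lambda>x. v x + \<phi> x)" using mem unfolding plus_H1_0_def by blast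
    have "?F \<psi> = R \<Omega> \<phi> v" by (simp add: \<phi>(2))
    moreover have "(\<psi> x = u x) = (\<phi> x = w' x)" for x by (auto simp: \<phi>(2) w'_def)
    ultimately show ?thesis unfolding INF Fu using eq_iff[OF \<phi>(1)] by simp
  qed
  moreover have "bdd_below (?F ` plus_H1_0 \<Omega> v)"
    by (rule bdd_belowI2[of _ "?F u"]) (rule lower)
  ultimately show ?thesis using u_mem by blast
qed

end
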